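(* Let $\delta > 0$ and $\epsilon > 0$ be fixed. There is a constant $C = C(\delta,\epsilon)$ such that the following holds for all $n \ge 2$ and all $p = p(n) \in [0,1]$ with $$p \ge \frac{(\frac12 + \delta)\log n}{n}.$$ Let $d = p(n-1)$, and let $\tilde G$ be the largest connected component of the Erdős–Rényi random graph $G(n,p)$. Then $$\lambda(\tilde G) < \frac{C}{\sqrt d}$$ with probability at least $1 - Cn\exp(-(2-\epsilon)d) - C\exp(-d^{1/4}\log n)$.
   Context: $G(n,p)$ is the random graph on $n$ vertices in which each of the $\binom n2$ edges is included independently with probability $p$; $d=p(n-1)$ is the expected degree of a vertex. The giant component $\tilde G$ is the largest connected component of $G(n,p)$ (ties, which do not occur with high probability for $p=\omega(1/n)$, may be broken arbitrarily). For a finite graph $G$ with adjacency matrix $A$ and diagonal degree matrix $T$, the normalized Laplacian is $L = \pi_+ - T^{-1/2} A T^{-1/2}$, where $\pi_+$ is the coordinate projection onto the vertices of positive degree and $T^{-1/2}$ is taken to be $0$ in coordinates where the degree is $0$. Its eigenvalues (with multiplicity) are $0=\lambda_1 \le \lambda_2 \le \dots \le \lambda_{|V(G)|} \le 2$. Define $\lambda(G) = \max_{i\neq 1} |1-\lambda_i|$. *)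

theory Defs
  imports
    "HOL-Probability.Product_PMF"
    "Jordan_Normal_Form.Char_Poly"
begin

text \<open>
  A finite simple graph is given by its vertex set \<open>V\<close> and its edge set \<open>E\<close>, the edges being
  two-element subsets of \<open>V\<close>.
\<close>

definition degree_of :: "'a set \<Rightarrow> 'a set set \<Rightarrow> 'a \<Rightarrow> nat" where
  "degree_of V E v = card {u \<in> V. {u, v} \<in> E}"

definition induced_edges :: "'a set set \<Rightarrow> 'a set \<Rightarrow> 'a set set" where
  "induced_edges E U = {e \<in> E. e \<subseteq> U}"

definition components :: "'a set \<Rightarrow> 'a set set \<Rightarrow> 'a set set" where
  "components V E = V // {(u, v). u \<in> V \<and> v \<in> V \<and> (u, v) \<in> {(x, y). {x, y} \<in> E}\<^sup>*}"

text \<open>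
  Several components may have maximal size, so this is a predicate on vertex sets.
\<close>

definition largest_component :: "'a set \<Rightarrow> 'a set set \<Rightarrow> 'a set \<Rightarrow> bool" where
  "largest_component V E U \<longleftrightarrow>
     U \<in> components V E \<and> (\<forall>W \<in> components V E. card W \<le> card U)"

lemma largest_component_exists:
  assumes "finite V" "V \<noteq> {}"
  shows "\<exists>U. largest_component V E U"
proof -
  let ?r = "{(u, v). u \<in> V \<and> v \<in> V \<and> (u, v) \<in> {(x, y). {x, y} \<in> E}\<^sup>*}"
  have fin: "finite (components V E)"
    unfolding components_def by (rule finite_quotient) (use assms in auto)
  have ne: "components V E \<noteq> {}"
    unfolding components_def quotient_def using assms by auto
  have "Max (card ` components V E) \<in> card ` components V E"
    using fin ne by (intro Max_in) auto
  then obtain U where U: "U \<in> components V E" "card U = Max (card ` components V E)"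
    by auto
  then have "\<forall>W \<in> components V E. card W \<le> card U"
    using fin by auto
  with U show ?thesis unfolding largest_component_def by blast
qed

text \<open>
  The matrices are indexed by \<open>{..<card V}\<close> through the increasing enumeration of \<open>V\<close>.
  Reordering the vertices conjugates them by a permutation matrix, so the spectrum does not
  depend on this choice.
\<close>

definition vertex :: "'a::linorder set \<Rightarrow> nat \<Rightarrow> 'a" where
  "vertex V i = sorted_list_of_set V ! i"

definition adjacency_matrix :: "'a::linorder set \<Rightarrow> 'a set set \<Rightarrow> real mat" where
  "adjacency_matrix V E = Matrix.mat (card V) (card V)
     (\<lambda>(i, j). if {vertex V i, vertex V j} \<in> E then 1 else 0)"

definition inv_sqrt_degree_matrix :: "'a::linorder set \<Rightarrow> 'a set set \<Rightarrow> real mat" where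
  "inv_sqrt_degree_matrix V E = mat_diag (card V)
     (\<lambda>i. if degree_of V E (vertex V i) = 0 then 0
          else 1 / sqrt (real (degree_of V E (vertex V i))))"

definition positive_degree_projection :: "'a::linorder set \<Rightarrow> 'a set set \<Rightarrow> real mat" where
  "positive_degree_projection V E = mat_diag (card V)
     (\<lambda>i. if degree_of V E (vertex V i) > 0 then 1 else 0)"

definition normalized_laplacian :: "'a::linorder set \<Rightarrow> 'a set set \<Rightarrow> real mat" where
  "normalized_laplacian V E =
     positive_degree_projection V E
       - inv_sqrt_degree_matrix V E * adjacency_matrix V E * inv_sqrt_degree_matrix V E"

text \<open>
  Eigenvalues with algebraic multiplicity, in increasing order.  The Laplacian is real symmetric,
  so its characteristic polynomial splits over the reals and the list has length \<open>card V\<close>;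
  algebraic and geometric multiplicities agree.
\<close>

definition laplacian_eigenvalues :: "'a::linorder set \<Rightarrow> 'a set set \<Rightarrow> real list" where
  "laplacian_eigenvalues V E =
     sorted_list_of_multiset (proots (char_poly (normalized_laplacian V E)))"

text \<open>
  List positions start at 0, so position 0 holds the smallest eigenvalue and is the one left out
  of the maximum.  For a single vertex the maximum ranges over the empty set and is read as 0.
\<close>

definition spectral_lambda :: "'a::linorder set \<Rightarrow> 'a set set \<Rightarrow> real" where
  "spectral_lambda V E =
     (if card V \<le> 1 then 0
      else Max ((\<lambda>i. \<bar>1 - laplacian_eigenvalues V E ! i\<bar>) ` {1..<card V}))"

definition vertex_pairs :: "nat \<Rightarrow> nat set set" where
  "vertex_pairs n = {e. e \<subseteq> {..<n} \<and> card e = 2}"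

text \<open>
  The distribution of the random edge set of \<open>G(n,p)\<close> on the vertex set \<open>{..<n}\<close>.
\<close>

definition gnp :: "nat \<Rightarrow> real \<Rightarrow> nat set set pmf" where
  "gnp n p = map_pmf (\<lambda>f. {e \<in> vertex_pairs n. f e})
     (Pi_pmf (vertex_pairs n) False (\<lambda>_. bernoulli_pmf p))"

end

theory Submission
  imports
    Defs
    "HOL-Probability.Hoeffding"
    "Jordan_Normal_Form.Schur_Decomposition"
begin

text \<open>
  Let \<open>X\<close> be the adjacency matrix of \<open>G(n,p)\<close> with its off-diagonal entries centred.

  The operator norm of \<open>X\<close> is \<open>O(sqrt d)\<close> except with probability at most \<open>n * exp (- 2 * d)\<close>.
  With \<open>k\<close> close to \<open>n * p\<close>, the trace of \<open>X ^ (2 * k)\<close> is a sum over closed walks, of which only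
  those traversing every edge at least twice have nonzero expectation; such a walk visits at most
  \<open>k + 1\<close> vertices.  Grouping the walks by the set of visited vertices compares the expected trace,
  up to the factor \<open>n / (2 * k)\<close>, with that of a dense \<open>2 * k\<close> by \<open>2 * k\<close> matrix whose entries are
  \<open>2\<close> with probability \<open>1/3\<close> and \<open>-1\<close> otherwise (mean \<open>0\<close> and all higher moments at least \<open>1\<close>).
  The norm of the dense matrix is controlled by a lattice net and subgaussian moments.

  A Chernoff bound shows that, except with probability \<open>O(n * exp (- (2 - \<epsilon>) * d))\<close>, no two vertices of
  degree less than \<open>\<eta> * d\<close> are adjacent or have a common neighbour.

  On these two events every vector \<open>f\<close> orthogonal to \<open>sqrt deg\<close> satisfies
  \<open>\<bar>\<langle>f, T^(-1/2) A T^(-1/2) f\<rangle>\<bar> \<le> C / sqrt d * \<parallel>f\<parallel>^2\<close>: split \<open>f\<close> into its parts on vertices of high and of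
  low degree.  Low-low terms vanish, the mixed terms are bounded because every vertex has at most one
  neighbour of low degree, and on the high part the norm bound for \<open>X\<close> applies once the mean is
  controlled through the orthogonality.  A vector supported on a component and orthogonal to
  \<open>sqrt deg\<close> there is orthogonal to \<open>sqrt deg\<close> on the whole graph, so the bound passes to every
  component, in particular to the largest one.
\<close>

section \<open>Traces and operator norms\<close>

definition sqn :: "nat \<Rightarrow> (nat \<Rightarrow> real) \<Rightarrow> real" where
  "sqn N v = (\<Sum>i<N. (v i)\<^sup>2)"

definition dotp :: "nat \<Rightarrow> (nat \<Rightarrow> real) \<Rightarrow> (nat \<Rightarrow> real) \<Rightarrow> real" where
  "dotp N u v = (\<Sum>i<N. u i * v i)"

definition matvec :: "nat \<Rightarrow> (nat \<Rightarrow> nat \<Rightarrow> real) \<Rightarrow> (nat \<Rightarrow> real) \<Rightarrow> nat \<Rightarrow> real" where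
  "matvec N X v i = (\<Sum>j<N. X i j * v j)"

definition kron :: "nat \<Rightarrow> nat \<Rightarrow> real" where
  "kron a i = (if i = a then 1 else 0)"

lemma sqn_nonneg [simp]: "sqn N v \<ge> 0"
  by (simp add: sqn_def sum_nonneg)

lemma sqn_eq_dotp: "sqn N v = dotp N v v"
  by (simp add: sqn_def dotp_def power2_eq_square)

lemma dotp_commute: "dotp N u v = dotp N v u"
  by (simp add: dotp_def mult.commute)

lemma dotp_squared_le: "(dotp N u v)\<^sup>2 \<le> sqn N u * sqn N v"
  unfolding dotp_def sqn_def by (rule Cauchy_Schwarz_ineq_sum)

lemma abs_dotp_le: "\<bar>dotp N u v\<bar> \<le> sqrt (sqn N u) * sqrt (sqn N v)"
  using dotp_squared_le[of N u v] by (metis real_le_rsqrt real_sqrt_abs real_sqrt_le_iff real_sqrt_mult)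

lemma sqn_kron: "a < N \<Longrightarrow> sqn N (kron a) = 1"
  by (simp add: sqn_def kron_def if_distrib[of "\<lambda>x. x\<^sup>2"] cong: if_cong)

lemma dotp_kron: "a < N \<Longrightarrow> dotp N (kron a) v = v a"
  by (simp add: dotp_def kron_def if_distrib[of "\<lambda>x. x * _"] cong: if_cong)

lemma component_squared_le_sqn: "i < N \<Longrightarrow> (v i)\<^sup>2 \<le> sqn N v"
  unfolding sqn_def by (rule member_le_sum) auto

lemma dotp_matvec:
  assumes "\<And>i j. X i j = X j i"
  shows "dotp N u (matvec N X v) = dotp N (matvec N X u) v"
proof -
  have "dotp N u (matvec N X v) = (\<Sum>i<N. \<Sum>j<N. u i * X i j * v j)"
    by (simp add: dotp_def matvec_def sum_distrib_left mult.assoc)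
  also have "\<dots> = (\<Sum>j<N. \<Sum>i<N. u i * X i j * v j)" by (rule sum.swap)
  also have "\<dots> = dotp N (matvec N X u) v"
    unfolding dotp_def matvec_def sum_distrib_right
    by (intro sum.cong refl) (metis assms mult.commute)
  finally show ?thesis .
qed

lemma dotp_matvec_funpow:
  assumes "\<And>i j. X i j = X j i"
  shows "dotp N u ((matvec N X ^^ k) v) = dotp N ((matvec N X ^^ k) u) v"
proof (induction k arbitrary: u)
  case (Suc k)
  have "dotp N u ((matvec N X ^^ Suc k) v) = dotp N (matvec N X u) ((matvec N X ^^ k) v)"
    by (simp add: dotp_matvec[OF assms])
  also have "\<dots> = dotp N ((matvec N X ^^ Suc k) u) v"
    by (simp add: Suc funpow_swap1)
  finally show ?case .
qed simp

lemma matvec_sum: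
  "matvec N X (\<lambda>j. \<Sum>a<M. c a * w a j) = (\<lambda>i. \<Sum>a<M. c a * matvec N X (w a) i)"
proof
  fix i
  have "matvec N X (\<lambda>j. \<Sum>a<M. c a * w a j) i = (\<Sum>j<N. \<Sum>a<M. c a * (X i j * w a j))"
    by (simp add: matvec_def sum_distrib_left mult_ac)
  also have "\<dots> = (\<Sum>a<M. c a * matvec N X (w a) i)"
    unfolding matvec_def sum_distrib_left by (rule sum.swap)
  finally show "matvec N X (\<lambda>j. \<Sum>a<M. c a * w a j) i = \<dots>" .
qed

lemma matvec_cong: "(\<And>j. j < N \<Longrightarrow> v j = w j) \<Longrightarrow> matvec N X v = matvec N X w"
  by (auto simp: matvec_def)

lemma matvec_funpow_expand:
  assumes "i < N"
  shows "(matvec N X ^^ k) v i = (\<Sum>a<N. v a * (matvec N X ^^ k) (kron a) i)"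
  using assms
proof (induction k arbitrary: i)
  case 0
  have "(\<Sum>a<N. v a * kron a i) = (\<Sum>a<N. if a = i then v a else 0)"
    by (intro sum.cong) (auto simp: kron_def)
  then show ?case using 0 by simp
next
  case (Suc k)
  have "matvec N X ((matvec N X ^^ k) v) =
      matvec N X (\<lambda>i. \<Sum>a<N. v a * (matvec N X ^^ k) (kron a) i)"
    by (rule matvec_cong) (rule Suc.IH)
  then show ?case by (simp add: matvec_sum)
qed

lemma sqn_matvec_funpow_le:
  assumes "\<And>v. sqn N (matvec N X v) \<le> s * sqn N v" "s \<ge> 0"
  shows "sqn N ((matvec N X ^^ k) v) \<le> s ^ k * sqn N v"
proof (induction k)
  case (Suc k)
  have "sqn N ((matvec N X ^^ Suc k) v) \<le> s * sqn N ((matvec N X ^^ k) v)"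
    using assms(1) by simp
  also have "\<dots> \<le> s * (s ^ k * sqn N v)"
    using Suc assms(2) by (rule mult_left_mono)
  finally show ?case by simp
qed simp

section \<open>Matrix powers and traces as sums over walks\<close>

definition walks :: "nat \<Rightarrow> nat \<Rightarrow> nat list set" where
  "walks N L = {u. set u \<subseteq> {..<N} \<and> length u = L}"

fun path_weight :: "(nat \<Rightarrow> nat \<Rightarrow> real) \<Rightarrow> nat list \<Rightarrow> real" where
  "path_weight X (x # y # zs) = X x y * path_weight X (y # zs)"
| "path_weight X _ = 1"

text \<open>For \<open>L > 0\<close> this is the trace of the \<open>L\<close>-th power of \<open>X\<close>.\<close>

definition walk_trace :: "nat \<Rightarrow> nat \<Rightarrow> (nat \<Rightarrow> nat \<Rightarrow> real) \<Rightarrow> real" where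
  "walk_trace N L X = (\<Sum>u\<in>walks N L. path_weight X (u @ [hd u]))"

lemma finite_walks [simp]: "finite (walks N L)"
  unfolding walks_def by (rule finite_lists_length_eq) simp

lemma walks_0 [simp]: "walks N 0 = {[]}"
  by (auto simp: walks_def)

lemma sum_walks_Suc: "(\<Sum>u\<in>walks N (Suc t). f u) = (\<Sum>a<N. \<Sum>us\<in>walks N t. f (a # us))"
proof -
  have "(\<Sum>u\<in>walks N (Suc t). f u) = (\<Sum>(a, us)\<in>{..<N} \<times> walks N t. f (a # us))"
    by (rule sum.reindex_bij_witness[of _ "\<lambda>(a, us). a # us" "\<lambda>u. (hd u, tl u)"])
       (auto simp: walks_def length_Suc_conv)
  then show ?thesis by (simp add: sum.cartesian_product)
qed

text \<open>Here \<open>us\<close> lists the vertices visited after the start \<open>i\<close>; the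
  last one selects the coordinate of \<open>v\<close>.\<close>

lemma matvec_funpow_walks:
  "(matvec N X ^^ t) v i = (\<Sum>us\<in>walks N t. path_weight X (i # us) * v (last (i # us)))"
proof (induction t arbitrary: i)
  case (Suc t)
  show ?case
    by (simp add: matvec_def[of N X "(_ ^^ _) v"] Suc sum_walks_Suc sum_distrib_left mult.assoc)
qed simp

text \<open>The factor \<open>kron a\<close> forces the last vertex to be \<open>a\<close>, so only
  \<open>t\<close> vertices stay free; this is how walks are closed up.\<close>

lemma sum_walks_append_kron:
  "a < N \<Longrightarrow> (\<Sum>us\<in>walks N (Suc t). f us * kron a (last us)) = (\<Sum>us\<in>walks N t. f (us @ [a]))"
proof (induction t arbitrary: f)
  case 0
  have "(\<Sum>j<N. f [j] * kron a j) = (\<Sum>j<N. if j = a then f [j] else 0)"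
    by (intro sum.cong) (auto simp: kron_def)
  with 0 show ?case by (simp add: sum_walks_Suc)
next
  case (Suc t)
  have "(\<Sum>us\<in>walks N (Suc (Suc t)). f us * kron a (last us)) =
      (\<Sum>j<N. \<Sum>us\<in>walks N (Suc t). f (j # us) * kron a (last us))"
    unfolding sum_walks_Suc[of _ _ "Suc t"]
    by (intro sum.cong refl) (auto simp: walks_def)
  also have "\<dots> = (\<Sum>j<N. \<Sum>us\<in>walks N t. f (j # (us @ [a])))"
    by (rule sum.cong[OF refl], rule Suc.IH[OF Suc.prems])
  also have "\<dots> = (\<Sum>us\<in>walks N (Suc t). f (us @ [a]))"
    by (simp add: sum_walks_Suc)
  finally show ?case .
qed

lemma walk_trace_eq:
  assumes "L > 0"
  shows "walk_trace N L X = (\<Sum>a<N. (matvec N X ^^ L) (kron a) a)"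
proof -
  obtain t where L: "L = Suc t" using assms by (cases L) auto
  have "(matvec N X ^^ L) (kron a) a = (\<Sum>us\<in>walks N t. path_weight X (a # us @ [a]))"
    if "a < N" for a
  proof -
    have "(matvec N X ^^ L) (kron a) a =
        (\<Sum>us\<in>walks N (Suc t). path_weight X (a # us) * kron a (last us))"
      unfolding L matvec_funpow_walks by (intro sum.cong refl) (auto simp: walks_def)
    then show ?thesis by (simp add: sum_walks_append_kron[OF that])
  qed
  then show ?thesis by (simp add: walk_trace_def L sum_walks_Suc)
qed

text \<open>Each diagonal entry of the \<open>L\<close>-th power is a coordinate of the image of a
  unit vector, hence at most \<open>s ^ L\<close>.\<close>

lemma walk_trace_le:
  assumes norm: "\<And>v. sqn N (matvec N X v) \<le> s\<^sup>2 * sqn N v" and s: "s \<ge> 0" and L: "L > 0"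
  shows "walk_trace N L X \<le> real N * s ^ L"
proof -
  have "(matvec N X ^^ L) (kron a) a \<le> s ^ L" if a: "a < N" for a
  proof -
    have "((matvec N X ^^ L) (kron a) a)\<^sup>2 \<le> sqn N ((matvec N X ^^ L) (kron a))"
      by (rule component_squared_le_sqn[OF a])
    also have "\<dots> \<le> (s\<^sup>2) ^ L * sqn N (kron a)"
      by (rule sqn_matvec_funpow_le[OF norm]) auto
    also have "\<dots> = (s ^ L)\<^sup>2" using a by (simp add: sqn_kron mult.commute flip: power_mult)
    finally show ?thesis using s by (meson power2_le_imp_le zero_le_power)
  qed
  then have "walk_trace N L X \<le> (\<Sum>a<N. s ^ L)"
    unfolding walk_trace_eq[OF L] by (intro sum_mono) auto
  then show ?thesis by simp
qed

text \<open>The Frobenius norm dominates the operator norm, and for symmetric \<open>X\<close> the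
  squared Frobenius norm of the \<open>k\<close>-th power is the trace of the
  \<open>2 * k\<close>-th.\<close>

lemma sqn_funpow_le_walk_trace:
  assumes sym: "\<And>i j. X i j = X j i" and k: "k > 0"
  shows "sqn N ((matvec N X ^^ k) v) \<le> walk_trace N (2 * k) X * sqn N v"
proof -
  let ?P = "\<lambda>a. (matvec N X ^^ k) (kron a)"
  have "sqn N ((matvec N X ^^ k) v) \<le> (\<Sum>i<N. sqn N v * (\<Sum>a<N. (?P a i)\<^sup>2))"
    unfolding sqn_def[of N "(_ ^^ _) v"]
  proof (intro sum_mono)
    fix i assume "i \<in> {..<N}"
    then have "((matvec N X ^^ k) v i)\<^sup>2 = (dotp N v (\<lambda>a. ?P a i))\<^sup>2"
      by (simp add: dotp_def matvec_funpow_expand[where k = k and v = v])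
    also have "\<dots> \<le> sqn N v * sqn N (\<lambda>a. ?P a i)" by (rule dotp_squared_le)
    finally show "((matvec N X ^^ k) v i)\<^sup>2 \<le> sqn N v * (\<Sum>a<N. (?P a i)\<^sup>2)"
      by (simp add: sqn_def)
  qed
  also have "\<dots> = sqn N v * (\<Sum>i<N. \<Sum>a<N. (?P a i)\<^sup>2)" by (simp add: sum_distrib_left)
  also have "(\<Sum>i<N. \<Sum>a<N. (?P a i)\<^sup>2) = (\<Sum>a<N. sqn N (?P a))"
    unfolding sqn_def by (rule sum.swap)
  also have "\<dots> = (\<Sum>a<N. (matvec N X ^^ (2 * k)) (kron a) a)"
  proof (intro sum.cong refl)
    fix a assume a: "a \<in> {..<N}"
    have "sqn N (?P a) = dotp N (kron a) ((matvec N X ^^ k) (?P a))"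
      unfolding sqn_eq_dotp by (rule dotp_matvec_funpow[OF sym, symmetric])
    also have "(matvec N X ^^ k) (?P a) = (matvec N X ^^ (2 * k)) (kron a)"
      by (simp add: mult_2 funpow_add)
    finally show "sqn N (?P a) = (matvec N X ^^ (2 * k)) (kron a) a"
      using a by (simp add: dotp_kron)
  qed
  also have "\<dots> = walk_trace N (2 * k) X" using k by (simp add: walk_trace_eq)
  finally show ?thesis by (simp add: mult.commute)
qed

text \<open>No diagonalisation is involved: the squared norms of the iterates of \<open>v\<close>
  form a log-convex sequence, so its first ratio is at most the geometric mean of the first
  \<open>k\<close> ratios, which the trace controls.\<close>

lemma sqn_matvec_le_of_walk_trace:
  assumes sym: "\<And>i j. X i j = X j i" and k: "k > 0"
    and t: "walk_trace N (2 * k) X \<le> t ^ k" "t \<ge> 0"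
  shows "sqn N (matvec N X v) \<le> t * sqn N v"
proof -
  define b where "b j = sqn N ((matvec N X ^^ j) v)" for j
  have b0: "b j \<ge> 0" for j by (simp add: b_def)
  \<comment> \<open>By symmetry one factor of \<open>X\<close> can be moved across the inner
    product; then Cauchy-Schwarz applies.\<close>
  have logconvex: "(b (Suc j))\<^sup>2 \<le> b j * b (Suc (Suc j))" for j
  proof -
    have "b (Suc j) = dotp N ((matvec N X ^^ j) v) ((matvec N X ^^ Suc (Suc j)) v)"
      by (simp add: b_def sqn_eq_dotp dotp_matvec[OF sym])
    then show ?thesis unfolding b_def by (metis dotp_squared_le)
  qed
  \<comment> \<open>Log-convexity makes consecutive ratios increase. The cross-multiplied form
    remains meaningful when some \<open>b j\<close> vanishes.\<close>
  have ratio: "b 1 * b j \<le> b 0 * b (Suc j)" for j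
  proof (induction j)
    case (Suc j)
    show ?case
    proof (cases "b j = 0 \<or> b (Suc j) = 0")
      case True
      with logconvex[of j] have "b (Suc j) = 0" by auto
      then show ?thesis using b0 by simp
    next
      case False
      then have pos: "b j > 0" "b (Suc j) > 0" using b0[of j] b0[of "Suc j"] by auto
      have "(b 1 * b j) * (b (Suc j))\<^sup>2 \<le> (b 0 * b (Suc j)) * (b j * b (Suc (Suc j)))"
        by (intro mult_mono Suc logconvex mult_nonneg_nonneg b0) auto
      then have "(b j * b (Suc j)) * (b 1 * b (Suc j)) \<le> (b j * b (Suc j)) * (b 0 * b (Suc (Suc j)))"
        by (simp add: power2_eq_square mult_ac)
      then show ?thesis using pos by (simp only: mult_le_cancel_left_pos mult_pos_pos)
    qed
  qed simp
  have pow: "b 1 ^ j * b 0 \<le> b 0 ^ j * b j" for j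
  proof (induction j)
    case (Suc j)
    have "b 1 ^ Suc j * b 0 \<le> b 1 * (b 0 ^ j * b j)"
      using mult_left_mono[OF Suc b0[of 1]] by (simp add: mult_ac)
    also have "\<dots> \<le> b 0 ^ j * (b 0 * b (Suc j))"
      using mult_left_mono[OF ratio[of j], of "b 0 ^ j"] b0 by (simp add: mult_ac)
    finally show ?case by (simp add: mult_ac)
  qed simp
  show ?thesis
  proof (cases "b 0 = 0")
    case True
    then have "sqn N v = 0" by (simp add: b_def)
    then have "(\<Sum>j<N. (v j)\<^sup>2) = 0" by (simp add: sqn_def)
    then have "\<And>j. j < N \<Longrightarrow> v j = 0" by (subst (asm) sum_nonneg_eq_0_iff) auto
    then have "sqn N (matvec N X v) = 0" by (simp add: sqn_def matvec_def)
    then show ?thesis using t by simp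
  next
    case False
    then have p: "b 0 > 0" using b0[of 0] by simp
    have "b 1 ^ k * b 0 \<le> b 0 ^ k * b k" by (rule pow)
    also have "\<dots> \<le> b 0 ^ k * (t ^ k * b 0)"
      using sqn_funpow_le_walk_trace[where X = X and N = N and v = v, OF sym k] t p
      by (intro mult_left_mono) (auto simp: b_def intro: order_trans mult_right_mono)
    finally have "b 1 ^ k \<le> (t * b 0) ^ k" using p by (simp add: power_mult_distrib mult_ac)
    then have "b 1 \<le> t * b 0" using k b0 t by (meson mult_nonneg_nonneg power_less_imp_less_base linorder_not_le power_strict_mono)
    then show ?thesis by (simp add: b_def)
  qed
qed

section \<open>Expected traces and closed walks\<close>

text \<open>Expectation over a random subset of a finite set \<open>P\<close> containing each
  element independently with probability \<open>p\<close>. As a finite sum it needs no integrability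
  conditions; \<open>prob_gnp\<close> connects it with \<open>gnp\<close>.\<close>

definition expect :: "'e set \<Rightarrow> real \<Rightarrow> ('e set \<Rightarrow> real) \<Rightarrow> real" where
  "expect P p g = (\<Sum>E\<in>Pow P. p ^ card E * (1 - p) ^ card (P - E) * g E)"

lemma expect_sum: "expect P p (\<lambda>E. \<Sum>i\<in>I. g i E) = (\<Sum>i\<in>I. expect P p (g i))"
  unfolding expect_def by (subst sum.swap) (simp add: sum_distrib_left)

lemma expect_cmult: "expect P p (\<lambda>E. c * g E) = c * expect P p g"
  by (simp add: expect_def sum_distrib_left mult_ac)

lemma expect_add: "expect P p (\<lambda>E. g E + h E) = expect P p g + expect P p h"
  by (simp add: expect_def sum.distrib distrib_left)

lemma expect_mono:
  assumes "0 \<le> p" "p \<le> 1" "\<And>E. E \<subseteq> P \<Longrightarrow> g E \<le> h E"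
  shows "expect P p g \<le> expect P p h"
  unfolding expect_def using assms by (intro sum_mono mult_left_mono) auto

text \<open>Independence in finite form: expand the product of two-term sums over subsets of
  \<open>P\<close>.\<close>

lemma expect_prod:
  assumes "finite P"
  shows "expect P p (\<lambda>E. \<Prod>e\<in>P. \<phi> e (e \<in> E)) = (\<Prod>e\<in>P. p * \<phi> e True + (1 - p) * \<phi> e False)"
proof -
  have "(\<Prod>e\<in>P. p * \<phi> e True + (1 - p) * \<phi> e False) =
      (\<Sum>E\<in>Pow P. (\<Prod>e\<in>E. p * \<phi> e True) * (\<Prod>e\<in>P - E. (1 - p) * \<phi> e False))"
    using assms by (rule prod_add)
  also have "\<dots> = expect P p (\<lambda>E. \<Prod>e\<in>P. \<phi> e (e \<in> E))"
    unfolding expect_def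
  proof (intro sum.cong refl)
    fix E assume E: "E \<in> Pow P"
    have "(\<Prod>e\<in>P. \<phi> e (e \<in> E)) = (\<Prod>e\<in>E. \<phi> e True) * (\<Prod>e\<in>P - E. \<phi> e False)"
      using E assms prod.subset_diff[of E P "\<lambda>e. \<phi> e (e \<in> E)"]
      by (auto simp: mult.commute intro!: arg_cong2[of _ _ _ _ "(*)"] prod.cong)
    then show "(\<Prod>e\<in>E. p * \<phi> e True) * (\<Prod>e\<in>P - E. (1 - p) * \<phi> e False) =
        p ^ card E * (1 - p) ^ card (P - E) * (\<Prod>e\<in>P. \<phi> e (e \<in> E))"
      by (simp add: prod.distrib mult_ac)
  qed
  finally show ?thesis ..
qed

text \<open>Used with \<open>(1 - p, - p)\<close> for the centred adjacency matrix of the random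
  graph and with \<open>(2, -1)\<close> for the dense comparison matrix.\<close>

definition edge_mat :: "real \<Rightarrow> real \<Rightarrow> nat set set \<Rightarrow> nat \<Rightarrow> nat \<Rightarrow> real" where
  "edge_mat a b E i j = (if i = j then 0 else if {i, j} \<in> E then a else b)"

lemma edge_mat_commute: "edge_mat a b E i j = edge_mat a b E j i"
  by (simp add: edge_mat_def insert_commute eq_commute)

fun path_edges :: "nat list \<Rightarrow> nat set list" where
  "path_edges (x # y # zs) = {x, y} # path_edges (y # zs)"
| "path_edges _ = []"

definition bernoulli_moment :: "real \<Rightarrow> real \<Rightarrow> real \<Rightarrow> nat \<Rightarrow> real" where
  "bernoulli_moment p a b j = p * a ^ j + (1 - p) * b ^ j"

text \<open>A step that stays at its vertex yields a singleton edge and meets the zero diagonal, so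
  the value is then \<open>0\<close>. Otherwise independence gives one moment per distinct edge, of
  order its multiplicity.\<close>

definition edge_moment :: "real \<Rightarrow> real \<Rightarrow> real \<Rightarrow> nat set list \<Rightarrow> real" where
  "edge_moment p a b es =
     (if \<forall>e\<in>set es. card e = 2 then \<Prod>e\<in>set es. bernoulli_moment p a b (count_list es e) else 0)"

lemma path_weight_edge_mat:
  "path_weight (edge_mat a b E) w =
     (if \<forall>e\<in>set (path_edges w). card e = 2
      then prod_list (map (\<lambda>e. if e \<in> E then a else b) (path_edges w)) else 0)"
  by (induction w rule: path_edges.induct) (auto simp: edge_mat_def card_insert_if)

lemma path_edges_subset: "e \<in> set (path_edges w) \<Longrightarrow> e \<subseteq> set w"
  by (induction w rule: path_edges.induct) auto

lemma length_path_edges: "length (path_edges w) = length w - 1"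
  by (induction w rule: path_edges.induct) auto

lemma path_edges_map: "path_edges (map \<sigma> w) = map ((`) \<sigma>) (path_edges w)"
  by (induction w rule: path_edges.induct) auto

lemma card_set_path_edges: "w \<noteq> [] \<Longrightarrow> card (set w) \<le> card (set (path_edges w)) + 1"
proof (induction w rule: path_edges.induct)
  case (1 x y zs)
  show ?case
  proof (cases "x \<in> set (y # zs)")
    case True
    then have "card (set (x # y # zs)) = card (set (y # zs))" by (simp add: insert_absorb)
    also have "\<dots> \<le> card (set (path_edges (y # zs))) + 1" using 1 by simp
    also have "\<dots> \<le> card (set (path_edges (x # y # zs))) + 1"
      by (simp add: card_insert_if)
    finally show ?thesis .
  next
    case False
    then have "{x, y} \<notin> set (path_edges (y # zs))" using path_edges_subset by blast
    then have "card (set (path_edges (x # y # zs))) = card (set (path_edges (y # zs))) + 1"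
      by (simp add: card_insert_if)
    moreover have "card (set (x # y # zs)) = card (set (y # zs)) + 1"
      using False by (simp add: card_insert_if)
    ultimately show ?thesis using 1 by simp
  qed
qed auto

lemma finite_vertex_pairs [simp]: "finite (vertex_pairs n)"
  by (rule finite_subset[of _ "Pow {..<n}"]) (auto simp: vertex_pairs_def)

lemma prod_list_eq_prod_count:
  fixes f :: "'a \<Rightarrow> real"
  assumes "finite P" "set xs \<subseteq> P"
  shows "prod_list (map f xs) = (\<Prod>x\<in>P. f x ^ count_list xs x)"
  using assms(2)
proof (induction xs)
  case (Cons y xs)
  have "(\<Prod>x\<in>P. f x ^ count_list (y # xs) x) =
      (\<Prod>x\<in>P. (if x = y then f x else 1) * f x ^ count_list xs x)"
    by (intro prod.cong) auto
  also have "\<dots> = f y * (\<Prod>x\<in>P. f x ^ count_list xs x)"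
    using Cons.prems assms(1) by (simp add: prod.distrib)
  finally show ?case using Cons by simp
qed simp

lemma expect_path_weight:
  assumes "set w \<subseteq> {..<N}"
  shows "expect (vertex_pairs N) p (\<lambda>E. path_weight (edge_mat a b E) w) =
      edge_moment p a b (path_edges w)"
proof (cases "\<forall>e\<in>set (path_edges w). card e = 2")
  case True
  let ?c = "count_list (path_edges w)"
  have sub: "set (path_edges w) \<subseteq> vertex_pairs N"
    using True assms path_edges_subset[of _ w] by (auto simp: vertex_pairs_def)
  have "expect (vertex_pairs N) p (\<lambda>E. path_weight (edge_mat a b E) w) =
      expect (vertex_pairs N) p (\<lambda>E. \<Prod>e\<in>vertex_pairs N. (if e \<in> E then a else b) ^ ?c e)"
    using True by (simp add: path_weight_edge_mat prod_list_eq_prod_count[OF finite_vertex_pairs sub])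
  also have "\<dots> = (\<Prod>e\<in>vertex_pairs N. p * (if True then a else b) ^ ?c e
      + (1 - p) * (if False then a else b) ^ ?c e)"
    by (rule expect_prod) simp
  also have "\<dots> = (\<Prod>e\<in>vertex_pairs N. bernoulli_moment p a b (?c e))"
    by (simp add: bernoulli_moment_def)
  \<comment> \<open>Pairs off the path have multiplicity zero, and their moment is
    \<open>p + (1 - p) = 1\<close>.\<close>
  also have "\<dots> = (\<Prod>e\<in>set (path_edges w). bernoulli_moment p a b (?c e))"
    using sub by (intro prod.mono_neutral_right)
      (auto simp: bernoulli_moment_def count_list_0_iff)
  finally show ?thesis using True by (simp add: edge_moment_def)
next
  case False
  then have "path_weight (edge_mat a b E) w = 0" for E
    unfolding path_weight_edge_mat by (rule if_not_P)
  with False show ?thesis by (auto simp: edge_moment_def expect_def)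
qed

section \<open>Closed walks using every edge at least twice, counted by their vertex sets\<close>

definition closed_edges :: "nat list \<Rightarrow> nat set list" where
  "closed_edges u = path_edges (u @ [hd u])"

lemma expect_walk_trace:
  assumes "L > 0"
  shows "expect (vertex_pairs N) p (\<lambda>E. walk_trace N L (edge_mat a b E)) =
      (\<Sum>u\<in>walks N L. edge_moment p a b (closed_edges u))"
  unfolding walk_trace_def expect_sum closed_edges_def
proof (rule sum.cong[OF refl], rule expect_path_weight)
  fix u assume "u \<in> walks N L"
  with assms show "set (u @ [hd u]) \<subseteq> {..<N}" by (cases u) (auto simp: walks_def)
qed

lemma count_list_map_inj_on:
  "inj_on f A \<Longrightarrow> set xs \<subseteq> A \<Longrightarrow> x \<in> A \<Longrightarrow> count_list (map f xs) (f x) = count_list xs x"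
  by (induction xs) (auto dest: inj_onD)

definition double_cover :: "nat set list \<Rightarrow> bool" where
  "double_cover es \<longleftrightarrow> (\<forall>e\<in>set es. card e = 2 \<and> count_list es e \<ge> 2)"

lemma double_cover_map:
  assumes "inj_on \<sigma> (\<Union>(set es))"
  shows "double_cover (map ((`) \<sigma>) es) \<longleftrightarrow> double_cover es"
proof -
  have inj: "inj_on ((`) \<sigma>) (set es)" using assms by (rule inj_on_image)
  have "card (\<sigma> ` e) = card e" if "e \<in> set es" for e
    using assms that by (intro card_image) (blast intro: inj_on_subset)
  then show ?thesis
    using count_list_map_inj_on[OF inj] by (auto simp: double_cover_def)
qed

definition cover_walks :: "nat \<Rightarrow> nat set \<Rightarrow> nat list set" where
  "cover_walks L S = {u. set u = S \<and> length u = L \<and> double_cover (closed_edges u)}"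

lemma closed_edges_map: "u \<noteq> [] \<Longrightarrow> closed_edges (map \<sigma> u) = map ((`) \<sigma>) (closed_edges u)"
  unfolding closed_edges_def by (simp add: hd_map flip: path_edges_map)

lemma closed_edges_subset: "u \<noteq> [] \<Longrightarrow> \<Union>(set (closed_edges u)) \<subseteq> set u"
proof -
  assume "u \<noteq> []"
  then have "set (u @ [hd u]) = set u" by (cases u) auto
  then show ?thesis
    unfolding closed_edges_def using path_edges_subset[of _ "u @ [hd u]"] by blast
qed

text \<open>Relabelling vertices along a bijection preserves edge multiplicities. Exchanging
  \<open>S\<close> and \<open>T\<close> gives equality, so the count depends only on the number of
  vertices.\<close>

lemma card_cover_walks_le:
  assumes "finite S" "card S = card T" "finite T" "L > 0"
  shows "card (cover_walks L S) \<le> card (cover_walks L T)"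
proof -
  obtain \<sigma> where \<sigma>: "bij_betw \<sigma> S T" using assms finite_same_card_bij by blast
  have fin: "finite (cover_walks L T)"
    by (rule finite_subset[of _ "{u. set u \<subseteq> T \<and> length u = L}"])
       (auto simp: cover_walks_def intro: finite_lists_length_eq assms)
  show ?thesis
  proof (rule card_inj_on_le[OF _ _ fin, of "map \<sigma>"])
    show "inj_on (map \<sigma>) (cover_walks L S)"
      using \<sigma> by (intro inj_on_mapI) (auto simp: cover_walks_def bij_betw_def inj_on_def)
    show "map \<sigma> ` cover_walks L S \<subseteq> cover_walks L T"
    proof clarify
      fix u assume u: "u \<in> cover_walks L S"
      then have ne: "u \<noteq> []" using assms by (auto simp: cover_walks_def)
      have "inj_on \<sigma> (\<Union>(set (closed_edges u)))"
        using \<sigma> closed_edges_subset[OF ne] u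
        by (auto simp: cover_walks_def bij_betw_def intro: inj_on_subset)
      then show "map \<sigma> u \<in> cover_walks L T"
        using u \<sigma> by (auto simp: cover_walks_def closed_edges_map[OF ne] double_cover_map bij_betw_def)
    qed
  qed
qed

lemma card_cover_walks_eq:
  assumes "finite S" "L > 0"
  shows "card (cover_walks L S) = card (cover_walks L {..<card S})"
  using assms card_cover_walks_le[of S "{..<card S}" L] card_cover_walks_le[of "{..<card S}" S L]
  by simp

text \<open>Grouping by the visited set \<open>S\<close> separates the ambient size
  \<open>N\<close>, which enters only through the binomial coefficient, from a walk count
  independent of \<open>N\<close>.\<close>

lemma sum_walks_by_card:
  assumes "L > 0"
  shows "(\<Sum>u | u \<in> walks N L \<and> double_cover (closed_edges u). c (card (set u))) =
      (\<Sum>m\<le>N. real (N choose m) * (c m * real (card (cover_walks L {..<m}))))"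
proof -
  let ?U = "{u \<in> walks N L. double_cover (closed_edges u)}"
  have fw: "finite (cover_walks L S)" if "S \<subseteq> {..<N}" for S
    by (rule finite_subset[OF _ finite_walks[of N L]]) (use that in \<open>auto simp: cover_walks_def walks_def\<close>)
  have "finite ?U" by (rule finite_subset[OF _ finite_walks[of N L]]) auto
  then have "(\<Sum>u\<in>?U. c (card (set u))) =
      (\<Sum>S\<in>Pow {..<N}. \<Sum>u | u \<in> ?U \<and> set u = S. c (card (set u)))"
    by (intro sum.group[symmetric]) (auto simp: walks_def)
  also have "\<dots> = (\<Sum>S\<in>Pow {..<N}. c (card S) * real (card (cover_walks L {..<card S})))"
  proof (intro sum.cong refl)
    fix S assume S: "S \<in> Pow {..<N}"
    then have "{u. u \<in> ?U \<and> set u = S} = cover_walks L S"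
      by (auto simp: walks_def cover_walks_def)
    then show "(\<Sum>u | u \<in> ?U \<and> set u = S. c (card (set u))) =
        c (card S) * real (card (cover_walks L {..<card S}))"
      using card_cover_walks_eq[of S L] S assms
      by (simp add: cover_walks_def finite_subset[of S "{..<N}"])
  qed
  also have "\<dots> = (\<Sum>m\<le>N. \<Sum>S | S \<in> Pow {..<N} \<and> card S = m.
      c (card S) * real (card (cover_walks L {..<card S})))"
    by (rule sum.group[symmetric]) (auto simp: card_mono[of "{..<N}", simplified])
  also have "\<dots> = (\<Sum>m\<le>N. real (N choose m) * (c m * real (card (cover_walks L {..<m}))))"
    using n_subsets[of "{..<N}"] by (intro sum.cong refl) simp
  finally show ?thesis by simp
qed

lemma sum_count_list: "(\<Sum>x\<in>set xs. count_list xs x) = length xs"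
  by (rule sum_count_set) auto

text \<open>Together the two bounds say that such a walk visits at most \<open>L / 2 + 1\<close>
  vertices: its edges connect them, and there are at most \<open>L / 2\<close> distinct
  edges.\<close>

lemma double_cover_card:
  assumes "u \<in> walks N L" "L > 0" "double_cover (closed_edges u)"
  shows "card (set u) \<le> card (set (closed_edges u)) + 1" "2 * card (set (closed_edges u)) \<le> L"
proof -
  have ne: "u \<noteq> []" using assms by (auto simp: walks_def)
  have "set (u @ [hd u]) = set u" using ne by auto
  then show "card (set u) \<le> card (set (closed_edges u)) + 1"
    using card_set_path_edges[of "u @ [hd u]"] by (simp add: closed_edges_def)
  have "2 * card (set (closed_edges u)) = (\<Sum>e\<in>set (closed_edges u). 2)" by simp
  also have "\<dots> \<le> (\<Sum>e\<in>set (closed_edges u). count_list (closed_edges u) e)"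
    using assms(3) by (intro sum_mono) (auto simp: double_cover_def)
  also have "\<dots> = L" using assms(1)
    by (simp add: sum_count_list) (simp add: closed_edges_def length_path_edges walks_def)
  finally show "2 * card (set (closed_edges u)) \<le> L" .
qed

lemma cover_walks_empty:
  assumes "L > 0" "2 * m > L + 2"
  shows "cover_walks L {..<m} = {}"
proof (rule ccontr)
  assume "cover_walks L {..<m} \<noteq> {}"
  then obtain u where u: "u \<in> cover_walks L {..<m}" by auto
  then have "u \<in> walks m L" "double_cover (closed_edges u)" "card (set u) = m"
    by (auto simp: cover_walks_def walks_def)
  with double_cover_card[of u m L] assms show False by simp
qed

text \<open>The first moment of a centred edge variable is zero, so an edge traversed once kills the
  product; every moment of order at least two is at most \<open>p * (1 - p)\<close> in absolute
  value.\<close>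

lemma centred_edge_moment_le:
  assumes p: "0 \<le> p" "p \<le> 1"
  shows "\<bar>edge_moment p (1 - p) (- p) es\<bar> \<le> (if double_cover es then p ^ card (set es) else 0)"
proof (cases "double_cover es")
  case True
  have "\<bar>bernoulli_moment p (1 - p) (- p) j\<bar> \<le> p" if "j \<ge> 2" for j
  proof -
    obtain i where j: "j = Suc (Suc i)" using \<open>j \<ge> 2\<close> by (metis add_2_eq_Suc le_Suc_ex)
    have "\<bar>bernoulli_moment p (1 - p) (- p) j\<bar> \<le> p * (1 - p) ^ j + (1 - p) * p ^ j"
      unfolding bernoulli_moment_def using p by (intro order_trans[OF abs_triangle_ineq]) (simp add: abs_mult power_abs)
    also have "\<dots> = p * (1 - p) * ((1 - p) * (1 - p) ^ i + p * p ^ i)"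
      by (simp add: j algebra_simps)
    also have "\<dots> \<le> p * (1 - p) * ((1 - p) * 1 + p * 1)"
      using p by (intro mult_left_mono add_mono power_le_one) auto
    also have "\<dots> \<le> p * 1" using p by (intro order_trans[OF eq_refl mult_left_mono[of "1 - p" 1]]) auto
    finally show ?thesis by simp
  qed
  then have "(\<Prod>e\<in>set es. \<bar>bernoulli_moment p (1 - p) (- p) (count_list es e)\<bar>) \<le> (\<Prod>e\<in>set es. p)"
    using True by (intro prod_mono) (auto simp: double_cover_def)
  then show ?thesis using True p by (auto simp: edge_moment_def abs_prod)
next
  case False
  then obtain e where e: "e \<in> set es" "card e \<noteq> 2 \<or> count_list es e < 2"
    by (auto simp: double_cover_def not_le)
  have "edge_moment p (1 - p) (- p) es = 0"
  proof (cases "card e = 2")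
    case c: True
    have "count_list es e \<noteq> 0" using e by (simp add: count_list_0_iff)
    with c e have "count_list es e = 1" by auto
    then have "bernoulli_moment p (1 - p) (- p) (count_list es e) = 0"
      by (simp add: bernoulli_moment_def algebra_simps)
    then have "(\<Prod>e\<in>set es. bernoulli_moment p (1 - p) (- p) (count_list es e)) = 0"
      using e by auto
    then show ?thesis by (simp add: edge_moment_def)
  qed (use e in \<open>auto simp: edge_moment_def\<close>)
  then show ?thesis using False by simp
qed

text \<open>The moment of order \<open>j\<close> is \<open>(2 ^ j + 2 * (-1) ^ j) / 3\<close>.
  Skewness is the point: odd moments from the third on are also at least \<open>1\<close>, whereas
  symmetric signs would make them vanish.\<close>

lemma skew_edge_moment_ge:
  "(if double_cover es then 1 else 0) \<le> edge_moment (1/3) 2 (-1) es"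
proof -
  have big: "bernoulli_moment (1/3) 2 (-1) j \<ge> 1" if "j \<ge> 2" for j
  proof -
    have "(2::real) ^ 2 \<le> 2 ^ j" using that by (intro power_increasing) auto
    moreover have "(2::real) ^ 3 \<le> 2 ^ j" if "odd j"
      using \<open>j \<ge> 2\<close> that by (intro power_increasing) (auto simp: le_less Suc_le_eq numeral_3_eq_3 elim: oddE)
    ultimately show ?thesis by (cases "even j") (auto simp: bernoulli_moment_def)
  qed
  have "bernoulli_moment (1/3) 2 (-1) 1 = 0" "bernoulli_moment (1/3) 2 (-1) 0 = 1"
    by (simp_all add: bernoulli_moment_def)
  then have nn: "bernoulli_moment (1/3) 2 (-1) j \<ge> 0" for j
    using big[of j] by (cases "j \<ge> 2") (auto simp: not_le less_2_cases_iff)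
  show ?thesis
  proof (cases "double_cover es")
    case True
    then show ?thesis using big by (auto simp: edge_moment_def double_cover_def intro!: prod_ge_1)
  qed (auto simp: edge_moment_def nn intro!: prod_nonneg)
qed

text \<open>
  A walk covering \<open>m\<close> vertices contributes at most \<open>p ^ (m - 1)\<close> for the centred adjacency
  matrix and at least \<open>1\<close> for the dense comparison matrix of size \<open>r\<close>; the numbers of
  \<open>m\<close>-subsets satisfy \<open>(n choose m) * p ^ (m - 1) \<le> (n / r) * (r choose m)\<close> because \<open>r - i \<ge> n * p\<close>
  for all \<open>i < m\<close>.
\<close>

lemma expect_walk_trace_comparison:
  assumes p: "0 \<le> p" "p \<le> 1" and k: "k > 0" and r: "real r \<ge> real n * p + real k"
  shows "real r * expect (vertex_pairs n) p (\<lambda>E. walk_trace n (2 * k) (edge_mat (1 - p) (- p) E))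
    \<le> real n * expect (vertex_pairs r) (1/3) (\<lambda>E. walk_trace r (2 * k) (edge_mat 2 (-1) E))"
proof -
  define L where "L = 2 * k"
  define w where "w m = real (card (cover_walks L {..<m}))" for m
  have L: "L > 0" using k by (simp add: L_def)
  have w0: "w m \<ge> 0" for m by (simp add: w_def)
  have wz: "w m = 0" if "m > k + 1" for m
    using that cover_walks_empty[OF L, of m] by (simp add: w_def L_def)
  have wz0: "w 0 = 0"
    using L by (simp add: w_def cover_walks_def)
  have r0: "r > 0" "real k \<le> real r" using r k p by (smt (verit) mult_nonneg_nonneg of_nat_0_le_iff of_nat_0_less_iff)+
  have upper: "expect (vertex_pairs n) p (\<lambda>E. walk_trace n L (edge_mat (1 - p) (- p) E))
      \<le> (\<Sum>m\<le>n. real (n choose m) * (p ^ (m - 1) * w m))"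
  proof -
    have "(\<Sum>u\<in>walks n L. edge_moment p (1 - p) (- p) (closed_edges u))
        \<le> (\<Sum>u\<in>walks n L. if double_cover (closed_edges u) then p ^ (card (set u) - 1) else 0)"
    proof (intro sum_mono)
      fix u assume u: "u \<in> walks n L"
      have "edge_moment p (1 - p) (- p) (closed_edges u)
          \<le> (if double_cover (closed_edges u) then p ^ card (set (closed_edges u)) else 0)"
        using centred_edge_moment_le[OF p, of "closed_edges u"] by linarith
      \<comment> \<open>Since \<open>p \<le> 1\<close>, replacing the number of edges by the smaller
        number of vertices minus one only increases the power.\<close>
      also have "\<dots> \<le> (if double_cover (closed_edges u) then p ^ (card (set u) - 1) else 0)"
        using double_cover_card(1)[OF u L] p by (auto intro!: power_decreasing)
      finally show "edge_moment p (1 - p) (- p) (closed_edges u) \<le> \<dots>" .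
    qed
    also have "\<dots> = (\<Sum>u | u \<in> walks n L \<and> double_cover (closed_edges u). p ^ (card (set u) - 1))"
      by (subst sum.inter_filter[symmetric]) auto
    finally show ?thesis
      unfolding expect_walk_trace[OF L] sum_walks_by_card[OF L, of "\<lambda>m. p ^ (m - 1)"] w_def .
  qed
  have lower: "(\<Sum>m\<le>r. real (r choose m) * w m)
      \<le> expect (vertex_pairs r) (1/3) (\<lambda>E. walk_trace r L (edge_mat 2 (-1) E))"
  proof -
    have "(\<Sum>m\<le>r. real (r choose m) * (1 * w m)) =
        (\<Sum>u | u \<in> walks r L \<and> double_cover (closed_edges u). 1)"
      unfolding w_def by (rule sum_walks_by_card[OF L, of "\<lambda>_. 1", symmetric])
    also have "\<dots> = (\<Sum>u\<in>walks r L. if double_cover (closed_edges u) then 1 else 0)"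
      by (subst sum.inter_filter[symmetric]) auto
    also have "\<dots> \<le> (\<Sum>u\<in>walks r L. edge_moment (1/3) 2 (-1) (closed_edges u))"
      by (intro sum_mono skew_edge_moment_ge)
    finally show ?thesis unfolding expect_walk_trace[OF L] by simp
  qed
  have binom: "real r * (real (n choose m) * p ^ (m - 1)) \<le> real n * real (r choose m)"
    if m: "1 \<le> m" "m \<le> k + 1" for m
  proof -
    obtain j where j: "m = Suc j" "j \<le> k" using m by (cases m) auto
    \<comment> \<open>The leading factor \<open>N\<close> of the falling factorial is split off; it
      becomes \<open>n\<close> on one side and \<open>r\<close> on the other, and the remaining
      factors are compared one by one.\<close>
    have fall: "fact m * real (N choose m) = real N * (\<Prod>i=1..j. real N - real i)" for N
      unfolding binomial_gbinomial gbinomial_mult_fact j(1)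
      by (simp add: atLeast0LessThan lessThan_Suc_atMost prod.atMost_shift prod.atLeast1_atMost_eq)
    have m1: "m - 1 = j" using j by simp
    show ?thesis
    proof (cases "m \<le> n")
      case True
      have "fact m * (real r * (real (n choose m) * p ^ (m - 1))) =
          real r * (real n * (\<Prod>i=1..j. (real n - real i) * p))"
        using fall[of n] m1 by (simp add: prod.distrib mult_ac)
      also have "\<dots> \<le> real r * (real n * (\<Prod>i=1..j. real r - real i))"
      proof (intro mult_left_mono prod_mono conjI)
        fix i assume i: "i \<in> {1..j}"
        then have "real i \<le> real n" using True j by simp
        then show "0 \<le> (real n - real i) * p" using p by simp
        have "(real n - real i) * p \<le> real n * p" using p by (simp add: mult_right_mono)
        also have "\<dots> \<le> real r - real i" using r i j by simp
        finally show "(real n - real i) * p \<le> real r - real i" .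
      qed auto
      also have "\<dots> = fact m * (real n * real (r choose m))"
        using fall[of r] by (simp add: mult_ac)
      finally show ?thesis by simp
    qed (simp add: binomial_eq_0)
  qed
  have "real r * expect (vertex_pairs n) p (\<lambda>E. walk_trace n L (edge_mat (1 - p) (- p) E))
      \<le> (\<Sum>m\<le>n. real r * (real (n choose m) * p ^ (m - 1)) * w m)"
    using mult_left_mono[OF upper, of "real r"] by (simp add: sum_distrib_left mult_ac)
  also have "\<dots> \<le> (\<Sum>m\<le>n. real n * real (r choose m) * w m)"
  proof (intro sum_mono)
    fix m
    show "real r * (real (n choose m) * p ^ (m - 1)) * w m \<le> real n * real (r choose m) * w m"
    proof (cases "1 \<le> m \<and> m \<le> k + 1")
      case True
      then show ?thesis using binom[of m] w0[of m] by (intro mult_right_mono) auto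
    next
      case False
      then have "m = 0 \<or> m > k + 1" by linarith
      then have "w m = 0" using wz wz0 by auto
      then show ?thesis by simp
    qed
  qed
  \<comment> \<open>Passing to a common range lets the sum then shrink to \<open>m \<le> r\<close>,
    beyond which the binomial coefficients vanish.\<close>
  also have "\<dots> \<le> (\<Sum>m\<le>max n r. real n * real (r choose m) * w m)"
    by (intro sum_mono2) (auto simp: w0)
  also have "\<dots> = (\<Sum>m\<le>r. real n * real (r choose m) * w m)"
    by (intro sum.mono_neutral_right) (auto simp: binomial_eq_0)
  also have "\<dots> = real n * (\<Sum>m\<le>r. real (r choose m) * w m)"
    by (simp add: sum_distrib_left mult.assoc)
  also have "\<dots> \<le> real n * expect (vertex_pairs r) (1/3) (\<lambda>E. walk_trace r L (edge_mat 2 (-1) E))"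
    by (intro mult_left_mono lower) auto
  finally show ?thesis unfolding L_def .
qed

section \<open>A lattice net for the operator norm\<close>

text \<open>After scaling by \<open>1 / (4 * sqrt r)\<close> these are grid points of the unit ball.
  The box makes the set visibly finite and lets sums over it be enlarged to sums that factor over
  coordinates.\<close>

definition lattice_ball :: "nat \<Rightarrow> (nat \<Rightarrow> int) set" where
  "lattice_ball r = {a \<in> PiE {..<r} (\<lambda>_. {- int (4 * r)..int (4 * r)}). (\<Sum>i<r. (a i)\<^sup>2) \<le> 16 * int r}"

definition net_point :: "nat \<Rightarrow> (nat \<Rightarrow> int) \<Rightarrow> nat \<Rightarrow> real" where
  "net_point r a i = real_of_int (a i) / (4 * sqrt (real r))"

lemma finite_lattice_ball [simp]: "finite (lattice_ball r)"
proof -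
  have "finite (PiE {..<r} (\<lambda>_. {- int (4 * r)..int (4 * r)}))" by (rule finite_PiE) auto
  then show ?thesis unfolding lattice_ball_def by simp
qed

lemma sum_half_powers: "(\<Sum>x\<in>{- int B..int B}. (1/2::real) ^ nat \<bar>x\<bar>) = 3 - 2 * (1/2) ^ B"
proof (induction B)
  case (Suc B)
  have "{- int (Suc B)..int (Suc B)} = insert (- int (Suc B)) (insert (int (Suc B)) {- int B..int B})"
    by auto
  then show ?case using Suc by (simp add: nat_add_distrib nat_diff_distrib)
qed simp

text \<open>Weight a point by the product of \<open>(1/2) ^ \<bar>a i\<bar>\<close>. For integers
  \<open>\<bar>x\<bar>\<close> is at most its square, so each point of the ball weighs at least
  \<open>(1/2) ^ (16 * r)\<close>, while the whole box weighs at most \<open>4 ^ r\<close>.\<close>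

lemma card_lattice_ball: "real (card (lattice_ball r)) \<le> (2 ^ 18) ^ r"
proof -
  let ?P = "PiE {..<r} (\<lambda>_. {- int (4 * r)..int (4 * r)})"
  have fin: "finite ?P" by (intro finite_PiE) auto
  have "real (card (lattice_ball r)) * (1/2) ^ (16 * r) = (\<Sum>a\<in>lattice_ball r. (1/2) ^ (16 * r))"
    by simp
  also have "\<dots> \<le> (\<Sum>a\<in>lattice_ball r. \<Prod>i<r. (1/2) ^ nat \<bar>a i\<bar>)"
  proof (intro sum_mono)
    fix a assume "a \<in> lattice_ball r"
    then have a: "(\<Sum>i<r. (a i)\<^sup>2) \<le> 16 * int r" by (simp add: lattice_ball_def)
    have abs_le: "\<bar>x\<bar> \<le> x\<^sup>2" for x :: int
      using mult_left_mono[of 1 "\<bar>x\<bar>" "\<bar>x\<bar>"] by (cases "x = 0") (auto simp: power2_eq_square)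
    have "int (\<Sum>i<r. nat \<bar>a i\<bar>) = (\<Sum>i<r. \<bar>a i\<bar>)" by simp
    also have "\<dots> \<le> (\<Sum>i<r. (a i)\<^sup>2)" by (intro sum_mono abs_le)
    finally have "int (\<Sum>i<r. nat \<bar>a i\<bar>) \<le> (\<Sum>i<r. (a i)\<^sup>2)" .
    then have "(\<Sum>i<r. nat \<bar>a i\<bar>) \<le> 16 * r" using a by linarith
    then show "(1/2::real) ^ (16 * r) \<le> (\<Prod>i<r. (1/2) ^ nat \<bar>a i\<bar>)"
      unfolding power_sum[symmetric] by (intro power_decreasing) auto
  qed
  also have "\<dots> \<le> (\<Sum>a\<in>?P. \<Prod>i<r. (1/2) ^ nat \<bar>a i\<bar>)"
    using fin by (intro sum_mono2) (auto simp: lattice_ball_def prod_nonneg)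
  also have "\<dots> = (\<Prod>i<r. \<Sum>x\<in>{- int (4 * r)..int (4 * r)}. (1/2) ^ nat \<bar>x\<bar>)"
    by (rule prod_sum_PiE[symmetric]) auto
  also have "\<dots> \<le> (\<Prod>i<r. 4)"
    unfolding sum_half_powers by (intro prod_mono) (auto simp: power_le_one algebra_simps intro: order_trans[of _ 2])
  finally have "real (card (lattice_ball r)) * (1/2) ^ (16 * r) \<le> 4 ^ r" by simp
  then have "real (card (lattice_ball r)) \<le> 4 ^ r * 2 ^ (16 * r)"
    by (simp add: power_divide divide_simps)
  also have "\<dots> = (2 ^ 18) ^ r" by (simp add: power_mult flip: power_mult_distrib)
  finally show ?thesis .
qed

lemma sqn_net_point:
  assumes "a \<in> lattice_ball r"
  shows "sqn r (net_point r a) \<le> 1"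
proof (cases "r = 0")
  case False
  have "real_of_int (\<Sum>i<r. (a i)\<^sup>2) \<le> real_of_int (16 * int r)"
    using assms by (intro of_int_le_iff[THEN iffD2]) (simp add: lattice_ball_def)
  then have "(\<Sum>i<r. (real_of_int (a i))\<^sup>2) / (16 * real r) \<le> 1" using False by simp
  moreover have "sqn r (net_point r a) = (\<Sum>i<r. (real_of_int (a i))\<^sup>2) / (16 * real r)"
    using False by (simp add: sqn_def net_point_def power_divide power_mult_distrib sum_divide_distrib)
  ultimately show ?thesis by simp
qed (simp add: sqn_def)

text \<open>Rounding moves each coordinate by at most \<open>1 / (4 * sqrt r)\<close>, hence the
  vector by at most \<open>1/4\<close>.\<close>

lemma net_approximation:
  assumes v: "sqn r v \<le> 1"
  shows "\<exists>a\<in>lattice_ball r. sqn r (\<lambda>i. 4 * (v i - net_point r a i)) \<le> 1"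
proof (cases "r = 0")
  case True
  then show ?thesis by (auto simp: lattice_ball_def sqn_def)
next
  case False
  define s where "s = 4 * sqrt (real r)"
  have s: "s > 0" "s\<^sup>2 = 16 * real r" "s \<le> 4 * real r"
    using False by (auto simp: s_def power_mult_distrib real_le_lsqrt power2_eq_square)
  \<comment> \<open>Rounding towards zero never increases a coordinate in absolute value, so the
    rounded point stays in the ball.\<close>
  define a where "a = restrict (\<lambda>i. if v i \<ge> 0 then \<lfloor>s * v i\<rfloor> else \<lceil>s * v i\<rceil>) {..<r}"
  have a1: "\<bar>real_of_int (a i)\<bar> \<le> \<bar>s * v i\<bar>" and a2: "\<bar>s * v i - real_of_int (a i)\<bar> \<le> 1"
    if "i < r" for i
  proof -
    have "s * v i \<ge> 0 \<longleftrightarrow> v i \<ge> 0" using s by (simp add: zero_le_mult_iff)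
    then show "\<bar>real_of_int (a i)\<bar> \<le> \<bar>s * v i\<bar>" "\<bar>s * v i - real_of_int (a i)\<bar> \<le> 1"
      using that by (auto simp: a_def) linarith+
  qed
  have "real_of_int (\<Sum>i<r. (a i)\<^sup>2) \<le> (\<Sum>i<r. (s * v i)\<^sup>2)"
    using a1 by (auto intro!: sum_mono simp: abs_le_square_iff)
  also have "\<dots> = s\<^sup>2 * sqn r v" by (simp add: sqn_def power_mult_distrib sum_distrib_left)
  also have "\<dots> \<le> real_of_int (16 * int r)" using v s by simp
  finally have "(\<Sum>i<r. (a i)\<^sup>2) \<le> 16 * int r" by linarith
  moreover have "a i \<in> {- int (4 * r)..int (4 * r)}" if "i < r" for i
  proof -
    have "(v i)\<^sup>2 \<le> 1" using component_squared_le_sqn[OF that, of v] v by linarith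
    then have "\<bar>v i\<bar> \<le> 1" by (simp add: abs_square_le_1)
    then have "\<bar>s * v i\<bar> \<le> 4 * real r"
      using s mult_mono[of s "4 * real r" "\<bar>v i\<bar>" 1] by (simp add: abs_mult)
    then have "real_of_int \<bar>a i\<bar> \<le> real_of_int (int (4 * r))" using a1[OF that] by simp
    then have "\<bar>a i\<bar> \<le> int (4 * r)" by linarith
    then show ?thesis by (simp only: atLeastAtMost_iff) linarith
  qed
  moreover have "a \<in> extensional {..<r}" by (simp add: a_def)
  ultimately have "a \<in> lattice_ball r" by (simp add: lattice_ball_def PiE_iff)
  moreover have "sqn r (\<lambda>i. 4 * (v i - net_point r a i)) \<le> 1"
  proof -
    have "(4 * (v i - net_point r a i))\<^sup>2 \<le> 1 / real r" if "i < r" for i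
    proof -
      have "4 * (v i - net_point r a i) = 4 * (s * v i - real_of_int (a i)) / s"
        using s by (simp add: net_point_def s_def field_simps)
      moreover have "(s * v i - real_of_int (a i))\<^sup>2 \<le> 1"
        using a2[OF that] by (simp add: abs_square_le_1)
      ultimately have "(4 * (v i - net_point r a i))\<^sup>2 \<le> 4\<^sup>2 * 1 / s\<^sup>2"
        by (simp only: power_divide power_mult_distrib) (intro divide_right_mono mult_left_mono, auto)
      then show ?thesis by (simp add: s(2))
    qed
    then have "sqn r (\<lambda>i. 4 * (v i - net_point r a i)) \<le> (\<Sum>i<r. 1 / real r)"
      unfolding sqn_def by (intro sum_mono) auto
    then show ?thesis using False by simp
  qed
  ultimately show ?thesis by blast
qed

section \<open>Bilinear forms, and the passage from the net to the whole unit ball\<close>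

definition bilin :: "nat \<Rightarrow> (nat \<Rightarrow> nat \<Rightarrow> real) \<Rightarrow> (nat \<Rightarrow> real) \<Rightarrow> (nat \<Rightarrow> real) \<Rightarrow> real" where
  "bilin N X u v = (\<Sum>i<N. \<Sum>j<N. X i j * u i * v j)"

lemma bilin_eq_dotp: "bilin N X u v = dotp N u (matvec N X v)"
  by (simp add: bilin_def dotp_def matvec_def sum_distrib_left mult_ac)

lemma bilin_diff_left: "bilin N X (\<lambda>i. u i - w i) v = bilin N X u v - bilin N X w v"
  by (simp add: bilin_def algebra_simps sum_subtractf)

lemma bilin_diff_right: "bilin N X u (\<lambda>i. v i - w i) = bilin N X u v - bilin N X u w"
  by (simp add: bilin_def algebra_simps sum_subtractf)

lemma bilin_scale_left: "bilin N X (\<lambda>i. c * u i) v = c * bilin N X u v"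
  by (simp add: bilin_def sum_distrib_left mult_ac)

lemma bilin_scale_right: "bilin N X u (\<lambda>i. c * v i) = c * bilin N X u v"
  by (simp add: bilin_def sum_distrib_left mult_ac)

lemma sqn_scale: "sqn N (\<lambda>i. c * v i) = c\<^sup>2 * sqn N v"
  by (simp add: sqn_def power_mult_distrib sum_distrib_left)

text \<open>Moving either argument to a net point at distance at most \<open>1/4\<close> costs a
  quarter of the supremum over the unit ball. So the supremum is at most \<open>M\<close> plus half
  of itself.\<close>

lemma abs_bilin_le_of_net:
  assumes net: "\<And>a b. a \<in> lattice_ball N \<Longrightarrow> b \<in> lattice_ball N \<Longrightarrow>
      \<bar>bilin N X (net_point N a) (net_point N b)\<bar> \<le> M"
    and u: "sqn N u \<le> 1" and v: "sqn N v \<le> 1"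
  shows "\<bar>bilin N X u v\<bar> \<le> 2 * M"
proof -
  define S where "S = {s. \<exists>u v. sqn N u \<le> 1 \<and> sqn N v \<le> 1 \<and> s = \<bar>bilin N X u v\<bar>}"
  have le1: "\<bar>u i\<bar> \<le> 1" if "sqn N u \<le> 1" "i < N" for u i
    using component_squared_le_sqn[OF that(2), of u] that(1) by (simp add: abs_square_le_1[symmetric])
  have "\<bar>bilin N X u v\<bar> \<le> (\<Sum>i<N. \<Sum>j<N. \<bar>X i j\<bar>)" if "sqn N u \<le> 1" "sqn N v \<le> 1" for u v
  proof -
    have "\<bar>bilin N X u v\<bar> \<le> (\<Sum>i<N. \<Sum>j<N. \<bar>X i j * u i * v j\<bar>)"
      unfolding bilin_def by (intro order_trans[OF sum_abs] sum_mono order_trans[OF sum_abs]) auto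
    also have "\<dots> \<le> (\<Sum>i<N. \<Sum>j<N. \<bar>X i j\<bar>)"
    proof (intro sum_mono)
      fix i j assume "i \<in> {..<N}" "j \<in> {..<N}"
      then have "\<bar>u i\<bar> * \<bar>v j\<bar> \<le> 1" using le1[of u i] le1[of v j] that
        by (intro mult_le_one) auto
      then show "\<bar>X i j * u i * v j\<bar> \<le> \<bar>X i j\<bar>"
        using mult_left_mono[of "\<bar>u i\<bar> * \<bar>v j\<bar>" 1 "\<bar>X i j\<bar>"] by (simp add: abs_mult mult.assoc)
    qed
    finally show ?thesis .
  qed
  \<comment> \<open>The supremum has to be finite before the inequality can be solved for it; the
    sum of all entries in absolute value is a crude bound.\<close>
  then have bdd: "bdd_above S" unfolding S_def by (intro bdd_aboveI) blast
  have mem: "\<bar>bilin N X u v\<bar> \<le> Sup S" if "sqn N u \<le> 1" "sqn N v \<le> 1" for u v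
    by (rule cSup_upper[OF _ bdd]) (use that in \<open>unfold S_def, blast\<close>)
  have step: "\<bar>bilin N X u v\<bar> \<le> M + Sup S / 2" if uv: "sqn N u \<le> 1" "sqn N v \<le> 1" for u v
  proof -
    obtain a where a: "a \<in> lattice_ball N" "sqn N (\<lambda>i. 4 * (u i - net_point N a i)) \<le> 1"
      using net_approximation[OF uv(1)] by blast
    obtain b where b: "b \<in> lattice_ball N" "sqn N (\<lambda>i. 4 * (v i - net_point N b i)) \<le> 1"
      using net_approximation[OF uv(2)] by blast
    have 1: "\<bar>4 * (bilin N X u v - bilin N X (net_point N a) v)\<bar> \<le> Sup S"
      using mem[OF a(2) uv(2)] by (simp only: bilin_scale_left bilin_diff_left)
    have 2: "\<bar>4 * (bilin N X (net_point N a) v - bilin N X (net_point N a) (net_point N b))\<bar> \<le> Sup S"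
      using mem[OF sqn_net_point[OF a(1)] b(2)] by (simp only: bilin_scale_right bilin_diff_right)
    have real_fact: "\<bar>4 * (x - y)\<bar> \<le> s \<Longrightarrow> \<bar>4 * (y - z)\<bar> \<le> s \<Longrightarrow> \<bar>z\<bar> \<le> m \<Longrightarrow> \<bar>x\<bar> \<le> m + s / 2"
      for x y z s m :: real
      by (smt (verit) field_sum_of_halves)
    show ?thesis by (rule real_fact[OF 1 2 net[OF a(1) b(1)]])
  qed
  have "Sup S \<le> M + Sup S / 2"
  proof (rule cSup_least)
    have "sqn N (\<lambda>_. 0) \<le> 1" by (simp add: sqn_def)
    then show "S \<noteq> {}" unfolding S_def by blast
    show "x \<le> M + Sup S / 2" if x: "x \<in> S" for x
    proof -
      obtain u v where "sqn N u \<le> 1" "sqn N v \<le> 1" "x = \<bar>bilin N X u v\<bar>"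
        using x unfolding S_def by blast
      then show ?thesis using step by simp
    qed
  qed
  then show ?thesis using mem[OF u v] by linarith
qed

text \<open>Test the bilinear form on the normalised vectors \<open>v\<close> and
  \<open>matvec N X v\<close>.\<close>

lemma sqn_matvec_le_of_net:
  assumes net: "\<And>a b. a \<in> lattice_ball N \<Longrightarrow> b \<in> lattice_ball N \<Longrightarrow>
      \<bar>bilin N X (net_point N a) (net_point N b)\<bar> \<le> M"
  shows "sqn N (matvec N X v) \<le> (2 * M)\<^sup>2 * sqn N v"
proof (cases "sqn N v = 0 \<or> sqn N (matvec N X v) = 0")
  case True
  moreover have "sqn N (matvec N X v) = 0" if "sqn N v = 0"
  proof -
    have "(\<Sum>j<N. (v j)\<^sup>2) = 0" using that by (simp add: sqn_def)
    then have "\<And>j. j < N \<Longrightarrow> v j = 0" by (subst (asm) sum_nonneg_eq_0_iff) auto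
    then show ?thesis by (simp add: sqn_def matvec_def)
  qed
  ultimately have "sqn N (matvec N X v) = 0" by blast
  then show ?thesis by simp
next
  case False
  let ?w = "matvec N X v"
  define s t where "s = sqrt (sqn N v)" and "t = sqrt (sqn N ?w)"
  have st: "s > 0" "t > 0" "s\<^sup>2 = sqn N v" "t\<^sup>2 = sqn N ?w"
    using False sqn_nonneg[of N v] sqn_nonneg[of N ?w] by (auto simp: s_def t_def less_le)
  have "sqn N (\<lambda>i. (1/t) * ?w i) \<le> 1" "sqn N (\<lambda>i. (1/s) * v i) \<le> 1"
    unfolding sqn_scale power_divide st(3,4) using False by auto
  then have "\<bar>bilin N X (\<lambda>i. (1/t) * ?w i) (\<lambda>i. (1/s) * v i)\<bar> \<le> 2 * M"
    by (intro abs_bilin_le_of_net net)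
  moreover have "bilin N X (\<lambda>i. (1/t) * ?w i) (\<lambda>i. (1/s) * v i) = (1/t) * ((1/s) * t\<^sup>2)"
    unfolding bilin_scale_left bilin_scale_right by (simp add: bilin_eq_dotp st sqn_eq_dotp)
  ultimately have "t / s \<le> 2 * M" using st by (simp add: power2_eq_square)
  then have "t \<le> 2 * M * s" using st by (simp add: field_simps)
  then have "t\<^sup>2 \<le> (2 * M * s)\<^sup>2" using st by (intro power_mono) auto
  then show ?thesis by (simp add: power_mult_distrib st)
qed

text \<open>The maximum over pairs of net points is replaced by a sum of even powers, so that
  expectations can be taken term by term.\<close>

lemma walk_trace_le_net_sum:
  assumes k: "k > 0"
  shows "walk_trace N (2 * k) X \<le> real N * (4 ^ k *
    (\<Sum>a\<in>lattice_ball N. \<Sum>b\<in>lattice_ball N. bilin N X (net_point N a) (net_point N b) ^ (2 * k)))"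
proof -
  let ?f = "\<lambda>(a, b). \<bar>bilin N X (net_point N a) (net_point N b)\<bar>"
  let ?L = "lattice_ball N \<times> lattice_ball N"
  define M where "M = Max (?f ` ?L)"
  have "restrict (\<lambda>_. 0) {..<N} \<in> lattice_ball N" by (auto simp: lattice_ball_def)
  then have ne: "?L \<noteq> {}" by auto
  have "M \<in> ?f ` ?L" unfolding M_def by (intro Max_in) (use ne in auto)
  then obtain a b where ab: "a \<in> lattice_ball N" "b \<in> lattice_ball N" "M = ?f (a, b)" by auto
  have "sqn N (matvec N X v) \<le> (2 * M)\<^sup>2 * sqn N v" for v
  proof (rule sqn_matvec_le_of_net)
    fix a b assume "a \<in> lattice_ball N" "b \<in> lattice_ball N"
    then have "?f (a, b) \<le> M" unfolding M_def by (intro Max_ge) auto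
    then show "\<bar>bilin N X (net_point N a) (net_point N b)\<bar> \<le> M" by simp
  qed
  then have "walk_trace N (2 * k) X \<le> real N * (2 * M) ^ (2 * k)"
    using ab k by (intro walk_trace_le) auto
  also have "(2 * M) ^ (2 * k) = 4 ^ k * bilin N X (net_point N a) (net_point N b) ^ (2 * k)"
    by (simp add: ab(3) power_mult power_mult_distrib)
  also have "bilin N X (net_point N a) (net_point N b) ^ (2 * k) \<le>
      (\<Sum>b\<in>lattice_ball N. bilin N X (net_point N a) (net_point N b) ^ (2 * k))"
    by (rule member_le_sum[OF ab(2)]) (auto simp: power_mult)
  also have "\<dots> \<le> (\<Sum>a\<in>lattice_ball N. \<Sum>b\<in>lattice_ball N.
      bilin N X (net_point N a) (net_point N b) ^ (2 * k))"
    by (rule member_le_sum[OF ab(1)]) (auto simp: power_mult sum_nonneg)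
  finally show ?thesis by (simp add: mult_left_mono)
qed

section \<open>The dense comparison matrix\<close>

text \<open>A single term of the exponential series is at most the whole series.\<close>

lemma power_le_fact_exp:
  fixes x :: real
  assumes "x \<ge> 0"
  shows "x ^ n \<le> fact n * exp x"
proof -
  have "(\<Sum>i\<in>{n}. x ^ i /\<^sub>R fact i) \<le> (\<Sum>i. x ^ i /\<^sub>R fact i)"
    using assms by (intro sum_le_suminf summable_exp_generic) auto
  then have "x ^ n / fact n \<le> exp x" by (simp add: exp_def divide_inverse mult.commute)
  then show ?thesis by (simp add: divide_le_eq mult.commute)
qed

lemma even_power_le_fact_exp: "(x::real) ^ (2 * k) \<le> fact (2 * k) * (exp x + exp (- x))"
proof -
  have "x ^ (2 * k) = \<bar>x\<bar> ^ (2 * k)" by (simp add: power_even_abs)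
  also have "\<dots> \<le> fact (2 * k) * exp \<bar>x\<bar>" by (rule power_le_fact_exp) simp
  also have "\<dots> \<le> fact (2 * k) * (exp x + exp (- x))" by (intro mult_left_mono) (auto simp: abs_if)
  finally show ?thesis .
qed

text \<open>Hoeffding's lemma for a centred variable on an interval of length \<open>3\<close>,
  whence \<open>9 / 8 = 3 ^ 2 / 8\<close>. For negative \<open>x\<close> the two values swap roles,
  so the lemma is again applied at a positive parameter, now with weight \<open>2/3\<close>.\<close>

lemma skew_mgf_le: "1/3 * exp (2 * x) + (1 - 1/3) * exp (- x) \<le> exp (9 / 8 * x\<^sup>2)" for x :: real
proof -
  have le_exp: "z \<le> exp y" if "ln z \<le> y" "0 < z" for y z :: real
    using that by (metis exp_le_cancel_iff exp_ln)
  show ?thesis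
  proof (cases "x \<ge> 0")
    case True
    have "- (3 * x) * (1/3) + ln (1 + 1/3 * (exp (3 * x) - 1)) \<le> (3 * x)\<^sup>2 / 8"
      using Hoeffdings_lemma_aux[of "3 * x" "1/3"] True by simp
    moreover have "1 + 1/3 * (exp (3 * x) - 1) > 0" using exp_gt_zero[of "3 * x"] unfolding right_diff_distrib by linarith
    ultimately have "1 + 1/3 * (exp (3 * x) - 1) \<le> exp (9 / 8 * x\<^sup>2 + x)"
      by (intro le_exp) (auto simp: power_mult_distrib)
    then have "exp (- x) * (1 + 1/3 * (exp (3 * x) - 1)) \<le> exp (- x) * exp (9 / 8 * x\<^sup>2 + x)"
      by (intro mult_left_mono) auto
    then show ?thesis by (simp add: algebra_simps flip: exp_add)
  next
    case False
    have "- (- 3 * x) * (2/3) + ln (1 + 2/3 * (exp (- 3 * x) - 1)) \<le> (- 3 * x)\<^sup>2 / 8"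
      using Hoeffdings_lemma_aux[of "- 3 * x" "2/3"] False by simp
    moreover have "1 + 2/3 * (exp (- 3 * x) - 1) > 0" using exp_gt_zero[of "- 3 * x"] unfolding right_diff_distrib by linarith
    ultimately have "1 + 2/3 * (exp (- 3 * x) - 1) \<le> exp (9 / 8 * x\<^sup>2 - 2 * x)"
      by (intro le_exp) (auto simp: power_mult_distrib)
    then have "exp (2 * x) * (1 + 2/3 * (exp (- 3 * x) - 1)) \<le> exp (2 * x) * exp (9 / 8 * x\<^sup>2 - 2 * x)"
      by (intro mult_left_mono) auto
    then show ?thesis by (simp add: algebra_simps flip: exp_add)
  qed
qed

text \<open>For \<open>e = {i, j}\<close> inside \<open>{..<r}\<close> this is
  \<open>u i * v j + u j * v i\<close>, the coefficient of the variable of edge \<open>e\<close> in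
  the bilinear form.\<close>

definition pair_coeff :: "nat \<Rightarrow> (nat \<Rightarrow> real) \<Rightarrow> (nat \<Rightarrow> real) \<Rightarrow> nat set \<Rightarrow> real" where
  "pair_coeff r u v e = (\<Sum>x | x \<in> {x \<in> {..<r} \<times> {..<r}. fst x \<noteq> snd x} \<and> {fst x, snd x} = e. u (fst x) * v (snd x))"

lemma off_diagonal_group:
  fixes f :: "nat \<times> nat \<Rightarrow> real"
  shows "(\<Sum>x | x \<in> {..<r} \<times> {..<r} \<and> fst x \<noteq> snd x. f x) =
    (\<Sum>e\<in>vertex_pairs r. \<Sum>x | x \<in> {x \<in> {..<r} \<times> {..<r}. fst x \<noteq> snd x} \<and> {fst x, snd x} = e. f x)"
  by (rule sum.group[symmetric]) (auto simp: vertex_pairs_def)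

text \<open>The two mirror entries of an edge are dependent; collecting them turns the form into a
  sum of independent edge variables.\<close>

lemma bilin_edge_mat:
  "bilin r (edge_mat a b E) u v = (\<Sum>e\<in>vertex_pairs r. (if e \<in> E then a else b) * pair_coeff r u v e)"
proof -
  have "bilin r (edge_mat a b E) u v =
      (\<Sum>x\<in>{..<r} \<times> {..<r}. edge_mat a b E (fst x) (snd x) * u (fst x) * v (snd x))"
    by (simp add: bilin_def sum.cartesian_product case_prod_beta)
  also have "\<dots> = (\<Sum>x | x \<in> {..<r} \<times> {..<r} \<and> fst x \<noteq> snd x.
      (if {fst x, snd x} \<in> E then a else b) * (u (fst x) * v (snd x)))"
  proof (rule sum.mono_neutral_cong_right)
    show "\<forall>x\<in>{..<r} \<times> {..<r} - {x. x \<in> {..<r} \<times> {..<r} \<and> fst x \<noteq> snd x}.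
        edge_mat a b E (fst x) (snd x) * u (fst x) * v (snd x) = 0"
      by (simp add: edge_mat_def)
  qed (simp_all add: edge_mat_def subset_iff)
  also have "\<dots> = (\<Sum>e\<in>vertex_pairs r. (if e \<in> E then a else b) * pair_coeff r u v e)"
    by (subst off_diagonal_group, unfold pair_coeff_def sum_distrib_left, intro sum.cong refl) auto
  finally show ?thesis .
qed

text \<open>Cauchy-Schwarz over the at most two orientations of an edge accounts for the factor
  \<open>2\<close>.\<close>

lemma sum_pair_coeff_squared: "(\<Sum>e\<in>vertex_pairs r. (pair_coeff r u v e)\<^sup>2) \<le> 2 * (sqn r u * sqn r v)"
proof -
  let ?F = "\<lambda>e. {x \<in> {x \<in> {..<r} \<times> {..<r}. fst x \<noteq> snd x}. {fst x, snd x} = e}"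
  have "(pair_coeff r u v e)\<^sup>2 \<le> 2 * (\<Sum>x\<in>?F e. (u (fst x) * v (snd x))\<^sup>2)" if e: "e \<in> vertex_pairs r" for e
  proof -
    obtain a b where ab: "e = {a, b}" using e by (auto simp: vertex_pairs_def card_2_iff)
    have "?F e \<subseteq> {(a, b), (b, a)}" unfolding ab by (auto simp: doubleton_eq_iff)
    then have "card (?F e) \<le> card {(a, b), (b, a)}" by (intro card_mono) auto
    also have "\<dots> \<le> 2" using card_length[of "[(a, b), (b, a)]"] by simp
    finally have c: "card (?F e) \<le> 2" .
    have "(pair_coeff r u v e)\<^sup>2 = (\<Sum>x\<in>?F e. 1 * (u (fst x) * v (snd x)))\<^sup>2"
      unfolding pair_coeff_def by simp
    also have "\<dots> \<le> (\<Sum>x\<in>?F e. 1\<^sup>2) * (\<Sum>x\<in>?F e. (u (fst x) * v (snd x))\<^sup>2)"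
      by (rule Cauchy_Schwarz_ineq_sum)
    also have "\<dots> \<le> 2 * (\<Sum>x\<in>?F e. (u (fst x) * v (snd x))\<^sup>2)"
      using c by (intro mult_right_mono) (auto simp: sum_nonneg)
    finally show ?thesis .
  qed
  then have "(\<Sum>e\<in>vertex_pairs r. (pair_coeff r u v e)\<^sup>2) \<le>
      (\<Sum>e\<in>vertex_pairs r. 2 * (\<Sum>x\<in>?F e. (u (fst x) * v (snd x))\<^sup>2))"
    by (rule sum_mono)
  also have "\<dots> = 2 * (\<Sum>x | x \<in> {..<r} \<times> {..<r} \<and> fst x \<noteq> snd x. (u (fst x) * v (snd x))\<^sup>2)"
    by (subst off_diagonal_group) (simp only: sum_distrib_left)
  also have "\<dots> \<le> 2 * (\<Sum>x\<in>{..<r} \<times> {..<r}. (u (fst x) * v (snd x))\<^sup>2)"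
    by (intro mult_left_mono sum_mono2) auto
  also have "(\<Sum>x\<in>{..<r} \<times> {..<r}. (u (fst x) * v (snd x))\<^sup>2) = sqn r u * sqn r v"
    unfolding sqn_def sum_product sum.cartesian_product by (simp only: case_prod_unfold power_mult_distrib)
  finally show ?thesis .
qed

text \<open>The edge factors are independent, so their subgaussian exponents add up to
  \<open>9 / 8\<close> times the sum of squared coefficients, which is at most
  \<open>2\<close>.\<close>

lemma expect_exp_bilin_le:
  assumes "sqn r u \<le> 1" "sqn r v \<le> 1"
  shows "expect (vertex_pairs r) (1/3) (\<lambda>E. exp (l * bilin r (edge_mat 2 (-1) E) u v)) \<le> exp (9 / 4 * l\<^sup>2)"
proof -
  let ?P = "vertex_pairs r" and ?c = "pair_coeff r u v"
  have "expect ?P (1/3) (\<lambda>E. exp (l * bilin r (edge_mat 2 (-1) E) u v)) =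
      expect ?P (1/3) (\<lambda>E. \<Prod>e\<in>?P. exp (l * ((if e \<in> E then 2 else -1) * ?c e)))"
    by (simp add: bilin_edge_mat sum_distrib_left exp_sum)
  also have "\<dots> = (\<Prod>e\<in>?P. 1/3 * exp (l * ((if True then 2 else -1) * ?c e))
      + (1 - 1/3) * exp (l * ((if False then 2 else -1) * ?c e)))"
    by (rule expect_prod) simp
  also have "\<dots> \<le> (\<Prod>e\<in>?P. exp (9 / 8 * (l * ?c e)\<^sup>2))"
  proof (intro prod_mono conjI)
    fix e
    show "1/3 * exp (l * ((if True then 2 else -1) * ?c e))
        + (1 - 1/3) * exp (l * ((if False then 2 else -1) * ?c e)) \<le> exp (9 / 8 * (l * ?c e)\<^sup>2)"
      using skew_mgf_le[of "l * ?c e"] by (simp add: mult_ac)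
  qed (auto intro!: add_nonneg_nonneg)
  also have "\<dots> = exp (9 / 8 * l\<^sup>2 * (\<Sum>e\<in>?P. (?c e)\<^sup>2))"
    by (simp add: exp_sum[symmetric] sum_distrib_left power_mult_distrib mult_ac)
  also have "\<dots> \<le> exp (9 / 8 * l\<^sup>2 * (2 * 1))"
  proof -
    have "(\<Sum>e\<in>?P. (?c e)\<^sup>2) \<le> 2 * (sqn r u * sqn r v)" by (rule sum_pair_coeff_squared)
    also have "\<dots> \<le> 2 * (1 * 1)" using assms by (intro mult_left_mono mult_mono) auto
    finally show ?thesis by (simp only: exp_le_cancel_iff) (intro mult_left_mono, auto)
  qed
  finally show ?thesis by simp
qed

lemma expect_bilin_power_le:
  assumes uv: "sqn r u \<le> 1" "sqn r v \<le> 1" and k: "k > 0"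
  shows "expect (vertex_pairs r) (1/3) (\<lambda>E. bilin r (edge_mat 2 (-1) E) u v ^ (2 * k))
    \<le> (8 * exp 3 * real k) ^ k"
proof -
  let ?P = "vertex_pairs r" and ?B = "\<lambda>E. bilin r (edge_mat 2 (-1) E) u v"
  \<comment> \<open>This tilt keeps the exponent \<open>9 / 4 * l^2\<close> linear in
    \<open>k\<close>; dividing \<open>fact (2 * k)\<close> by \<open>l ^ (2 * k)\<close> then leaves
    a bound of order \<open>k ^ k\<close> up to a constant to the power \<open>k\<close>.\<close>
  define l where "l = sqrt (real k)"
  have l: "l\<^sup>2 = real k" by (simp add: l_def)
  have "real k ^ k * expect ?P (1/3) (\<lambda>E. ?B E ^ (2 * k)) =
      expect ?P (1/3) (\<lambda>E. (l * ?B E) ^ (2 * k))"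
    unfolding expect_cmult[symmetric] by (simp add: power_mult power_mult_distrib l)
  also have "\<dots> \<le> expect ?P (1/3) (\<lambda>E. fact (2 * k) * (exp (l * ?B E) + exp ((- l) * ?B E)))"
    using even_power_le_fact_exp by (intro expect_mono) auto
  also have "\<dots> = fact (2 * k) * (expect ?P (1/3) (\<lambda>E. exp (l * ?B E)) + expect ?P (1/3) (\<lambda>E. exp ((- l) * ?B E)))"
    unfolding expect_cmult by (simp add: expect_def algebra_simps sum.distrib)
  also have "\<dots> \<le> fact (2 * k) * (exp (9 / 4 * l\<^sup>2) + exp (9 / 4 * (- l)\<^sup>2))"
    by (intro mult_left_mono add_mono expect_exp_bilin_le uv) auto
  also have "\<dots> = fact (2 * k) * (2 * exp (9 / 4 * real k))" by (simp add: l)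
  also have "\<dots> \<le> (2 * real k) ^ (2 * k) * (2 ^ k * exp (3 * real k))"
  proof (intro mult_mono)
    have "(fact (2 * k) :: real) \<le> real (2 * k) ^ (2 * k)"
      by (metis fact_le_power order_refl of_nat_fact of_nat_power of_nat_le_iff)
    then show "(fact (2 * k) :: real) \<le> (2 * real k) ^ (2 * k)" by simp
    have "(2::real) ^ 1 \<le> 2 ^ k" using k by (intro power_increasing) auto
    then show "(2::real) \<le> 2 ^ k" by simp
  qed auto
  also have "\<dots> = real k ^ k * (8 * exp 3 * real k) ^ k"
  proof -
    have "(2 * real k)\<^sup>2 = 4 * real k * real k" by (simp add: power2_eq_square)
    then have "(2 * real k) ^ (2 * k) = (4 * real k * real k) ^ k" by (simp only: power_mult)
    moreover have "exp (3 * real k) = exp 3 ^ k"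
      using exp_of_nat_mult[of k "3::real"] by (simp add: mult.commute)
    moreover have "4 * real k * real k * (2 * exp 3) = real k * (8 * exp 3 * real k)" by simp
    ultimately show ?thesis by (simp only: flip: power_mult_distrib)
  qed
  finally show ?thesis using k by simp
qed

text \<open>Per unit of \<open>k\<close>: \<open>4\<close> is the loss in passing to the net,
  \<open>2 ^ 72\<close> bounds the number of pairs of net points in dimension \<open>2 * k\<close>,
  and \<open>8 * exp 3\<close> comes from the moment bound.\<close>

definition trace_const :: real where "trace_const = 4 * 2 ^ 72 * (8 * exp 3)"

text \<open>Matrix size and moment order both equal \<open>2 * k\<close>, so the size of the net,
  exponential in the dimension, costs only a constant factor per unit of \<open>k\<close>.\<close>

lemma expect_skew_walk_trace_le:
  assumes k: "k > 0"
  shows "expect (vertex_pairs (2 * k)) (1/3) (\<lambda>E. walk_trace (2 * k) (2 * k) (edge_mat 2 (-1) E))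
    \<le> real (2 * k) * (trace_const * real k) ^ k"
proof -
  let ?r = "2 * k" and ?L = "lattice_ball (2 * k)"
  let ?B = "\<lambda>a b E. bilin ?r (edge_mat 2 (-1) E) (net_point ?r a) (net_point ?r b) ^ (2 * k)"
  have "expect (vertex_pairs ?r) (1/3) (\<lambda>E. walk_trace ?r (2 * k) (edge_mat 2 (-1) E))
      \<le> expect (vertex_pairs ?r) (1/3) (\<lambda>E. real ?r * (4 ^ k * (\<Sum>a\<in>?L. \<Sum>b\<in>?L. ?B a b E)))"
    by (intro expect_mono walk_trace_le_net_sum k) auto
  also have "\<dots> = real ?r * (4 ^ k * (\<Sum>a\<in>?L. \<Sum>b\<in>?L. expect (vertex_pairs ?r) (1/3) (?B a b)))"
    by (simp only: expect_cmult expect_sum)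
  also have "\<dots> \<le> real ?r * (4 ^ k * (\<Sum>a\<in>?L. \<Sum>b\<in>?L. (8 * exp 3 * real k) ^ k))"
    by (intro mult_left_mono sum_mono expect_bilin_power_le sqn_net_point k) auto
  also have "\<dots> = real ?r * (4 ^ k * (real (card ?L) * real (card ?L)) * (8 * exp 3 * real k) ^ k)"
    by simp
  also have "\<dots> \<le> real ?r * (4 ^ k * ((2 ^ 18) ^ ?r * (2 ^ 18) ^ ?r) * (8 * exp 3 * real k) ^ k)"
    by (intro mult_left_mono mult_right_mono mult_mono card_lattice_ball) auto
  also have "4 ^ k * ((2 ^ 18) ^ ?r * (2 ^ 18) ^ ?r) * (8 * exp 3 * real k) ^ k = (trace_const * real k) ^ k"
  proof -
    have "4 * (((2 ^ 18) ^ 2) * ((2 ^ 18) ^ 2)) * (8 * exp 3 * real k) = trace_const * real k"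
      by (simp add: trace_const_def)
    then show ?thesis by (simp only: power_mult flip: power_mult_distrib)
  qed
  finally show ?thesis .
qed

section \<open>Tail bounds for the random graph\<close>

lemma walk_trace_nonneg:
  assumes sym: "\<And>i j. X i j = X j i" and k: "k > 0"
  shows "walk_trace N (2 * k) X \<ge> 0"
proof (cases "N = 0")
  case True
  then have "walks N (2 * k) = {}" using k by (auto simp: walks_def)
  then show ?thesis by (simp add: walk_trace_def)
next
  case False
  then have "0 \<le> walk_trace N (2 * k) X * sqn N (kron 0)"
    using order_trans[OF sqn_nonneg sqn_funpow_le_walk_trace[where X = X and v = "kron 0", OF sym k]] by blast
  then show ?thesis using False by (simp add: sqn_kron)
qed

lemma trace_const_pos: "trace_const > 0"
  by (simp add: trace_const_def)

text \<open>Markov's inequality for the trace of the \<open>2 * k\<close>-th power. The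
  \<open>exp 2\<close> in the threshold produces the decay \<open>exp (- 2 * k)\<close>.\<close>

lemma centred_matrix_norm_tail:
  assumes p: "0 \<le> p" "p \<le> 1" and k: "k > 0" "real n * p \<le> real k"
  shows "expect (vertex_pairs n) p (\<lambda>E. of_bool (\<exists>v. sqn n (matvec n (edge_mat (1 - p) (- p) E) v)
      > exp 2 * trace_const * real k * sqn n v)) \<le> real n * exp (- 2 * real k)"
proof -
  define t where "t = exp 2 * trace_const * real k"
  have t: "t > 0" using k trace_const_pos by (simp add: t_def)
  let ?X = "edge_mat (1 - p) (- p)"
  have "expect (vertex_pairs n) p (\<lambda>E. of_bool (\<exists>v. sqn n (matvec n (?X E) v) > t * sqn n v))
      \<le> expect (vertex_pairs n) p (\<lambda>E. (1 / t ^ k) * walk_trace n (2 * k) (?X E))"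
  proof (intro expect_mono p)
    fix E
    show "of_bool (\<exists>v. sqn n (matvec n (?X E) v) > t * sqn n v) \<le> (1 / t ^ k) * walk_trace n (2 * k) (?X E)"
    proof (cases "walk_trace n (2 * k) (?X E) \<le> t ^ k")
      case True
      then have "\<not> (\<exists>v. sqn n (matvec n (?X E) v) > t * sqn n v)"
        using sqn_matvec_le_of_walk_trace[of "?X E" k n t] k t by (auto simp: edge_mat_commute not_less)
      then show ?thesis using walk_trace_nonneg[of "?X E" k n] k t
        by (simp add: edge_mat_commute del: not_ex)
    next
      case False
      then have "1 \<le> (1 / t ^ k) * walk_trace n (2 * k) (?X E)" using t by (simp add: field_simps)
      then show ?thesis by (smt (verit) of_bool_less_eq_one)
    qed
  qed
  also have "\<dots> = (1 / t ^ k) * expect (vertex_pairs n) p (\<lambda>E. walk_trace n (2 * k) (?X E))"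
    by (rule expect_cmult)
  also have "\<dots> \<le> (1 / t ^ k) * (real n * (trace_const * real k) ^ k)"
  proof (intro mult_left_mono)
    \<comment> \<open>A comparison matrix of size \<open>2 * k\<close> is large enough because
      \<open>n * p \<le> k\<close>.\<close>
    have "real (2 * k) * expect (vertex_pairs n) p (\<lambda>E. walk_trace n (2 * k) (?X E))
        \<le> real n * expect (vertex_pairs (2 * k)) (1/3) (\<lambda>E. walk_trace (2 * k) (2 * k) (edge_mat 2 (-1) E))"
      using k by (intro expect_walk_trace_comparison p) auto
    also have "\<dots> \<le> real n * (real (2 * k) * (trace_const * real k) ^ k)"
      by (intro mult_left_mono expect_skew_walk_trace_le k) auto
    finally have "real (2 * k) * expect (vertex_pairs n) p (\<lambda>E. walk_trace n (2 * k) (?X E))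
        \<le> real (2 * k) * (real n * (trace_const * real k) ^ k)" by (simp only: mult_ac)
    then show "expect (vertex_pairs n) p (\<lambda>E. walk_trace n (2 * k) (?X E)) \<le> real n * (trace_const * real k) ^ k"
      using k by (subst (asm) mult_le_cancel_left_pos) auto
  qed (use t in auto)
  also have "\<dots> = real n * exp (- 2 * real k)"
  proof -
    define q where "q = (trace_const * real k) ^ k"
    have tq: "t ^ k = exp (2 * real k) * q"
      using exp_of_nat_mult[of k "2::real"] by (simp add: t_def q_def power_mult_distrib mult_ac)
    have "q \<noteq> 0" using k trace_const_pos by (simp add: q_def)
    then show ?thesis unfolding tq q_def[symmetric] by (simp add: exp_minus field_simps)
  qed
  finally show ?thesis by (simp add: t_def)
qed

section \<open>Low-degree vertices at distance at most two\<close>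

definition low_degree :: "nat \<Rightarrow> real \<Rightarrow> nat set set \<Rightarrow> nat set" where
  "low_degree n D E = {v. v < n \<and> real (degree_of {..<n} E v) < D}"

lemma vertex_pairs_other_end:
  assumes "e \<in> vertex_pairs n" "v \<in> e"
  obtains u where "e = {u, v}"
proof -
  obtain a b where "e = {a, b}" using assms by (auto simp: vertex_pairs_def card_2_iff)
  then have "e = {a, v} \<or> e = {b, v}" using assms(2) by auto
  with that show ?thesis by blast
qed

lemma inj_on_doubleton: "inj_on (\<lambda>x. {x, v}) A"
  by (rule inj_onI) (metis doubleton_eq_iff)

lemma degree_of_vertex_pairs:
  assumes "E \<subseteq> vertex_pairs n" "v < n"
  shows "real (degree_of {..<n} E v) = (\<Sum>e | e \<in> vertex_pairs n \<and> v \<in> e. of_bool (e \<in> E))"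
proof -
  have "card {u \<in> {..<n}. {u, v} \<in> E} = card {e \<in> E. v \<in> e}"
  proof (rule bij_betw_same_card[of "\<lambda>u. {u, v}"], unfold bij_betw_def, intro conjI)
    show "inj_on (\<lambda>u. {u, v}) {u \<in> {..<n}. {u, v} \<in> E}"
      by (rule inj_on_doubleton)
    show "(\<lambda>u. {u, v}) ` {u \<in> {..<n}. {u, v} \<in> E} = {e \<in> E. v \<in> e}"
    proof (intro equalityI subsetI)
      fix e assume e: "e \<in> {e \<in> E. v \<in> e}"
      then have "e \<in> vertex_pairs n" "v \<in> e" "e \<in> E" using assms by auto
      moreover from this obtain u where u: "e = {u, v}" using vertex_pairs_other_end by blast
      ultimately have "u < n" "{u, v} \<in> E" by (auto simp: vertex_pairs_def)
      then show "e \<in> (\<lambda>u. {u, v}) ` {u \<in> {..<n}. {u, v} \<in> E}" using u by auto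
    qed auto
  qed
  also have "{e \<in> E. v \<in> e} = {e \<in> {e \<in> vertex_pairs n. v \<in> e}. e \<in> E}" using assms by auto
  finally show ?thesis by (simp add: degree_of_def sum_of_bool_eq Int_def conj_ac)
qed

lemma card_pairs_meeting_once:
  assumes uv: "u \<noteq> v" "u < n" "v < n"
  shows "2 * (n - 2) \<le> card {e \<in> vertex_pairs n. (u \<in> e) \<noteq> (v \<in> e)}"
proof -
  let ?R = "{..<n} - {u, v}"
  let ?A = "(\<lambda>x. {x, u}) ` ?R" and ?B = "(\<lambda>x. {x, v}) ` ?R"
  have cR: "card ?R = n - 2" using uv by (simp add: card_Diff_subset)
  have "card (?A \<union> ?B) = card ?A + card ?B"
    using uv by (intro card_Un_disjoint) (auto simp: doubleton_eq_iff)
  also have "card ?A = n - 2" using cR by (simp add: card_image inj_on_doubleton)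
  also have "card ?B = n - 2" using cR by (simp add: card_image inj_on_doubleton)
  finally have "2 * (n - 2) = card (?A \<union> ?B)" by simp
  also have "\<dots> \<le> card {e \<in> vertex_pairs n. (u \<in> e) \<noteq> (v \<in> e)}"
    using uv by (intro card_mono) (auto simp: vertex_pairs_def card_insert_if)
  finally show ?thesis .
qed

text \<open>Exponential tilting: when both degrees are below \<open>D\<close>,
  \<open>exp (2 * s * D)\<close> times the product of \<open>exp (- s)\<close> over all incidences
  with \<open>u\<close> and \<open>v\<close> is at least \<open>1\<close>. Each edge in
  \<open>F\<close> contributes at most \<open>p\<close>; other pairs meeting just one of
  \<open>u\<close>, \<open>v\<close> contribute \<open>1 - p * (1 - exp (- s))\<close>.\<close>

lemma expect_low_pair_le:
  assumes p: "0 \<le> p" "p \<le> 1" and s: "s \<ge> 0" and uv: "u \<noteq> v" "u < n" "v < n"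
    and F: "F \<subseteq> vertex_pairs n" "card F \<le> 2"
  shows "expect (vertex_pairs n) p (\<lambda>E. of_bool (u \<in> low_degree n D E \<and> v \<in> low_degree n D E \<and> F \<subseteq> E))
    \<le> p ^ card F * exp (2 * s * D - 2 * p * (1 - exp (- s)) * (real n - 3))"
proof -
  let ?P = "vertex_pairs n"
  define m where "m e = (of_bool (u \<in> e) + of_bool (v \<in> e) :: real)" for e :: "nat set"
  define Z where "Z = {e \<in> ?P. (u \<in> e) \<noteq> (v \<in> e)} - F"
  \<comment> \<open>An absent edge of \<open>F\<close> contributes the factor \<open>0\<close>, so
    the product also encodes the condition \<open>F \<subseteq> E\<close>.\<close>
  define \<phi> where "\<phi> e b = (if b then exp (- s * m e) else of_bool (e \<notin> F))" for e b
  have finF: "finite F" by (rule finite_subset[OF F(1) finite_vertex_pairs])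
  have "expect ?P p (\<lambda>E. of_bool (u \<in> low_degree n D E \<and> v \<in> low_degree n D E \<and> F \<subseteq> E))
      \<le> expect ?P p (\<lambda>E. exp (2 * s * D) * (\<Prod>e\<in>?P. \<phi> e (e \<in> E)))"
  proof (intro expect_mono p)
    fix E assume E: "E \<subseteq> ?P"
    show "of_bool (u \<in> low_degree n D E \<and> v \<in> low_degree n D E \<and> F \<subseteq> E)
        \<le> exp (2 * s * D) * (\<Prod>e\<in>?P. \<phi> e (e \<in> E))"
    proof (cases "u \<in> low_degree n D E \<and> v \<in> low_degree n D E \<and> F \<subseteq> E")
      case True
      have "(\<Prod>e\<in>?P. \<phi> e (e \<in> E)) = (\<Prod>e\<in>?P. exp (- s * (m e * of_bool (e \<in> E))))"
        using True by (intro prod.cong) (auto simp: \<phi>_def)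
      also have "\<dots> = exp (- s * (\<Sum>e\<in>?P. m e * of_bool (e \<in> E)))"
        unfolding sum_distrib_left by (rule exp_sum[symmetric]) simp
      also have "(\<Sum>e\<in>?P. m e * of_bool (e \<in> E)) =
          (\<Sum>e\<in>?P. of_bool (u \<in> e) * of_bool (e \<in> E)) + (\<Sum>e\<in>?P. of_bool (v \<in> e) * of_bool (e \<in> E))"
        by (simp add: m_def distrib_right sum.distrib)
      also have "\<dots> = real (degree_of {..<n} E u) + real (degree_of {..<n} E v)"
        unfolding degree_of_vertex_pairs[OF E uv(2)] degree_of_vertex_pairs[OF E uv(3)]
        by (intro arg_cong2[of _ _ _ _ "(+)"] sum.mono_neutral_cong_right) auto
      finally have "exp (2 * s * D) * (\<Prod>e\<in>?P. \<phi> e (e \<in> E)) =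
          exp (s * (2 * D - (real (degree_of {..<n} E u) + real (degree_of {..<n} E v))))"
        by (simp add: algebra_simps flip: exp_add)
      moreover have "0 \<le> s * (2 * D - (real (degree_of {..<n} E u) + real (degree_of {..<n} E v)))"
        using True s by (intro mult_nonneg_nonneg) (auto simp: low_degree_def)
      ultimately show ?thesis by simp
    next
      case False
      then show ?thesis by (auto simp: \<phi>_def intro!: mult_nonneg_nonneg prod_nonneg simp del: of_bool_eq_0_iff)
    qed
  qed
  also have "\<dots> = exp (2 * s * D) * (\<Prod>e\<in>?P. p * \<phi> e True + (1 - p) * \<phi> e False)"
    unfolding expect_cmult by (subst expect_prod) simp_all
  finally have tilt: "expect ?P p (\<lambda>E. of_bool (u \<in> low_degree n D E \<and> v \<in> low_degree n D E \<and> F \<subseteq> E))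
      \<le> exp (2 * s * D) * (\<Prod>e\<in>?P. p * \<phi> e True + (1 - p) * \<phi> e False)" .
  have "(\<Prod>e\<in>?P. p * \<phi> e True + (1 - p) * \<phi> e False)
      \<le> (\<Prod>e\<in>?P. (if e \<in> F then p else 1) * (if e \<in> Z then exp (- p * (1 - exp (- s))) else 1))"
  proof (intro prod_mono conjI)
    fix e assume "e \<in> ?P"
    show "0 \<le> p * \<phi> e True + (1 - p) * \<phi> e False" using p by (simp add: \<phi>_def)
    have m0: "m e \<ge> 0" by (simp add: m_def)
    have le1: "exp (- s * m e) \<le> 1" using s m0 by simp
    consider "e \<in> F" | "e \<notin> F" "e \<in> Z" | "e \<notin> F" "e \<notin> Z" by blast
    then show "p * \<phi> e True + (1 - p) * \<phi> e False
        \<le> (if e \<in> F then p else 1) * (if e \<in> Z then exp (- p * (1 - exp (- s))) else 1)"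
    proof cases
      case 1
      then show ?thesis using mult_left_mono[OF le1 p(1)] by (simp add: \<phi>_def Z_def)
    next
      case 2
      then have "m e = 1" by (auto simp: Z_def m_def)
      then have "p * \<phi> e True + (1 - p) * \<phi> e False = 1 + (- p * (1 - exp (- s)))"
        using 2 by (simp add: \<phi>_def algebra_simps)
      also have "\<dots> \<le> exp (- p * (1 - exp (- s)))" by (rule exp_ge_add_one_self)
      finally show ?thesis using 2 by simp
    next
      case 3
      then show ?thesis using mult_left_mono[OF le1 p(1)] by (simp add: \<phi>_def)
    qed
  qed
  also have "\<dots> = p ^ card F * exp (- p * (1 - exp (- s))) ^ card Z"
  proof -
    have "?P \<inter> F = F" "?P \<inter> Z = Z" using F by (auto simp: Z_def)
    then show ?thesis by (simp add: prod.distrib prod.If_cases)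
  qed
  also have "\<dots> = p ^ card F * exp (- (p * (1 - exp (- s))) * real (card Z))"
    by (simp add: exp_of_nat_mult[symmetric] mult_ac)
  also have "\<dots> \<le> p ^ card F * exp (- (p * (1 - exp (- s))) * (2 * real n - 6))"
  proof -
    have "card {e \<in> ?P. (u \<in> e) \<noteq> (v \<in> e)} - card F \<le> card Z"
      unfolding Z_def by (rule diff_card_le_card_Diff[OF finF])
    \<comment> \<open>At most two of the \<open>2 * (n - 2)\<close> pairs are lost to
      \<open>F\<close>; the additive form remains correct under truncated subtraction.\<close>
    then have "2 * n \<le> card Z + 6" using card_pairs_meeting_once[OF uv] F(2) by linarith
    then have "2 * real n - 6 \<le> real (card Z)" by linarith
    then show ?thesis using p s by (auto intro!: mult_left_mono mult_nonneg_nonneg)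
  qed
  finally have "(\<Prod>e\<in>?P. p * \<phi> e True + (1 - p) * \<phi> e False)
      \<le> p ^ card F * exp (- (p * (1 - exp (- s))) * (2 * real n - 6))" .
  then have "exp (2 * s * D) * (\<Prod>e\<in>?P. p * \<phi> e True + (1 - p) * \<phi> e False)
      \<le> exp (2 * s * D) * (p ^ card F * exp (- (p * (1 - exp (- s))) * (2 * real n - 6)))"
    by (rule mult_left_mono) simp
  also have "\<dots> = p ^ card F * exp (2 * s * D - 2 * p * (1 - exp (- s)) * (real n - 3))"
    by (simp add: mult_exp_exp algebra_simps)
  finally show ?thesis using tilt by linarith
qed

definition crowded :: "nat \<Rightarrow> real \<Rightarrow> nat set set \<Rightarrow> bool" where
  "crowded n D E \<longleftrightarrow> (\<exists>u\<in>low_degree n D E. \<exists>v\<in>low_degree n D E. u \<noteq> v \<and>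
     ({u, v} \<in> E \<or> (\<exists>w<n. w \<noteq> u \<and> w \<noteq> v \<and> {u, w} \<in> E \<and> {v, w} \<in> E)))"

text \<open>Union bound: ordered pairs with one prescribed edge give \<open>n^2 * p\<close>, and
  triples with two prescribed edges give \<open>n^3 * p^2\<close>.\<close>

lemma expect_crowded_le:
  assumes p: "0 \<le> p" "p \<le> 1" and s: "s \<ge> 0"
  shows "expect (vertex_pairs n) p (\<lambda>E. of_bool (crowded n D E))
    \<le> (real n ^ 2 * p + real n ^ 3 * p\<^sup>2) * exp (2 * s * D - 2 * p * (1 - exp (- s)) * (real n - 3))"
proof -
  let ?P = "vertex_pairs n" and ?B = "exp (2 * s * D - 2 * p * (1 - exp (- s)) * (real n - 3))"
  define lo where "lo u v F E \<longleftrightarrow> u \<in> low_degree n D E \<and> v \<in> low_degree n D E \<and> F \<subseteq> E" for u v F E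
  define I where "I = {x \<in> {..<n} \<times> {..<n}. fst x \<noteq> snd x}"
  define J where "J = {y \<in> I \<times> {..<n}. snd y \<noteq> fst (fst y) \<and> snd y \<noteq> snd (fst y)}"
  define F2 where "F2 y = {{fst (fst y), snd y}, {snd (fst y), snd y}}" for y :: "(nat \<times> nat) \<times> nat"
  define b1 where "b1 E x = (of_bool (lo (fst x) (snd x) {{fst x, snd x}} E) :: real)" for E x
  define b2 where "b2 E y = (of_bool (lo (fst (fst y)) (snd (fst y)) (F2 y) E) :: real)" for E y
  have fin: "finite I" "finite J" by (simp_all add: I_def J_def)
  have nn: "b1 E x \<ge> 0" "b2 E y \<ge> 0" for E x y by (simp_all add: b1_def b2_def)
  have "expect ?P p (\<lambda>E. of_bool (crowded n D E))
      \<le> expect ?P p (\<lambda>E. \<Sum>z\<in>I <+> J. case z of Inl x \<Rightarrow> b1 E x | Inr y \<Rightarrow> b2 E y)"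
  proof (intro expect_mono p)
    fix E
    let ?g = "\<lambda>z. case z of Inl x \<Rightarrow> b1 E x | Inr y \<Rightarrow> b2 E y"
    have g0: "?g z \<ge> 0" for z using nn by (cases z) auto
    show "of_bool (crowded n D E) \<le> (\<Sum>z\<in>I <+> J. ?g z)"
    proof (cases "crowded n D E")
      case True
      then obtain u v where uv: "u \<in> low_degree n D E" "v \<in> low_degree n D E" "u \<noteq> v"
        and c: "{u, v} \<in> E \<or> (\<exists>w<n. w \<noteq> u \<and> w \<noteq> v \<and> {u, w} \<in> E \<and> {v, w} \<in> E)"
        unfolding crowded_def by blast
      have "\<exists>z\<in>I <+> J. ?g z = 1"
        using c
      proof
        assume "{u, v} \<in> E"
        then show ?thesis using uv
          by (intro bexI[of _ "Inl (u, v)"]) (auto simp: b1_def lo_def I_def low_degree_def)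
      next
        assume "\<exists>w<n. w \<noteq> u \<and> w \<noteq> v \<and> {u, w} \<in> E \<and> {v, w} \<in> E"
        then obtain w where "w < n" "w \<noteq> u" "w \<noteq> v" "{u, w} \<in> E" "{v, w} \<in> E" by blast
        then show ?thesis using uv
          by (intro bexI[of _ "Inr ((u, v), w)"]) (auto simp: b2_def F2_def lo_def I_def J_def low_degree_def)
      qed
      then obtain z where z: "z \<in> I <+> J" "?g z = 1" by blast
      have "?g z \<le> (\<Sum>z\<in>I <+> J. ?g z)"
        using z(1) fin g0 by (intro member_le_sum) auto
      then show ?thesis using z True by simp
    qed (use g0 in \<open>simp add: sum_nonneg\<close>)
  qed
  also have "\<dots> = (\<Sum>x\<in>I. expect ?P p (\<lambda>E. b1 E x)) + (\<Sum>y\<in>J. expect ?P p (\<lambda>E. b2 E y))"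
    using fin by (simp add: expect_sum expect_add sum.Plus)
  also have "\<dots> \<le> (\<Sum>x\<in>I. p * ?B) + (\<Sum>y\<in>J. p\<^sup>2 * ?B)"
  proof (intro add_mono sum_mono)
    fix x assume "x \<in> I"
    then show "expect ?P p (\<lambda>E. b1 E x) \<le> p * ?B"
      using expect_low_pair_le[OF p s, of "fst x" "snd x" n "{{fst x, snd x}}" D]
      by (auto simp: b1_def lo_def I_def vertex_pairs_def)
  next
    fix y assume y: "y \<in> J"
    then have "{fst (fst y), snd y} \<noteq> {snd (fst y), snd y}"
      by (auto simp: J_def I_def doubleton_eq_iff)
    then have "card (F2 y) = 2" by (simp add: F2_def)
    moreover have "F2 y \<subseteq> ?P" using y by (auto simp: F2_def J_def I_def vertex_pairs_def)
    ultimately show "expect ?P p (\<lambda>E. b2 E y) \<le> p\<^sup>2 * ?B"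
      using expect_low_pair_le[OF p s, of "fst (fst y)" "snd (fst y)" n "F2 y" D] y
      by (auto simp: b2_def lo_def I_def J_def)
  qed
  also have "\<dots> = (real (card I) * p + real (card J) * p\<^sup>2) * ?B" by (simp add: algebra_simps)
  also have "\<dots> \<le> (real n ^ 2 * p + real n ^ 3 * p\<^sup>2) * ?B"
  proof -
    have "card I \<le> card ({..<n} \<times> {..<n})" unfolding I_def by (intro card_mono) auto
    then have I: "card I \<le> n ^ 2" by (simp add: power2_eq_square)
    have "card J \<le> card (I \<times> {..<n})" using fin unfolding J_def by (intro card_mono) auto
    also have "\<dots> \<le> n ^ 2 * n" using I by (simp add: card_cartesian_product)
    finally have "card J \<le> n ^ 3" by (simp add: power2_eq_square power3_eq_cube)
    then have "real (card J) \<le> real n ^ 3" by (metis of_nat_le_iff of_nat_power)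
    moreover have "real (card I) \<le> real n ^ 2" using I by (metis of_nat_le_iff of_nat_power)
    ultimately show ?thesis using p by (intro mult_right_mono add_mono) auto
  qed
  finally show ?thesis .
qed

text \<open>
  The bound is obtained with a tilting parameter \<open>s\<close> so large that \<open>1 - exp (- s)\<close> is close to
  \<open>1\<close>, and then \<open>\<eta>\<close> so small that the factor \<open>exp (2 * s * \<eta> * d)\<close> is harmless.
\<close>

lemma crowded_tail:
  assumes \<epsilon>: "\<epsilon> > 0"
  obtains \<eta> K :: real where "0 < \<eta>" "\<eta> \<le> 1/2" "K \<ge> 0"
    "\<And>n p d. n \<ge> 2 \<Longrightarrow> 0 \<le> p \<Longrightarrow> p \<le> 1 \<Longrightarrow> d = p * (real n - 1) \<Longrightarrow>
      expect (vertex_pairs n) p (\<lambda>E. of_bool (crowded n (\<eta> * d) E)) \<le> K * real n * exp (- (2 - \<epsilon>) * d)"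
proof -
  define s where "s = max 1 (ln (8 / \<epsilon>))"
  have s: "s \<ge> 1" by (simp add: s_def)
  have es: "exp (- s) \<le> \<epsilon> / 8"
  proof -
    have "exp (- s) \<le> exp (- ln (8 / \<epsilon>))" by (simp add: s_def)
    then show ?thesis using \<epsilon> by (simp add: exp_minus)
  qed
  define \<eta> where "\<eta> = min (1/2) (\<epsilon> / (8 * s))"
  have \<eta>: "0 < \<eta>" "\<eta> \<le> 1/2" "\<eta> \<le> \<epsilon> / (8 * s)" using s \<epsilon> by (simp_all add: \<eta>_def)
  have s\<eta>: "s * \<eta> \<le> \<epsilon> / 8" using \<eta>(3) s by (simp add: field_simps)
  define K where "K = (4 / \<epsilon> + 32 / \<epsilon>\<^sup>2) * exp 4"
  show thesis
  proof (rule that[OF \<eta>(1,2)])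
    show "K \<ge> 0" using \<epsilon> by (simp add: K_def)
    fix n :: nat and p d :: real
    assume n: "n \<ge> 2" and p: "0 \<le> p" "p \<le> 1" and d: "d = p * (real n - 1)"
    have d0: "d \<ge> 0" using n p d by simp
    have np: "real n * p \<le> 2 * d"
    proof -
      have "p * real n \<le> p * (2 * (real n - 1))" using n p by (intro mult_left_mono) auto
      then show ?thesis by (simp add: d algebra_simps)
    qed
    have "real n ^ 2 * p + real n ^ 3 * p\<^sup>2 = real n * (real n * p + (real n * p)\<^sup>2)"
      by (simp add: power2_eq_square power3_eq_cube algebra_simps)
    also have "\<dots> \<le> real n * (2 * d + (2 * d)\<^sup>2)"
      using np p by (intro mult_left_mono add_mono power_mono) auto
    \<comment> \<open>Half of the allowance \<open>\<epsilon> * d\<close> in the exponent absorbs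
      the polynomial factor in \<open>d\<close>.\<close>
    also have "2 * d + (2 * d)\<^sup>2 \<le> (4 / \<epsilon> + 32 / \<epsilon>\<^sup>2) * exp (\<epsilon> / 2 * d)"
    proof -
      define x where "x = \<epsilon> / 2 * d"
      have x: "x \<ge> 0" using \<epsilon> d0 by (simp add: x_def)
      have "x ^ 1 \<le> fact 1 * exp x" "x ^ 2 \<le> fact 2 * exp x"
        using power_le_fact_exp[OF x] by blast+
      then have "4 / \<epsilon> * x \<le> 4 / \<epsilon> * exp x" "16 / \<epsilon>\<^sup>2 * x\<^sup>2 \<le> 16 / \<epsilon>\<^sup>2 * (2 * exp x)"
        using \<epsilon> by (auto intro!: divide_right_mono)
      moreover have "4 / \<epsilon> * x = 2 * d" "16 / \<epsilon>\<^sup>2 * x\<^sup>2 = (2 * d)\<^sup>2"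
        using \<epsilon> by (simp_all add: x_def power2_eq_square)
      ultimately have "2 * d + (2 * d)\<^sup>2 \<le> 4 / \<epsilon> * exp x + 16 / \<epsilon>\<^sup>2 * (2 * exp x)" by linarith
      also have "\<dots> = (4 / \<epsilon> + 32 / \<epsilon>\<^sup>2) * exp x" by (simp add: algebra_simps)
      finally show ?thesis by (simp add: x_def)
    qed
    finally have poly: "real n ^ 2 * p + real n ^ 3 * p\<^sup>2 \<le> real n * ((4 / \<epsilon> + 32 / \<epsilon>\<^sup>2) * exp (\<epsilon> / 2 * d))"
      by (simp add: mult_left_mono)
    \<comment> \<open>The other half pays for \<open>exp (- s)\<close> and for
      \<open>s * \<eta>\<close>, a quarter each; replacing \<open>n - 1\<close> by
      \<open>n - 3\<close> costs at most the constant \<open>4\<close>.\<close>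
    have expo: "2 * s * (\<eta> * d) - 2 * p * (1 - exp (- s)) * (real n - 3) \<le> 4 - 2 * d + \<epsilon> / 2 * d"
    proof -
      have "p * (real n - 3) = d - 2 * p" by (simp add: d algebra_simps)
      then have "2 * p * (1 - exp (- s)) * (real n - 3) = 2 * (1 - exp (- s)) * (d - 2 * p)"
        by (simp add: mult_ac)
      also have "\<dots> = 2 * d - 2 * exp (- s) * d - 4 * (1 - exp (- s)) * p" by (simp add: algebra_simps)
      finally have eq: "2 * p * (1 - exp (- s)) * (real n - 3) = \<dots>" .
      have "exp (- s) * d \<le> \<epsilon> / 8 * d" "s * \<eta> * d \<le> \<epsilon> / 8 * d"
        using mult_right_mono[OF es d0] mult_right_mono[OF s\<eta> d0] by simp_all
      moreover have "(1 - exp (- s)) * p \<le> 1 * 1" using s p by (intro mult_mono) auto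
      ultimately show ?thesis unfolding eq by (simp add: algebra_simps)
    qed
    have "expect (vertex_pairs n) p (\<lambda>E. of_bool (crowded n (\<eta> * d) E))
        \<le> (real n ^ 2 * p + real n ^ 3 * p\<^sup>2) * exp (2 * s * (\<eta> * d) - 2 * p * (1 - exp (- s)) * (real n - 3))"
      using s by (intro expect_crowded_le p) auto
    also have "\<dots> \<le> real n * ((4 / \<epsilon> + 32 / \<epsilon>\<^sup>2) * exp (\<epsilon> / 2 * d)) * exp (4 - 2 * d + \<epsilon> / 2 * d)"
      using poly expo \<epsilon> by (intro mult_mono) auto
    also have "\<dots> = K * real n * exp (- (2 - \<epsilon>) * d)"
    proof -
      have "exp (\<epsilon> / 2 * d) * exp (4 - 2 * d + \<epsilon> / 2 * d) = exp 4 * exp (- (2 - \<epsilon>) * d)"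
        unfolding exp_add[symmetric] by (simp add: algebra_simps)
      then show ?thesis by (simp add: K_def mult_ac)
    qed
    finally show "expect (vertex_pairs n) p (\<lambda>E. of_bool (crowded n (\<eta> * d) E)) \<le> K * real n * exp (- (2 - \<epsilon>) * d)" .
  qed
qed

section \<open>The quadratic form of the normalized adjacency matrix\<close>

definition adj :: "nat set set \<Rightarrow> nat \<Rightarrow> nat \<Rightarrow> real" where
  "adj E i j = of_bool ({i, j} \<in> E)"

abbreviation deg :: "nat \<Rightarrow> nat set set \<Rightarrow> nat \<Rightarrow> real" where
  "deg n E v \<equiv> real (degree_of {..<n} E v)"

lemma adj_commute: "adj E i j = adj E j i"
  by (simp add: adj_def insert_commute)

lemma deg_eq_sum_adj: "deg n E v = (\<Sum>j<n. adj E j v)"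
  by (simp add: degree_of_def adj_def sum_of_bool_eq Int_def)

lemma adj_diag: "E \<subseteq> vertex_pairs n \<Longrightarrow> adj E i i = 0"
  by (auto simp: adj_def vertex_pairs_def)

lemma bilin_adj_one: "bilin n (adj E) (\<lambda>_. 1) g = (\<Sum>i<n. deg n E i * g i)"
proof -
  have "bilin n (adj E) (\<lambda>_. 1) g = (\<Sum>j<n. \<Sum>i<n. adj E i j * g j)"
    unfolding bilin_def by (subst sum.swap) simp
  then show ?thesis by (simp add: deg_eq_sum_adj sum_distrib_right)
qed

text \<open>The adjacency matrix is the centred matrix plus \<open>p\<close> times the all-ones
  matrix minus \<open>p\<close> times the identity, as the diagonal was left at zero.\<close>

lemma bilin_adj:
  assumes "E \<subseteq> vertex_pairs n"
  shows "bilin n (adj E) u v =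
    bilin n (edge_mat (1 - p) (- p) E) u v + p * (\<Sum>i<n. u i) * (\<Sum>i<n. v i) - p * dotp n u v"
proof -
  have "adj E i j * u i * v j = edge_mat (1 - p) (- p) E i j * u i * v j + p * (u i * v j)
      - (if i = j then p * (u i * v j) else 0)" for i j
    using adj_diag[OF assms, of i] by (auto simp: edge_mat_def adj_def algebra_simps)
  then have "bilin n (adj E) u v = bilin n (edge_mat (1 - p) (- p) E) u v
      + (\<Sum>i<n. \<Sum>j<n. p * (u i * v j)) - (\<Sum>i<n. \<Sum>j<n. if i = j then p * (u i * v j) else 0)"
    unfolding bilin_def by (simp add: sum.distrib sum_subtractf)
  moreover have "(\<Sum>i<n. \<Sum>j<n. p * (u i * v j)) = p * ((\<Sum>i<n. u i) * (\<Sum>i<n. v i))"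
    by (simp only: sum_product) (simp only: sum_distrib_left)
  moreover have "(\<Sum>i<n. \<Sum>j<n. if i = j then p * (u i * v j) else 0) = p * dotp n u v"
    by (simp add: dotp_def sum_distrib_left)
  ultimately show ?thesis by (simp only: mult.assoc)
qed

lemma bilin_commute:
  assumes "\<And>i j. X i j = X j i"
  shows "bilin N X u v = bilin N X v u"
  using assms dotp_commute[of N u "matvec N X v"] by (simp add: bilin_eq_dotp dotp_matvec)

lemma bilin_add_left: "bilin N X (\<lambda>i. u i + w i) v = bilin N X u v + bilin N X w v"
  by (simp add: bilin_def algebra_simps sum.distrib)

lemma bilin_add_right: "bilin N X u (\<lambda>i. v i + w i) = bilin N X u v + bilin N X u w"
  by (simp add: bilin_def algebra_simps sum.distrib)

lemma abs_bilin_le: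
  assumes "sqn N (matvec N X v) \<le> T * sqn N v" "T \<ge> 0"
  shows "\<bar>bilin N X u v\<bar> \<le> sqrt T * sqrt (sqn N u) * sqrt (sqn N v)"
proof -
  have "\<bar>bilin N X u v\<bar> \<le> sqrt (sqn N u) * sqrt (sqn N (matvec N X v))"
    unfolding bilin_eq_dotp by (rule abs_dotp_le)
  also have "\<dots> \<le> sqrt (sqn N u) * sqrt (T * sqn N v)"
    using assms by (intro mult_left_mono) auto
  finally show ?thesis by (simp add: real_sqrt_mult mult_ac)
qed

lemma sum_squared_eq_of_at_most_one:
  fixes x :: "nat \<Rightarrow> real"
  assumes "\<And>i j. i < n \<Longrightarrow> j < n \<Longrightarrow> i \<noteq> j \<Longrightarrow> x i = 0 \<or> x j = 0"
  shows "(\<Sum>i<n. x i)\<^sup>2 = (\<Sum>i<n. (x i)\<^sup>2)"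
proof -
  have "(\<Sum>i<n. x i)\<^sup>2 = (\<Sum>i<n. \<Sum>j<n. x i * x j)"
    by (simp add: power2_eq_square sum_product)
  also have "\<dots> = (\<Sum>i<n. \<Sum>j<n. if i = j then x i * x j else 0)"
    by (intro sum.cong refl) (use assms in force)
  finally show ?thesis by (simp add: power2_eq_square)
qed

lemma not_crowded_independent:
  assumes "\<not> crowded n D E" "E \<subseteq> vertex_pairs n" "i \<in> low_degree n D E" "j \<in> low_degree n D E"
  shows "adj E i j = 0"
  using assms adj_diag[OF assms(2), of i] unfolding crowded_def adj_def by (cases "i = j") auto

lemma not_crowded_common_neighbour:
  assumes "\<not> crowded n D E" "E \<subseteq> vertex_pairs n" "i \<in> low_degree n D E" "j \<in> low_degree n D E"
    and "i \<noteq> j" "w < n"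
  shows "adj E w i = 0 \<or> adj E w j = 0"
proof (rule ccontr)
  assume "\<not> ?thesis"
  then have "{i, w} \<in> E" "{j, w} \<in> E" by (auto simp: adj_def insert_commute)
  moreover have "w \<noteq> i" "w \<noteq> j"
    using calculation assms(2) by (auto simp: vertex_pairs_def)
  ultimately show False using assms(1,3-6) unfolding crowded_def by blast
qed

text \<open>Every vertex has at most one neighbour of low degree, so squaring the neighbour sum
  produces no mixed products. Summing over all vertices then cancels the weights
  \<open>1 / deg\<close> on the low side, and the degree bound on the high side gives
  \<open>1 / D\<close>.\<close>

lemma cross_term_le:
  assumes E: "E \<subseteq> vertex_pairs n" and nc: "\<not> crowded n D E" and D: "D > 0"
    and f1: "\<And>i. i \<in> low_degree n D E \<Longrightarrow> f1 i = 0"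
    and f2: "\<And>i. i < n \<Longrightarrow> i \<notin> low_degree n D E \<Longrightarrow> f2 i = 0"
  shows "\<bar>bilin n (adj E) (\<lambda>i. f1 i / sqrt (deg n E i)) (\<lambda>i. f2 i / sqrt (deg n E i))\<bar>
    \<le> sqrt (sqn n f1) * sqrt (sqn n f2 / D)"
proof -
  let ?S = "low_degree n D E"
  let ?h = "\<lambda>i. f2 i / sqrt (deg n E i)"
  define q where "q i = (if i \<in> ?S then 0 else matvec n (adj E) ?h i / sqrt (deg n E i))" for i
  have "bilin n (adj E) (\<lambda>i. f1 i / sqrt (deg n E i)) ?h = dotp n f1 q"
    unfolding bilin_eq_dotp unfolding dotp_def by (intro sum.cong) (auto simp: q_def f1)
  then have "\<bar>bilin n (adj E) (\<lambda>i. f1 i / sqrt (deg n E i)) ?h\<bar> \<le> sqrt (sqn n f1) * sqrt (sqn n q)"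
    using abs_dotp_le[of n f1 q] by simp
  also have "sqn n q \<le> sqn n f2 / D"
  proof -
    have "sqn n q \<le> (\<Sum>i<n. (\<Sum>j<n. adj E i j * (?h j)\<^sup>2) / D)"
      unfolding sqn_def
    proof (intro sum_mono)
      fix i assume i: "i \<in> {..<n}"
      have nn: "(\<Sum>j<n. adj E i j * (?h j)\<^sup>2) \<ge> 0" by (simp add: sum_nonneg adj_def)
      show "(q i)\<^sup>2 \<le> (\<Sum>j<n. adj E i j * (?h j)\<^sup>2) / D"
      proof (cases "i \<in> ?S")
        case True
        then show ?thesis using nn D by (simp add: q_def)
      next
        case False
        then have dD: "deg n E i \<ge> D" using i by (auto simp: low_degree_def)
        have "(matvec n (adj E) ?h i)\<^sup>2 = (\<Sum>j<n. (adj E i j * ?h j)\<^sup>2)"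
          unfolding matvec_def
        proof (rule sum_squared_eq_of_at_most_one)
          fix j k assume "j < n" "k < n" "j \<noteq> k"
          then show "adj E i j * ?h j = 0 \<or> adj E i k * ?h k = 0"
            using not_crowded_common_neighbour[OF nc E, of j k i] f2[of j] f2[of k] i
            by (cases "j \<in> ?S"; cases "k \<in> ?S") auto
        qed
        also have "\<dots> = (\<Sum>j<n. adj E i j * (?h j)\<^sup>2)"
          by (intro sum.cong) (auto simp: adj_def)
        finally have "(q i)\<^sup>2 = (\<Sum>j<n. adj E i j * (?h j)\<^sup>2) / deg n E i"
          using False by (simp add: q_def power_divide)
        also have "\<dots> \<le> (\<Sum>j<n. adj E i j * (?h j)\<^sup>2) / D"
          using nn D dD by (intro divide_left_mono) auto
        finally show ?thesis .
      qed
    qed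
    also have "\<dots> = (\<Sum>j<n. \<Sum>i<n. adj E i j * (?h j)\<^sup>2) / D"
      unfolding sum_divide_distrib[symmetric] by (subst sum.swap) simp
    also have "\<dots> = (\<Sum>j<n. deg n E j * (?h j)\<^sup>2) / D"
      by (simp add: deg_eq_sum_adj sum_distrib_right)
    \<comment> \<open>Only an inequality: at a vertex of degree \<open>0\<close> the quotient is
      \<open>0\<close> by convention and the term disappears.\<close>
    also have "\<dots> \<le> sqn n f2 / D"
      using D unfolding sqn_def
      by (intro divide_right_mono sum_mono) (auto simp: power_divide)
    finally show ?thesis .
  qed
  then have "sqrt (sqn n f1) * sqrt (sqn n q) \<le> sqrt (sqn n f1) * sqrt (sqn n f2 / D)"
    by (intro mult_left_mono) auto
  finally show ?thesis .
qed

text \<open>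
  Testing the centred matrix on the indicator of the low-degree set bounds its size, and
  testing it on the constant vector controls the mean of a vector orthogonal to the degrees;
  hence a norm bound for the centred matrix suffices.
\<close>

lemma card_low_degree_le:
  assumes E: "E \<subseteq> vertex_pairs n" and p: "d = p * (real n - 1)" "d > 0" and \<eta>: "0 < \<eta>" "\<eta> \<le> 1/2"
    and T: "\<And>v. sqn n (matvec n (edge_mat (1 - p) (- p) E) v) \<le> c * d * sqn n v" "c \<ge> 0"
  shows "real (card (low_degree n (\<eta> * d) E)) * d \<le> 4 * c * real n"
proof -
  let ?S = "low_degree n (\<eta> * d) E"
  define s where "s = real (card ?S)"
  let ?u = "\<lambda>i. of_bool (i \<in> ?S) :: real"
  have sub: "{..<n} \<inter> ?S = ?S" by (auto simp: low_degree_def)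
  have su: "(\<Sum>i<n. ?u i) = s" by (simp add: s_def sub)
  have "sqn n ?u = (\<Sum>i<n. ?u i)" unfolding sqn_def by (intro sum.cong) auto
  then have sqn_u: "sqn n ?u = s" using su by simp
  \<comment> \<open>The degree sum over the low set would be \<open>d * s\<close> without the
    centred part but is at most half of that, so the centred part has to supply the
    difference.\<close>
  have "(\<Sum>i<n. deg n E i * ?u i) = bilin n (edge_mat (1 - p) (- p) E) (\<lambda>_. 1) ?u + d * s"
    unfolding bilin_adj_one[symmetric] bilin_adj[OF E, of _ _ p] su
    using su by (simp add: dotp_def p algebra_simps)
  moreover have "(\<Sum>i<n. deg n E i * ?u i) \<le> (\<Sum>i<n. \<eta> * d * ?u i)"
    by (intro sum_mono) (auto simp: low_degree_def)
  moreover have "(\<Sum>i<n. \<eta> * d * ?u i) = \<eta> * d * s" by (simp only: su flip: sum_distrib_left)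
  moreover have "\<bar>bilin n (edge_mat (1 - p) (- p) E) (\<lambda>_. 1) ?u\<bar> \<le> sqrt (c * d) * sqrt (real n) * sqrt s"
  proof -
    have "\<bar>bilin n (edge_mat (1 - p) (- p) E) (\<lambda>_. 1) ?u\<bar> \<le> sqrt (c * d) * sqrt (sqn n (\<lambda>_. 1)) * sqrt (sqn n ?u)"
      using T p(2) by (intro abs_bilin_le) auto
    then show ?thesis unfolding sqn_u by (simp add: sqn_def)
  qed
  moreover have "\<eta> * d * s \<le> 1/2 * (d * s)"
    using mult_right_mono[OF \<eta>(2), of "d * s"] p by (simp add: s_def)
  ultimately have le: "1/2 * (d * s) \<le> sqrt (c * d) * sqrt (real n) * sqrt s" by linarith
  have s0: "s \<ge> 0" by (simp add: s_def)
  have "(1/2 * (d * s))\<^sup>2 \<le> (sqrt (c * d) * sqrt (real n) * sqrt s)\<^sup>2"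
    using le p s0 by (intro power_mono) auto
  also have "\<dots> = c * d * real n * s" using T(2) p s0 by (simp add: power_mult_distrib)
  finally have "(d * s) * (s * d) \<le> (d * s) * (4 * c * real n)"
    by (simp add: power2_eq_square algebra_simps)
  then show ?thesis
    using p s0 T(2) unfolding s_def[symmetric]
    by (cases "s = 0") (auto simp: mult_le_cancel_left_pos)
qed

text \<open>On the high part, dividing by square roots of degrees gains a factor
  \<open>1 / (\<eta> * d)\<close>. The cross term and the centred term are of order
  \<open>1 / sqrt d\<close>; the mean and diagonal terms are of order \<open>1 / d\<close>, which
  \<open>d \<ge> 1\<close> makes comparable.\<close>

lemma laplacian_form_le:
  assumes E: "E \<subseteq> vertex_pairs n" and n: "n \<ge> 2" and p: "0 \<le> p" "d = p * (real n - 1)" "d \<ge> 1" "p \<le> 1"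
    and \<eta>: "0 < \<eta>" "\<eta> \<le> 1/2" and nc: "\<not> crowded n (\<eta> * d) E"
    and T: "\<And>v. sqn n (matvec n (edge_mat (1 - p) (- p) E) v) \<le> c * d * sqn n v" "c \<ge> 0"
    and f: "(\<Sum>i<n. sqrt (deg n E i) * f i) = 0"
  defines "h \<equiv> \<lambda>i. f i / sqrt (deg n E i)"
  shows "\<bar>bilin n (adj E) h h\<bar>
    \<le> (2 / sqrt \<eta> + sqrt c / \<eta> + 1 / \<eta> + 16 * c * \<eta> + 4 * c / \<eta>) / sqrt d * sqn n f"
proof -
  let ?S = "low_degree n (\<eta> * d) E" and ?X = "edge_mat (1 - p) (- p) E"
  define f1 f2 where "f1 i = (if i \<in> ?S then 0 else f i)" and "f2 i = (if i \<in> ?S then f i else 0)" for i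
  define g where "g i = f1 i / sqrt (deg n E i)" for i
  define g2 where "g2 i = f2 i / sqrt (deg n E i)" for i
  define F where "F = sqn n f"
  have F0: "F \<ge> 0" by (simp add: F_def)
  have d0: "d > 0" using p by simp
  have D0: "\<eta> * d > 0" using \<eta> d0 by simp
  have f1F: "sqn n f1 \<le> F" and f2F: "sqn n f2 \<le> F"
    unfolding F_def sqn_def by (auto intro!: sum_mono simp: f1_def f2_def)
  have gF: "sqn n g \<le> F / (\<eta> * d)"
  proof -
    have "sqn n g \<le> (\<Sum>i<n. (f1 i)\<^sup>2 / (\<eta> * d))"
      unfolding sqn_def
    proof (intro sum_mono)
      fix i assume "i \<in> {..<n}"
      then show "(g i)\<^sup>2 \<le> (f1 i)\<^sup>2 / (\<eta> * d)"
        using D0 by (auto simp: g_def f1_def low_degree_def power_divide intro!: divide_left_mono)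
    qed
    also have "\<dots> = sqn n f1 / (\<eta> * d)" by (simp add: sqn_def sum_divide_distrib)
    also have "\<dots> \<le> F / (\<eta> * d)" using f1F D0 by (intro divide_right_mono) auto
    finally show ?thesis .
  qed
  have h: "h = (\<lambda>i. g i + g2 i)" by (auto simp: h_def g_def g2_def f1_def f2_def)
  have split: "bilin n (adj E) h h = bilin n (adj E) g g + 2 * bilin n (adj E) g g2 + bilin n (adj E) g2 g2"
    unfolding h bilin_add_left bilin_add_right
    using bilin_commute[of "adj E" n g2 g] by (simp add: adj_commute)
  have "bilin n (adj E) g2 g2 = 0"
    unfolding bilin_def
    using not_crowded_independent[OF nc E] by (auto intro!: sum.neutral simp: g2_def f2_def)
  moreover have "\<bar>bilin n (adj E) g g2\<bar> \<le> F / sqrt (\<eta> * d)"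
  proof -
    have "\<bar>bilin n (adj E) g g2\<bar> \<le> sqrt (sqn n f1) * sqrt (sqn n f2 / (\<eta> * d))"
      unfolding g_def g2_def
      by (rule cross_term_le[OF E nc D0]) (auto simp: f1_def f2_def)
    also have "\<dots> \<le> sqrt F * sqrt (F / (\<eta> * d))"
      using f1F f2F D0 F0 by (intro mult_mono real_sqrt_le_mono divide_right_mono) auto
    also have "\<dots> = F / sqrt (\<eta> * d)" using F0 by (simp add: real_sqrt_divide)
    finally show ?thesis .
  qed
  moreover have "\<bar>bilin n ?X g g\<bar> \<le> sqrt (c * d) * (F / (\<eta> * d))"
  proof -
    have "\<bar>bilin n ?X g g\<bar> \<le> sqrt (c * d) * sqrt (sqn n g) * sqrt (sqn n g)"
      using T d0 by (intro abs_bilin_le) auto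
    also have "\<dots> = sqrt (c * d) * sqn n g" by simp
    also have "\<dots> \<le> sqrt (c * d) * (F / (\<eta> * d))" using gF T(2) d0 by (intro mult_left_mono) auto
    finally show ?thesis .
  qed
  moreover have "0 \<le> p * dotp n g g" "p * dotp n g g \<le> F / (\<eta> * d)"
  proof -
    show "p * dotp n g g \<le> F / (\<eta> * d)"
      using mult_mono[of p 1 "sqn n g" "F / (\<eta> * d)"] gF p by (simp flip: sqn_eq_dotp)
    show "0 \<le> p * dotp n g g" using p by (simp flip: sqn_eq_dotp)
  qed
  moreover have "0 \<le> p * (\<Sum>i<n. g i) * (\<Sum>i<n. g i)"
      "p * (\<Sum>i<n. g i) * (\<Sum>i<n. g i) \<le> (16 * c * \<eta> + 4 * c / \<eta>) / d * F"
  proof -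
    let ?m = "\<Sum>i<n. g i" and ?b = "bilin n ?X (\<lambda>_. 1) g" and ?r = "\<Sum>i<n. sqrt (deg n E i) * f2 i"
    have "(\<Sum>i<n. deg n E i * g i) = ?b + d * ?m"
      unfolding bilin_adj_one[symmetric] bilin_adj[OF E, of _ _ p]
      by (simp add: dotp_def p algebra_simps)
    moreover have "(\<Sum>i<n. deg n E i * g i) = (\<Sum>i<n. sqrt (deg n E i) * f1 i)"
    proof (intro sum.cong refl)
      fix i
      have "deg n E i = sqrt (deg n E i) * sqrt (deg n E i)" by simp
      then show "deg n E i * g i = sqrt (deg n E i) * f1 i"
        by (cases "deg n E i = 0") (auto simp: g_def field_simps)
    qed
    moreover have "(\<Sum>i<n. sqrt (deg n E i) * f1 i) + ?r = (\<Sum>i<n. sqrt (deg n E i) * f i)"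
      unfolding sum.distrib[symmetric] by (intro sum.cong) (auto simp: f1_def f2_def)
    \<comment> \<open>Orthogonality to \<open>sqrt deg\<close> trades the degree-weighted sum over
      the high part for minus the sum \<open>?r\<close> over the few low vertices.\<close>
    ultimately have dm: "d * ?m = - (?r + ?b)" using f by linarith
    have r2: "?r\<^sup>2 \<le> real (card ?S) * (\<eta> * d) * F"
    proof -
      have sub: "?S \<subseteq> {..<n}" by (auto simp: low_degree_def)
      have "?r\<^sup>2 = (dotp n (\<lambda>i. if i \<in> ?S then sqrt (deg n E i) else 0) f)\<^sup>2"
        unfolding dotp_def by (intro arg_cong[of _ _ "\<lambda>x. x\<^sup>2"] sum.cong) (auto simp: f2_def)
      also have "\<dots> \<le> sqn n (\<lambda>i. if i \<in> ?S then sqrt (deg n E i) else 0) * F"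
        unfolding F_def by (rule dotp_squared_le)
      also have "sqn n (\<lambda>i. if i \<in> ?S then sqrt (deg n E i) else 0) \<le> (\<Sum>i<n. if i \<in> ?S then \<eta> * d else 0)"
        unfolding sqn_def by (intro sum_mono) (auto simp: low_degree_def)
      also have "\<dots> = real (card ?S) * (\<eta> * d)"
        using sub by (simp add: sum.If_cases Int_absorb1)
      finally show ?thesis using F0 by (simp add: mult_right_mono)
    qed
    have b2: "?b\<^sup>2 \<le> c * d * real n * (F / (\<eta> * d))"
    proof -
      have "\<bar>?b\<bar> \<le> sqrt (c * d) * sqrt (sqn n (\<lambda>_. 1)) * sqrt (sqn n g)"
        using T d0 by (intro abs_bilin_le) auto
      then have "\<bar>?b\<bar>\<^sup>2 \<le> (sqrt (c * d) * sqrt (sqn n (\<lambda>_. 1)) * sqrt (sqn n g))\<^sup>2"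
        by (intro power_mono) auto
      also have "\<dots> = c * d * real n * sqn n g" using T(2) d0 by (simp add: power_mult_distrib) (simp add: sqn_def)
      also have "\<dots> \<le> c * d * real n * (F / (\<eta> * d))" using gF T(2) d0 by (intro mult_left_mono) auto
      finally show ?thesis by simp
    qed
    have np: "real n * p \<le> 2 * d"
    proof -
      have "p * real n \<le> p * (2 * (real n - 1))" using n p by (intro mult_left_mono) auto
      then show ?thesis by (simp add: p(2) algebra_simps)
    qed
    have "(d * ?m)\<^sup>2 \<le> 2 * ?r\<^sup>2 + 2 * ?b\<^sup>2"
      unfolding dm power2_minus using sum_squares_bound[of ?r ?b] by (simp add: power2_sum)
    also have "\<dots> \<le> 2 * (real (card ?S) * (\<eta> * d) * F) + 2 * (c * d * real n * (F / (\<eta> * d)))"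
      using r2 b2 by linarith
    also have "\<dots> = (real (card ?S) * d) * (2 * \<eta> * F) + 2 * c * real n * F / \<eta>"
      using d0 \<eta> by (simp add: field_simps)
    also have "\<dots> \<le> (4 * c * real n) * (2 * \<eta> * F) + 2 * c * real n * F / \<eta>"
      using card_low_degree_le[OF E p(2) d0 \<eta> T] F0 \<eta> by (intro add_right_mono mult_right_mono) auto
    also have "\<dots> = real n * ((8 * c * \<eta> + 2 * c / \<eta>) * F)" using \<eta> by (simp add: field_simps)
    \<comment> \<open>The factor \<open>p\<close> absorbs the dimension through
      \<open>n * p \<le> 2 * d\<close>.\<close>
    finally have "p * (d * ?m)\<^sup>2 \<le> p * (real n * ((8 * c * \<eta> + 2 * c / \<eta>) * F))"
      using p by (intro mult_left_mono) auto
    also have "\<dots> = (real n * p) * ((8 * c * \<eta> + 2 * c / \<eta>) * F)" by simp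
    also have "\<dots> \<le> (2 * d) * ((8 * c * \<eta> + 2 * c / \<eta>) * F)"
      using np F0 T(2) \<eta> by (intro mult_right_mono) auto
    finally have le: "p * (d * ?m)\<^sup>2 \<le> (2 * d) * ((8 * c * \<eta> + 2 * c / \<eta>) * F)" .
    have "p * (d * ?m)\<^sup>2 = d\<^sup>2 * (p * ?m * ?m)" by (simp add: power2_eq_square mult_ac)
    moreover have "(2 * d) * ((8 * c * \<eta> + 2 * c / \<eta>) * F) = d\<^sup>2 * ((16 * c * \<eta> + 4 * c / \<eta>) / d * F)"
    proof -
      have "16 * c * \<eta> + 4 * c / \<eta> = 2 * (8 * c * \<eta> + 2 * c / \<eta>)" by simp
      then show ?thesis using d0 by (simp only:) (simp add: power2_eq_square)
    qed
    ultimately have "d\<^sup>2 * (p * ?m * ?m) \<le> d\<^sup>2 * ((16 * c * \<eta> + 4 * c / \<eta>) / d * F)"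
      using le by (simp only:)
    then show "p * ?m * ?m \<le> (16 * c * \<eta> + 4 * c / \<eta>) / d * F"
      using d0 by (subst (asm) mult_le_cancel_left_pos) auto
    show "0 \<le> p * ?m * ?m" using p by (simp add: mult.assoc)
  qed
  ultimately have "\<bar>bilin n (adj E) h h\<bar> \<le> 2 * (F / sqrt (\<eta> * d)) + sqrt (c * d) * (F / (\<eta> * d))
      + F / (\<eta> * d) + (16 * c * \<eta> + 4 * c / \<eta>) / d * F"
    unfolding split bilin_adj[OF E, of g g p] by linarith
  also have "\<dots> \<le> (2 / sqrt \<eta> + sqrt c / \<eta> + 1 / \<eta> + 16 * c * \<eta> + 4 * c / \<eta>) / sqrt d * F"
  proof -
    have inv: "1 / d \<le> 1 / sqrt d"
      using p(3) by (intro divide_left_mono real_le_lsqrt) (auto simp: power2_eq_square)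
    have "sqrt d / d = 1 / sqrt d" using d0 by (simp add: field_simps)
    moreover have "sqrt (c * d) * (F / (\<eta> * d)) = sqrt c / \<eta> * F * (sqrt d / d)"
      by (simp add: real_sqrt_mult)
    ultimately have 1: "sqrt (c * d) * (F / (\<eta> * d)) = sqrt c / \<eta> * F * (1 / sqrt d)" by simp
    have 2: "2 * (F / sqrt (\<eta> * d)) = 2 / sqrt \<eta> * F * (1 / sqrt d)"
      by (simp add: real_sqrt_mult)
    have 3: "F / (\<eta> * d) \<le> 1 / \<eta> * F * (1 / sqrt d)"
      using mult_left_mono[OF inv, of "1 / \<eta> * F"] F0 \<eta> by simp
    have 4: "(16 * c * \<eta> + 4 * c / \<eta>) / d * F \<le> (16 * c * \<eta> + 4 * c / \<eta>) * F * (1 / sqrt d)"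
      using mult_left_mono[OF inv, of "(16 * c * \<eta> + 4 * c / \<eta>) * F"] F0 \<eta> T(2) by simp
    have "2 * (F / sqrt (\<eta> * d)) + sqrt (c * d) * (F / (\<eta> * d))
      + F / (\<eta> * d) + (16 * c * \<eta> + 4 * c / \<eta>) / d * F \<le>
      2 / sqrt \<eta> * F * (1 / sqrt d) + sqrt c / \<eta> * F * (1 / sqrt d) + 1 / \<eta> * F * (1 / sqrt d)
      + (16 * c * \<eta> + 4 * c / \<eta>) * F * (1 / sqrt d)"
      using 1 2 3 4 by linarith
    also have "\<dots> = (2 / sqrt \<eta> + sqrt c / \<eta> + 1 / \<eta> + 16 * c * \<eta> + 4 * c / \<eta>) / sqrt d * F"
      by (simp add: algebra_simps add_divide_distrib)
    finally show ?thesis .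
  qed
  finally show ?thesis by (simp only: F_def)
qed

section \<open>Eigenvalues of real symmetric matrices\<close>

lemma mult_mat_vec_index:
  assumes "A \<in> carrier_mat n m" "v \<in> carrier_vec m" "i < n"
  shows "vec_index (A *\<^sub>v v) i = (\<Sum>j<m. A $$ (i, j) * vec_index v j)"
  using assms by (auto simp: scalar_prod_def atLeast0LessThan intro!: sum.cong)

text \<open>The Hermitian form \<open>q\<close> at an eigenvector equals its own conjugate and is
  \<open>a\<close> times a nonzero real number.\<close>

lemma real_symmetric_eigenvalue_real:
  fixes L :: "real mat" and a :: complex
  assumes L: "L \<in> carrier_mat n n" and sym: "\<And>i j. i < n \<Longrightarrow> j < n \<Longrightarrow> L $$ (i, j) = L $$ (j, i)"
    and ev: "eigenvalue (map_mat complex_of_real L) a"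
  shows "a \<in> \<real>"
proof -
  let ?A = "map_mat complex_of_real L"
  have A: "?A \<in> carrier_mat n n" using L by simp
  obtain v where v: "v \<in> carrier_vec n" "v \<noteq> 0\<^sub>v n" "?A *\<^sub>v v = a \<cdot>\<^sub>v v"
    using ev A unfolding eigenvalue_def eigenvector_def by auto
  define q where "q = (\<Sum>i<n. \<Sum>j<n. complex_of_real (L $$ (i, j)) * vec_index v j * cnj (vec_index v i))"
  have Av: "(\<Sum>j<n. complex_of_real (L $$ (i, j)) * vec_index v j) = a * vec_index v i" if "i < n" for i
  proof -
    have "(\<Sum>j<n. complex_of_real (L $$ (i, j)) * vec_index v j) = (\<Sum>j<n. ?A $$ (i, j) * vec_index v j)"
      using L that by (intro sum.cong) auto
    also have "\<dots> = vec_index (a \<cdot>\<^sub>v v) i" unfolding v(3)[symmetric] by (rule mult_mat_vec_index[OF A v(1) that, symmetric])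
    finally show ?thesis using v(1) that by simp
  qed
  have "q = (\<Sum>i<n. a * vec_index v i * cnj (vec_index v i))"
    unfolding q_def sum_distrib_right[symmetric] by (intro sum.cong refl) (simp add: Av)
  also have "\<dots> = a * complex_of_real (\<Sum>i<n. (cmod (vec_index v i))\<^sup>2)"
    by (simp only: of_real_sum complex_norm_square sum_distrib_left mult.assoc)
  finally have q: "q = a * complex_of_real (\<Sum>i<n. (cmod (vec_index v i))\<^sup>2)" .
  have "cnj q = (\<Sum>i<n. \<Sum>j<n. complex_of_real (L $$ (i, j)) * cnj (vec_index v j) * vec_index v i)"
    by (simp add: q_def)
  also have "\<dots> = (\<Sum>j<n. \<Sum>i<n. complex_of_real (L $$ (i, j)) * cnj (vec_index v j) * vec_index v i)"
    by (rule sum.swap)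
  also have "\<dots> = q"
    unfolding q_def by (intro sum.cong refl) (simp add: sym mult_ac)
  finally have "cnj q = q" .
  then have "q \<in> \<real>" by (simp add: Reals_cnj_iff)
  moreover have "(\<Sum>i<n. (cmod (vec_index v i))\<^sup>2) \<noteq> 0"
  proof
    assume "(\<Sum>i<n. (cmod (vec_index v i))\<^sup>2) = 0"
    then have "\<And>i. i < n \<Longrightarrow> vec_index v i = 0" by (subst (asm) sum_nonneg_eq_0_iff) auto
    then have "v = 0\<^sub>v n" using v(1) by (intro eq_vecI) auto
    then show False using v(2) by blast
  qed
  ultimately have "q / complex_of_real (\<Sum>i<n. (cmod (vec_index v i))\<^sup>2) = a"
    unfolding q by (intro nonzero_mult_div_cancel_right) (simp only: of_real_eq_0_iff not_False_eq_True)
  then show ?thesis using \<open>q \<in> \<real>\<close> by (metis Reals_divide Reals_of_real)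
qed

lemma real_symmetric_char_poly_splits:
  fixes L :: "real mat"
  assumes L: "L \<in> carrier_mat n n" and sym: "\<And>i j. i < n \<Longrightarrow> j < n \<Longrightarrow> L $$ (i, j) = L $$ (j, i)"
  shows "\<exists>es. char_poly L = (\<Prod>a\<leftarrow>es. [:- a, 1:]) \<and> length es = n"
proof -
  let ?A = "map_mat complex_of_real L"
  have A: "?A \<in> carrier_mat n n" using L by simp
  obtain as where as: "char_poly ?A = (\<Prod>a\<leftarrow>as. [:- a, 1:])" "length as = n"
    using char_poly_factorized[OF A] by blast
  have "a \<in> \<real>" if "a \<in> set as" for a
  proof -
    have "poly (char_poly ?A) a = 0" unfolding as(1) using that by (auto simp: poly_prod_list prod_list_zero_iff)
    then have "eigenvalue ?A a" using eigenvalue_root_char_poly[OF A] by simp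
    then show ?thesis using real_symmetric_eigenvalue_real[of L n a] L sym by blast
  qed
  then have as_Re: "map (complex_of_real \<circ> Re) as = as" by (auto intro!: map_idI simp: of_real_Re)
  have "map_poly complex_of_real (char_poly L) = char_poly ?A"
    by (rule of_real_hom.char_poly_hom[OF L, symmetric])
  also have "\<dots> = (\<Prod>a\<leftarrow>map (complex_of_real \<circ> Re) as. [:- a, 1:])" by (simp only: as_Re as(1))
  also have "\<dots> = map_poly complex_of_real (\<Prod>a\<leftarrow>map Re as. [:- a, 1:])"
  proof -
    have mp: "map_poly complex_of_real (p * q) = map_poly complex_of_real p * map_poly complex_of_real q" for p q
      by (intro poly_eqI) (simp add: coeff_map_poly coeff_mult)
    show ?thesis by (induction as) (simp_all add: mp map_poly_pCons del: mult_pCons_left mult_pCons_right)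
  qed
  finally have "char_poly L = (\<Prod>a\<leftarrow>map Re as. [:- a, 1:])"
    by (simp add: poly_eq_iff coeff_map_poly)
  then show ?thesis using as(2) by (intro exI[of _ "map Re as"]) simp
qed

lemma proots_linear_factors: "proots (\<Prod>a\<leftarrow>es. [:- a, 1:]) = mset (es :: real list)"
proof (induction es)
  case (Cons a es)
  have "(\<Prod>a\<leftarrow>es. [:- a, 1:]) \<noteq> 0" by (auto simp: prod_list_zero_iff)
  then show ?case using Cons by (simp add: proots_mult del: mult_pCons_left)
qed simp

text \<open>For the eigenvalue \<open>0\<close>, passes from algebraic to geometric multiplicity. A
  Schur form with two leading zeros gives independent vectors with \<open>L x = 0\<close> and
  \<open>L y = b x\<close>; by symmetry the squared norm of \<open>b x\<close> is \<open>b\<close>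
  times the pairing of \<open>L x\<close> with \<open>y\<close>, hence zero.\<close>

lemma symmetric_double_kernel:
  fixes L :: "real mat"
  assumes L: "L \<in> carrier_mat n n" and sym: "\<And>i j. i < n \<Longrightarrow> j < n \<Longrightarrow> L $$ (i, j) = L $$ (j, i)"
    and cp: "char_poly L = (\<Prod>a\<leftarrow>es. [:- a, 1:])" and n: "n \<ge> 2" and es: "es ! 0 = 0" "es ! 1 = 0"
  shows "\<exists>x y :: nat \<Rightarrow> real. (\<forall>i<n. (\<Sum>j<n. L $$ (i, j) * x j) = 0) \<and>
    (\<forall>i<n. (\<Sum>j<n. L $$ (i, j) * y j) = 0) \<and>
    (\<forall>\<alpha> \<beta>. (\<forall>i<n. \<alpha> * x i + \<beta> * y i = 0) \<longrightarrow> \<alpha> = 0 \<and> \<beta> = 0)"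
proof -
  obtain B P Q where schur: "schur_decomposition L es = (B, P, Q)"
    by (cases "schur_decomposition L es") auto
  have wit: "similar_mat_wit L B P Q" and ut: "upper_triangular B" and diag: "diag_mat B = es"
    using schur_decomposition[OF L cp schur] by auto
  note w = similar_mat_witD2[OF L wit]
  have B: "B \<in> carrier_mat n n" and P: "P \<in> carrier_mat n n" and Q: "Q \<in> carrier_mat n n" using w by auto
  have "L * P = P * B * (Q * P)"
    unfolding w(3) using B P Q by (simp add: assoc_mult_mat[of _ n n _ n _ n])
  then have LP: "L * P = P * B" using B P w(2) by simp
  have mi: "(X * Y) $$ (i, k) = (\<Sum>j<n. X $$ (i, j) * Y $$ (j, k))"
    if "X \<in> carrier_mat n n" "Y \<in> carrier_mat n n" "i < n" "k < n" for X Y :: "real mat" and i k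
    using that by (auto simp: scalar_prod_def atLeast0LessThan intro!: sum.cong)
  have diag0: "B $$ (0, 0) = 0" "B $$ (1, 1) = 0"
    using diag es n B by (auto simp: diag_mat_def)
  have low: "B $$ (i, j) = 0" if "j < i" "i < n" for i j
    using ut that B by (auto simp: upper_triangular_def)
  define x y where "x j = P $$ (j, 0)" and "y j = P $$ (j, 1)" for j
  have Lx: "(\<Sum>j<n. L $$ (i, j) * x j) = 0" if i: "i < n" for i
  proof -
    have "(\<Sum>j<n. L $$ (i, j) * x j) = (P * B) $$ (i, 0)"
      unfolding LP[symmetric] using mi[OF L P i, of 0] n by (simp add: x_def)
    also have "\<dots> = (\<Sum>l<n. P $$ (i, l) * B $$ (l, 0))" using mi[OF P B i, of 0] n by simp
    also have "\<dots> = 0"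
      using low diag0 by (intro sum.neutral ballI) (metis lessThan_iff mult_zero_right neq0_conv)
    finally show ?thesis .
  qed
  define b where "b = B $$ (0, 1)"
  have Ly: "(\<Sum>j<n. L $$ (i, j) * y j) = b * x i" if i: "i < n" for i
  proof -
    have "(\<Sum>j<n. L $$ (i, j) * y j) = (P * B) $$ (i, 1)"
      unfolding LP[symmetric] using mi[OF L P i, of 1] n by (simp add: y_def)
    also have "\<dots> = (\<Sum>l<n. P $$ (i, l) * B $$ (l, 1))" using mi[OF P B i, of 1] n by simp
    also have "\<dots> = (\<Sum>l<n. if l = 0 then P $$ (i, 0) * b else 0)"
    proof (intro sum.cong refl)
      fix l assume "l \<in> {..<n}"
      then show "P $$ (i, l) * B $$ (l, 1) = (if l = 0 then P $$ (i, 0) * b else 0)"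
        using low[of 1 l] diag0 by (cases "l = 0"; cases "l = 1") (auto simp: b_def)
    qed
    finally show ?thesis using n by (simp add: x_def)
  qed
  have "(\<Sum>i<n. (b * x i)\<^sup>2) = (\<Sum>i<n. b * x i * (\<Sum>j<n. L $$ (i, j) * y j))"
    by (intro sum.cong refl) (simp add: Ly power2_eq_square)
  also have "\<dots> = (\<Sum>i<n. \<Sum>j<n. b * y j * (L $$ (j, i) * x i))"
    unfolding sum_distrib_left by (intro sum.cong refl) (simp add: sym mult_ac)
  also have "\<dots> = (\<Sum>j<n. b * y j * (\<Sum>i<n. L $$ (j, i) * x i))"
    unfolding sum_distrib_left by (rule sum.swap)
  also have "\<dots> = 0" by (intro sum.neutral ballI) (simp add: Lx)
  finally have "(\<Sum>i<n. (b * x i)\<^sup>2) = 0" .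
  then have "\<And>i. i < n \<Longrightarrow> b * x i = 0" by (subst (asm) sum_nonneg_eq_0_iff) auto
  then have Ly0: "(\<Sum>j<n. L $$ (i, j) * y j) = 0" if "i < n" for i using Ly that by simp
  \<comment> \<open>\<open>x\<close> and \<open>y\<close> are columns of the invertible matrix
    \<open>P\<close>; multiplying by its inverse \<open>Q\<close> reads off the
    coefficients.\<close>
  have indep: "\<alpha> = 0 \<and> \<beta> = 0" if z: "\<And>i. i < n \<Longrightarrow> \<alpha> * x i + \<beta> * y i = 0" for \<alpha> \<beta>
  proof -
    have comb: "\<alpha> * (Q * P) $$ (k, 0) + \<beta> * (Q * P) $$ (k, 1) = 0" if k: "k < n" for k
    proof -
      have "\<alpha> * (Q * P) $$ (k, 0) + \<beta> * (Q * P) $$ (k, 1) =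
          (\<Sum>i<n. Q $$ (k, i) * (\<alpha> * x i + \<beta> * y i))"
        using mi[OF Q P k, of 0] mi[OF Q P k, of 1] n
        by (simp add: x_def y_def sum_distrib_left sum.distrib algebra_simps)
      then show ?thesis using z by simp
    qed
    show ?thesis using comb[of 0] comb[of 1] n unfolding w(2) by simp
  qed
  show ?thesis
  proof (rule exI[of _ x], rule exI[of _ y], intro conjI allI impI)
    fix i assume "i < n"
    then show "(\<Sum>j<n. L $$ (i, j) * x j) = 0" "(\<Sum>j<n. L $$ (i, j) * y j) = 0"
      by (rule Lx, rule Ly0)
  next
    fix \<alpha> \<beta> assume "\<forall>i<n. \<alpha> * x i + \<beta> * y i = 0"
    then show "\<alpha> = 0" "\<beta> = 0" using indep[of \<alpha> \<beta>] by blast+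
  qed
qed

text \<open>Eigenvectors for nonzero eigenvalues are orthogonal to the kernel vector
  \<open>w\<close>, so \<open>form\<close> applies to them. What remains is to exclude
  \<open>0\<close> at positions beyond the first.\<close>

lemma symmetric_eigenvalues_close_to_one:
  fixes L :: "real mat" and w :: "nat \<Rightarrow> real"
  assumes L: "L \<in> carrier_mat n n" and sym: "\<And>i j. i < n \<Longrightarrow> j < n \<Longrightarrow> L $$ (i, j) = L $$ (j, i)"
    and w: "\<And>i. i < n \<Longrightarrow> (\<Sum>j<n. L $$ (i, j) * w j) = 0"
    and c: "c < 1"
    and form: "\<And>g. (\<Sum>i<n. g i * w i) = 0 \<Longrightarrow>
      \<bar>(\<Sum>i<n. (g i)\<^sup>2) - (\<Sum>i<n. g i * (\<Sum>j<n. L $$ (i, j) * g j))\<bar> \<le> c * (\<Sum>i<n. (g i)\<^sup>2)"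
    and i: "1 \<le> i" "i < n"
  shows "\<bar>1 - sorted_list_of_multiset (proots (char_poly L)) ! i\<bar> \<le> c"
proof -
  obtain es0 where es0: "char_poly L = (\<Prod>a\<leftarrow>es0. [:- a, 1:])" "length es0 = n"
    using real_symmetric_char_poly_splits[OF L sym] by blast
  define es where "es = sorted_list_of_multiset (proots (char_poly L))"
  have mset: "mset es = mset es0" by (simp add: es_def es0(1) proots_linear_factors)
  have len: "length es = n" using mset es0(2) by (metis size_mset)
  have srt: "sorted es" by (simp add: es_def)
  have cp: "char_poly L = (\<Prod>a\<leftarrow>es. [:- a, 1:])"
  proof -
    have "mset (map (\<lambda>a. [:- a, 1:]) es) = mset (map (\<lambda>a. [:- a, 1:]) es0)" by (simp add: mset)
    then show ?thesis unfolding es0(1) by (metis prod_mset_prod_list)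
  qed
  have nonzero: "\<bar>1 - e\<bar> \<le> c" if e: "e \<in> set es" "e \<noteq> 0" for e
  proof -
    have "poly (char_poly L) e = 0" unfolding cp using e(1) by (auto simp: poly_prod_list prod_list_zero_iff)
    then have "eigenvalue L e" using eigenvalue_root_char_poly[OF L] by simp
    then obtain v where v: "v \<in> carrier_vec n" "v \<noteq> 0\<^sub>v n" "L *\<^sub>v v = e \<cdot>\<^sub>v v"
      using L unfolding eigenvalue_def eigenvector_def by auto
    define g where "g j = vec_index v j" for j
    have Lg: "(\<Sum>j<n. L $$ (i, j) * g j) = e * g i" if "i < n" for i
      using mult_mat_vec_index[OF L v(1) that] v(1,3) that by (simp add: g_def)
    have "e * (\<Sum>i<n. g i * w i) = (\<Sum>i<n. (\<Sum>j<n. L $$ (i, j) * g j) * w i)"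
      unfolding sum_distrib_left by (intro sum.cong refl) (simp add: Lg)
    also have "\<dots> = (\<Sum>i<n. \<Sum>j<n. g j * (L $$ (j, i) * w i))"
      unfolding sum_distrib_right by (intro sum.cong refl) (simp add: sym mult_ac)
    also have "\<dots> = (\<Sum>j<n. g j * (\<Sum>i<n. L $$ (j, i) * w i))"
      unfolding sum_distrib_left by (rule sum.swap)
    also have "\<dots> = 0" by (intro sum.neutral ballI) (simp add: w)
    finally have orth: "(\<Sum>i<n. g i * w i) = 0" using e by simp
    have "(\<Sum>i<n. g i * (\<Sum>j<n. L $$ (i, j) * g j)) = (\<Sum>i<n. e * (g i)\<^sup>2)"
      by (intro sum.cong refl) (simp add: Lg power2_eq_square)
    then have quad: "(\<Sum>i<n. g i * (\<Sum>j<n. L $$ (i, j) * g j)) = e * (\<Sum>i<n. (g i)\<^sup>2)"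
      by (simp only: sum_distrib_left)
    have "\<bar>(1 - e) * (\<Sum>i<n. (g i)\<^sup>2)\<bar> \<le> c * (\<Sum>i<n. (g i)\<^sup>2)"
      using form[OF orth] unfolding quad by (simp add: left_diff_distrib)
    moreover have "(\<Sum>i<n. (g i)\<^sup>2) > 0"
    proof (rule ccontr)
      assume "\<not> ?thesis"
      then have "(\<Sum>i<n. (g i)\<^sup>2) = 0" by (simp add: not_less antisym sum_nonneg)
      then have "\<And>i. i < n \<Longrightarrow> g i = 0" by (subst (asm) sum_nonneg_eq_0_iff) auto
      then have "v = 0\<^sub>v n" using v(1) by (intro eq_vecI) (auto simp: g_def)
      then show False using v(2) by blast
    qed
    ultimately show ?thesis by (simp add: abs_mult)
  qed
  have n: "n \<ge> 2" using i by simp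
  show ?thesis
  proof (cases "es ! i = 0")
    case False
    moreover have "es ! i \<in> set es" using i len by simp
    ultimately show ?thesis unfolding es_def[symmetric] by (intro nonzero)
  next
    case True
    \<comment> \<open>Nonzero eigenvalues lie within \<open>c < 1\<close> of \<open>1\<close> and
      are thus positive, so nothing can precede a zero in the sorted list except zeros.\<close>
    have zero: "es ! k = 0" if "k \<le> i" for k
    proof (rule ccontr)
      assume nz: "es ! k \<noteq> 0"
      have "es ! k \<le> es ! i" using srt that i len by (intro sorted_nth_mono) auto
      then have "es ! k < 0" using nz True by simp
      moreover have "\<bar>1 - es ! k\<bar> \<le> c" using nz that i len by (intro nonzero) auto
      ultimately show False using c by linarith
    qed
    have "es ! 0 = 0" "es ! 1 = 0" using zero i by auto
    then have "\<exists>x y :: nat \<Rightarrow> real. (\<forall>i<n. (\<Sum>j<n. L $$ (i, j) * x j) = 0) \<and>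
      (\<forall>i<n. (\<Sum>j<n. L $$ (i, j) * y j) = 0) \<and>
      (\<forall>\<alpha> \<beta>. (\<forall>i<n. \<alpha> * x i + \<beta> * y i = 0) \<longrightarrow> \<alpha> = 0 \<and> \<beta> = 0)"
      by (intro symmetric_double_kernel[OF L _ cp n] sym)
    then obtain x y where xy: "\<forall>i<n. (\<Sum>j<n. L $$ (i, j) * x j) = 0"
      "\<forall>i<n. (\<Sum>j<n. L $$ (i, j) * y j) = 0"
      and indep: "\<forall>\<alpha> \<beta>. (\<forall>i<n. \<alpha> * x i + \<beta> * y i = 0) \<longrightarrow> \<alpha> = 0 \<and> \<beta> = 0"
      by (elim exE conjE)
    define sx sy where "sx = (\<Sum>i<n. x i * w i)" and "sy = (\<Sum>i<n. y i * w i)"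
    \<comment> \<open>A two-dimensional kernel contains a nonzero vector orthogonal to
      \<open>w\<close>; there \<open>form\<close> reads \<open>\<parallel>g\<parallel>^2 \<le> c *
      \<parallel>g\<parallel>^2\<close>, which contradicts \<open>c < 1\<close>.\<close>
    obtain \<alpha> \<beta> where ab: "\<alpha> * sx + \<beta> * sy = 0" "\<alpha> \<noteq> 0 \<or> \<beta> \<noteq> 0"
    proof (cases "sx = 0 \<and> sy = 0")
      case True
      then show thesis using that[of 1 0] by simp
    next
      case False
      then show thesis by (intro that[of sy "- sx"]) auto
    qed
    define g where "g i = \<alpha> * x i + \<beta> * y i" for i
    have "(\<Sum>i<n. g i * w i) = 0"
      using ab(1) by (simp add: g_def sx_def sy_def sum_distrib_left sum.distrib algebra_simps)
    note form[OF this]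
    moreover have "(\<Sum>j<n. L $$ (i, j) * g j) = 0" if "i < n" for i
    proof -
      have "(\<Sum>j<n. L $$ (i, j) * g j) = \<alpha> * (\<Sum>j<n. L $$ (i, j) * x j) + \<beta> * (\<Sum>j<n. L $$ (i, j) * y j)"
        by (simp add: g_def sum_distrib_left sum.distrib algebra_simps)
      then show ?thesis using xy that by simp
    qed
    ultimately have "(\<Sum>i<n. (g i)\<^sup>2) \<le> c * (\<Sum>i<n. (g i)\<^sup>2)" by simp
    then have "(1 - c) * (\<Sum>i<n. (g i)\<^sup>2) \<le> 0" by (simp add: left_diff_distrib)
    then have "(\<Sum>i<n. (g i)\<^sup>2) \<le> 0" using c by (simp add: mult_le_0_iff)
    then have "(\<Sum>i<n. (g i)\<^sup>2) = 0" by (simp add: antisym sum_nonneg)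
    then have "\<And>i. i < n \<Longrightarrow> g i = 0" by (subst (asm) sum_nonneg_eq_0_iff) auto
    then have "\<forall>i<n. \<alpha> * x i + \<beta> * y i = 0" by (simp add: g_def)
    then have "\<alpha> = 0 \<and> \<beta> = 0" by (rule indep[THEN spec, THEN spec, THEN mp])
    then show ?thesis using ab(2) by blast
  qed
qed

section \<open>Spectra of components\<close>

lemma normalized_laplacian_carrier: "normalized_laplacian V E \<in> carrier_mat (card V) (card V)"
proof -
  have "adjacency_matrix V E \<in> carrier_mat (card V) (card V)" by (simp add: adjacency_matrix_def)
  then show ?thesis
    unfolding normalized_laplacian_def inv_sqrt_degree_matrix_def
    by (intro minus_carrier_mat mult_carrier_mat[of _ "card V" "card V"] mat_diag_dim)
qed

context
  fixes n :: nat and E :: "nat set set" and U :: "nat set"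
  assumes E: "E \<subseteq> vertex_pairs n" and U: "U \<in> components {..<n} E"
begin

lemma component_subset: "U \<subseteq> {..<n}"
  using U by (auto simp: components_def quotient_def)

lemma finite_component: "finite U"
  using component_subset finite_subset by blast

lemma component_closed:
  assumes "u \<in> U" "{u, v} \<in> E"
  shows "v \<in> U"
proof -
  have "v < n" using assms E by (auto simp: vertex_pairs_def)
  then show ?thesis
    using U assms unfolding components_def quotient_def
    by (auto intro: rtrancl_into_rtrancl)
qed

lemma component_connected:
  assumes "u \<in> U" "v \<in> U"
  shows "(u, v) \<in> {(x, y). {x, y} \<in> E}\<^sup>*"
proof -
  have sym: "sym {(x, y). {x, y} \<in> E}" by (auto simp: sym_def insert_commute)
  obtain x where "(x, u) \<in> {(x, y). {x, y} \<in> E}\<^sup>*" "(x, v) \<in> {(x, y). {x, y} \<in> E}\<^sup>*"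
    using U assms unfolding components_def quotient_def by auto
  then show ?thesis using sym_rtrancl[OF sym] by (meson rtrancl_trans symD)
qed

lemma degree_of_component:
  assumes "v \<in> U"
  shows "degree_of U (induced_edges E U) v = degree_of {..<n} E v"
proof -
  have "{u \<in> U. {u, v} \<in> induced_edges E U} = {u \<in> {..<n}. {u, v} \<in> E}"
    using assms component_subset component_closed[OF assms]
    by (auto simp: induced_edges_def insert_commute)
  then show ?thesis by (simp add: degree_of_def)
qed

lemma degree_pos:
  assumes "v \<in> U" "card U \<ge> 2"
  shows "degree_of {..<n} E v > 0"
proof -
  have "U - {v} \<noteq> {}"
  proof
    assume "U - {v} = {}"
    then have "card U \<le> card {v}" by (intro card_mono) auto
    then show False using assms(2) by simp
  qed
  then obtain u where u: "u \<in> U" "u \<noteq> v" by blast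
  have "(v, u) \<in> {(x, y). {x, y} \<in> E}\<^sup>*" by (rule component_connected[OF assms(1) u(1)])
  then obtain z where z: "{v, z} \<in> E" using u(2) by (auto elim: converse_rtranclE)
  then have "z \<in> {u \<in> {..<n}. {u, v} \<in> E}"
    using component_closed[OF assms(1) z] component_subset by (auto simp: insert_commute)
  then show ?thesis unfolding degree_of_def by (subst card_gt_0_iff) auto
qed

lemma bij_betw_vertex: "bij_betw (vertex U) {..<card U} U"
proof -
  have "bij_betw ((!) (sorted_list_of_set U)) {..<length (sorted_list_of_set U)} (set (sorted_list_of_set U))"
    by (rule bij_betw_nth) (auto simp: finite_component)
  then show ?thesis unfolding vertex_def[abs_def] by (simp add: finite_component)
qed

text \<open>Translates between matrix indices of the component and vertices of the whole
  graph.\<close>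

lemma sum_vertex:
  fixes F :: "nat \<Rightarrow> real"
  assumes "\<And>u. u < n \<Longrightarrow> u \<notin> U \<Longrightarrow> F u = 0"
  shows "(\<Sum>i<card U. F (vertex U i)) = (\<Sum>u<n. F u)"
proof -
  have "(\<Sum>i<card U. F (vertex U i)) = (\<Sum>u\<in>U. F u)"
    by (rule sum.reindex_bij_betw[OF bij_betw_vertex])
  also have "\<dots> = (\<Sum>u<n. F u)"
    using component_subset assms by (intro sum.mono_neutral_left) auto
  finally show ?thesis .
qed

lemma vertex_mem: "i < card U \<Longrightarrow> vertex U i \<in> U"
  using bij_betw_vertex by (auto simp: bij_betw_def)

lemma adj_outside: "u \<in> U \<Longrightarrow> v \<notin> U \<Longrightarrow> adj E u v = 0"
  using component_closed[of u v] by (auto simp: adj_def)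

text \<open>A connected graph on two or more vertices has no isolated vertex, so the projection is
  the identity; degrees inside a component agree with those in the whole graph.\<close>

lemma normalized_laplacian_entry:
  assumes c: "card U \<ge> 2" and ij: "i < card U" "j < card U"
  shows "normalized_laplacian U (induced_edges E U) $$ (i, j) =
    (if i = j then 1 else 0) - adj E (vertex U i) (vertex U j)
      / (sqrt (deg n E (vertex U i)) * sqrt (deg n E (vertex U j)))"
proof -
  let ?A = "adjacency_matrix U (induced_edges E U)"
  define N where "N = card U"
  define r where "r k = (if degree_of U (induced_edges E U) (vertex U k) = 0 then 0
      else 1 / sqrt (real (degree_of U (induced_edges E U) (vertex U k))))" for k
  have A: "?A \<in> carrier_mat N N" by (simp add: adjacency_matrix_def N_def)
  have D: "inv_sqrt_degree_matrix U (induced_edges E U) = mat_diag N r"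
    by (simp add: inv_sqrt_degree_matrix_def r_def[abs_def] N_def)
  have ijN: "i < N" "j < N" using ij by (simp_all add: N_def)
  have DA: "mat_diag N r * ?A = Matrix.mat N N (\<lambda>(i, j). r i * ?A $$ (i, j))"
    by (rule mat_diag_mult_left[OF A])
  have "mat_diag N r * ?A * mat_diag N r = Matrix.mat N N (\<lambda>(i, j). (mat_diag N r * ?A) $$ (i, j) * r j)"
    by (rule mat_diag_mult_right, rule mult_carrier_mat[OF mat_diag_dim A])
  then have prod: "(mat_diag N r * ?A * mat_diag N r) $$ (i, j) = r i * ?A $$ (i, j) * r j"
    using ijN by (simp add: DA)
  have dim: "mat_diag N r * ?A * mat_diag N r \<in> carrier_mat N N"
    using A by (intro mult_carrier_mat[of _ N N]) auto
  have pos: "degree_of U (induced_edges E U) (vertex U k) > 0" if "k < card U" for k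
    using degree_pos[OF vertex_mem[OF that] c] degree_of_component[OF vertex_mem[OF that]] by simp
  have "?A $$ (i, j) = adj E (vertex U i) (vertex U j)"
    using ij vertex_mem by (auto simp: adjacency_matrix_def adj_def induced_edges_def)
  moreover have "r k = 1 / sqrt (deg n E (vertex U k))" if "k < card U" for k
    using pos[OF that] degree_of_component[OF vertex_mem[OF that]] by (simp add: r_def)
  moreover have "positive_degree_projection U (induced_edges E U) $$ (i, j) = (if i = j then 1 else 0)"
    using ij pos by (auto simp: positive_degree_projection_def mat_diag_def)
  moreover have "normalized_laplacian U (induced_edges E U) $$ (i, j) =
      positive_degree_projection U (induced_edges E U) $$ (i, j) - (mat_diag N r * ?A * mat_diag N r) $$ (i, j)"
    unfolding normalized_laplacian_def D
    by (rule index_minus_mat) (simp_all only: carrier_matD[OF dim] ijN)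
  ultimately show ?thesis using ij by (simp only: prod) simp
qed

text \<open>The kernel vector of the Laplacian is \<open>sqrt deg\<close> restricted to the
  component. The global form bound reaches the component by extending vectors by zero.\<close>

lemma spectral_lambda_le:
  assumes form: "\<And>f. (\<Sum>i<n. sqrt (deg n E i) * f i) = 0 \<Longrightarrow>
      \<bar>bilin n (adj E) (\<lambda>i. f i / sqrt (deg n E i)) (\<lambda>i. f i / sqrt (deg n E i))\<bar> \<le> c * sqn n f"
    and c: "0 \<le> c" "c < 1"
  shows "spectral_lambda U (induced_edges E U) \<le> c"
proof (cases "card U \<le> 1")
  case True
  then show ?thesis using c by (simp add: spectral_lambda_def)
next
  case False
  then have N: "card U \<ge> 2" by simp
  define N where "N = card U"
  define L where "L = normalized_laplacian U (induced_edges E U)"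
  define v where "v = vertex U"
  define s where "s u = sqrt (deg n E u)" for u
  have dimL: "L \<in> carrier_mat N N"
    unfolding L_def N_def by (rule normalized_laplacian_carrier)
  have vU: "v i \<in> U" if "i < N" for i using vertex_mem that by (simp add: v_def N_def)
  have s_pos: "s u > 0" if "u \<in> U" for u using degree_pos[OF that N] by (simp add: s_def)
  have entry: "L $$ (i, j) = (if i = j then 1 else 0) - adj E (v i) (v j) / (s (v i) * s (v j))"
    if "i < N" "j < N" for i j
    using normalized_laplacian_entry[OF N] that by (simp add: L_def v_def s_def N_def)
  have transfer: "(\<Sum>i<N. F (v i)) = (\<Sum>u<n. F u)" if "\<And>u. u < n \<Longrightarrow> u \<notin> U \<Longrightarrow> F u = 0" for F :: "nat \<Rightarrow> real"
    using sum_vertex[of F] that by (simp add: N_def v_def)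
  have row: "(\<Sum>j<N. L $$ (i, j) * g j) = g i - (\<Sum>j<N. adj E (v i) (v j) / (s (v i) * s (v j)) * g j)"
    if "i < N" for i g
  proof -
    have "(\<Sum>j<N. L $$ (i, j) * g j) = (\<Sum>j<N. (if j = i then g i else 0) - adj E (v i) (v j) / (s (v i) * s (v j)) * g j)"
      using that by (intro sum.cong refl) (auto simp: entry left_diff_distrib)
    then show ?thesis using that by (simp add: sum_subtractf)
  qed
  have "\<bar>1 - laplacian_eigenvalues U (induced_edges E U) ! k\<bar> \<le> c" if k: "1 \<le> k" "k < N" for k
    unfolding laplacian_eigenvalues_def L_def[symmetric]
  proof (rule symmetric_eigenvalues_close_to_one[OF dimL _ _ c(2) _ k, where w = "\<lambda>i. s (v i)"])
    show "L $$ (i, j) = L $$ (j, i)" if "i < N" "j < N" for i j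
      using that by (simp add: entry adj_commute[of E "v i"] mult.commute)
    show "(\<Sum>j<N. L $$ (i, j) * s (v j)) = 0" if i: "i < N" for i
    proof -
      have "(\<Sum>j<N. adj E (v i) (v j) / (s (v i) * s (v j)) * s (v j)) = (\<Sum>j<N. adj E (v i) (v j) / s (v i))"
        using s_pos vU by (intro sum.cong refl) (auto simp: less_imp_neq[THEN not_sym])
      also have "\<dots> = (\<Sum>u<n. adj E (v i) u / s (v i))"
        by (rule transfer) (simp add: adj_outside vU i)
      also have "\<dots> = deg n E (v i) / s (v i)"
        by (simp add: deg_eq_sum_adj adj_commute[of E "v i"] sum_divide_distrib)
      also have "\<dots> = s (v i)" using real_div_sqrt[of "deg n E (v i)"] by (simp add: s_def)
      finally show ?thesis using row[OF i, of "\<lambda>j. s (v j)"] by simp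
    qed
    fix g :: "nat \<Rightarrow> real" assume orth: "(\<Sum>i<N. g i * s (v i)) = 0"
    have bij: "bij_betw v {..<N} U" using bij_betw_vertex by (simp add: v_def N_def)
    \<comment> \<open>Extension by zero keeps orthogonality to \<open>sqrt deg\<close>, the norm and
      the value of the form.\<close>
    define f where "f u = (if u \<in> U then g (the_inv_into {..<N} v u) else 0)" for u
    have fv: "f (v i) = g i" if "i < N" for i
      using bij that vU by (simp add: f_def bij_betw_def the_inv_into_f_f)
    have "(\<Sum>u<n. s u * f u) = (\<Sum>i<N. s (v i) * f (v i))" by (rule transfer[symmetric]) (simp add: f_def)
    also have "\<dots> = 0" using orth by (simp add: fv mult.commute)
    finally have f0: "(\<Sum>u<n. s u * f u) = 0" .
    have "(\<Sum>u<n. (f u)\<^sup>2) = (\<Sum>i<N. (f (v i))\<^sup>2)" by (rule transfer[symmetric]) (simp add: f_def)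
    then have sq: "sqn n f = (\<Sum>i<N. (g i)\<^sup>2)" by (simp add: sqn_def fv)
    have "bilin n (adj E) (\<lambda>u. f u / s u) (\<lambda>u. f u / s u)
        = (\<Sum>i<N. \<Sum>w<n. adj E (v i) w * (f (v i) / s (v i)) * (f w / s w))"
      unfolding bilin_def by (rule transfer[symmetric]) (simp add: f_def)
    also have "\<dots> = (\<Sum>i<N. \<Sum>j<N. adj E (v i) (v j) * (f (v i) / s (v i)) * (f (v j) / s (v j)))"
      by (intro sum.cong refl transfer[symmetric]) (simp add: f_def)
    also have "\<dots> = (\<Sum>i<N. g i * (\<Sum>j<N. adj E (v i) (v j) / (s (v i) * s (v j)) * g j))"
      unfolding sum_distrib_left by (intro sum.cong refl) (simp add: fv)
    also have "\<dots> = (\<Sum>i<N. (g i)\<^sup>2) - (\<Sum>i<N. g i * (\<Sum>j<N. L $$ (i, j) * g j))"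
    proof -
      have "(\<Sum>i<N. g i * (\<Sum>j<N. L $$ (i, j) * g j)) =
          (\<Sum>i<N. (g i)\<^sup>2 - g i * (\<Sum>j<N. adj E (v i) (v j) / (s (v i) * s (v j)) * g j))"
        by (intro sum.cong refl) (simp add: row right_diff_distrib power2_eq_square)
      then show ?thesis by (simp add: sum_subtractf)
    qed
    finally show "\<bar>(\<Sum>i<N. (g i)\<^sup>2) - (\<Sum>i<N. g i * (\<Sum>j<N. L $$ (i, j) * g j))\<bar> \<le> c * (\<Sum>i<N. (g i)\<^sup>2)"
      using form[of f] f0 sq by (simp add: s_def)
  qed
  then have "Max ((\<lambda>i. \<bar>1 - laplacian_eigenvalues U (induced_edges E U) ! i\<bar>) ` {1..<card U}) \<le> c"
    using N by (intro Max.boundedI) (auto simp: N_def)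
  then show ?thesis using False by (simp add: spectral_lambda_def)
qed

end

section \<open>The spectral gap of the giant component\<close>

text \<open>The indicator function is almost surely \<open>False\<close> outside
  \<open>vertex_pairs n\<close>, so the edge set determines it and the product formula for its mass
  applies.\<close>

lemma pmf_gnp:
  assumes p: "0 \<le> p" "p \<le> 1" and E: "E \<subseteq> vertex_pairs n"
  shows "pmf (gnp n p) E = p ^ card E * (1 - p) ^ card (vertex_pairs n - E)"
proof -
  let ?P = "vertex_pairs n"
  let ?M = "Pi_pmf ?P False (\<lambda>_. bernoulli_pmf p)"
  have "pmf (gnp n p) E = measure_pmf.prob ?M ((\<lambda>f. {e \<in> ?P. f e}) -` {E})"
    unfolding gnp_def by (rule pmf_map)
  also have "\<dots> = measure_pmf.prob ?M {\<lambda>e. e \<in> E}"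
  proof (rule measure_pmf.finite_measure_eq_AE)
    show "AE f in ?M. (f \<in> (\<lambda>f. {e \<in> ?P. f e}) -` {E}) = (f \<in> {\<lambda>e. e \<in> E})"
    proof (rule AE_pmfI)
      fix f assume "f \<in> set_pmf ?M"
      then have "\<And>e. e \<notin> ?P \<Longrightarrow> f e = False"
        using set_Pi_pmf_subset[of ?P False "\<lambda>_. bernoulli_pmf p"] by auto
      then show "(f \<in> (\<lambda>f. {e \<in> ?P. f e}) -` {E}) = (f \<in> {\<lambda>e. e \<in> E})"
        using E by (auto simp: fun_eq_iff)
    qed
  qed auto
  also have "\<dots> = (\<Prod>e\<in>?P. pmf (bernoulli_pmf p) (e \<in> E))"
    using E by (auto simp: measure_pmf_single pmf_Pi)
  also have "\<dots> = (\<Prod>e\<in>?P. if e \<in> E then p else 1 - p)"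
    using p by (intro prod.cong) auto
  also have "\<dots> = p ^ card E * (1 - p) ^ card (?P - E)"
    using E by (simp add: prod.If_cases Int_absorb1 Diff_eq)
  finally show ?thesis .
qed

lemma prob_gnp:
  assumes p: "0 \<le> p" "p \<le> 1"
  shows "measure_pmf.prob (gnp n p) S = expect (vertex_pairs n) p (\<lambda>E. of_bool (E \<in> S))"
proof -
  let ?P = "vertex_pairs n"
  have "set_pmf (gnp n p) \<subseteq> Pow ?P" by (auto simp: gnp_def)
  then have "measure_pmf.prob (gnp n p) S = measure_pmf.prob (gnp n p) (S \<inter> Pow ?P)"
    by (intro measure_pmf.finite_measure_eq_AE AE_pmfI) auto
  also have "\<dots> = (\<Sum>E\<in>S \<inter> Pow ?P. pmf (gnp n p) E)"
    by (rule measure_measure_pmf_finite) auto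
  also have "\<dots> = (\<Sum>E\<in>Pow ?P. pmf (gnp n p) E * of_bool (E \<in> S))"
    by (intro sum.mono_neutral_cong_left) auto
  also have "\<dots> = expect ?P p (\<lambda>E. of_bool (E \<in> S))"
    unfolding expect_def by (intro sum.cong refl) (simp add: pmf_gnp[OF p])
  finally show ?thesis .
qed

lemma prob_gnp_ge_union_bound:
  assumes p: "0 \<le> p" "p \<le> 1"
    and good: "\<And>E. E \<subseteq> vertex_pairs n \<Longrightarrow> \<not> A E \<Longrightarrow> \<not> B E \<Longrightarrow> E \<in> S"
  shows "1 - expect (vertex_pairs n) p (\<lambda>E. of_bool (A E)) - expect (vertex_pairs n) p (\<lambda>E. of_bool (B E))
    \<le> measure_pmf.prob (gnp n p) S"
proof -
  let ?P = "vertex_pairs n"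
  have "1 = measure_pmf.prob (gnp n p) UNIV" by (simp add: measure_pmf.prob_eq_1)
  also have "\<dots> = expect ?P p (\<lambda>E. of_bool (E \<in> UNIV))" by (rule prob_gnp[OF p])
  also have "\<dots> \<le> expect ?P p (\<lambda>E. of_bool (E \<in> S) + (of_bool (A E) + of_bool (B E)))"
    using good by (intro expect_mono p) auto
  finally show ?thesis unfolding prob_gnp[OF p] by (simp add: expect_add)
qed

theorem theorem1p1:
  fixes \<delta> \<epsilon> :: real
  assumes "\<delta> > 0" and "\<epsilon> > 0"
  shows "\<exists>C::real. \<forall>(n::nat) (p::real) (d::real).
    n \<ge> 2 \<longrightarrow> 0 \<le> p \<longrightarrow> p \<le> 1 \<longrightarrow>
    p \<ge> (1/2 + \<delta>) * ln (real n) / real n \<longrightarrow>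
    d = p * (real n - 1) \<longrightarrow>
    measure_pmf.prob (gnp n p)
      {E. \<forall>U. largest_component {..<n} E U \<longrightarrow>
             spectral_lambda U (induced_edges E U) < C / sqrt d}
      \<ge> 1 - C * real n * exp (- (2 - \<epsilon>) * d) - C * exp (- (d powr (1/4)) * ln (real n))"
proof -
  obtain \<eta> K :: real where \<eta>: "0 < \<eta>" "\<eta> \<le> 1/2" and K: "K \<ge> 0"
    and crowded: "\<And>n p d. n \<ge> 2 \<Longrightarrow> 0 \<le> p \<Longrightarrow> p \<le> 1 \<Longrightarrow> d = p * (real n - 1) \<Longrightarrow>
      expect (vertex_pairs n) p (\<lambda>E. of_bool (crowded n (\<eta> * d) E)) \<le> K * real n * exp (- (2 - \<epsilon>) * d)"
    using crowded_tail[OF assms(2)] by metis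
  define c where "c = 3 * exp 2 * trace_const"
  have c: "c \<ge> 0" using trace_const_pos by (simp add: c_def)
  define C2 where "C2 = 2 / sqrt \<eta> + sqrt c / \<eta> + 1 / \<eta> + 16 * c * \<eta> + 4 * c / \<eta>"
  have C2: "C2 \<ge> 0" using \<eta> c by (simp add: C2_def)
  \<comment> \<open>For \<open>d \<ge> D0\<close> both \<open>d \<ge> 1\<close> and
    \<open>C2 / sqrt d < 1\<close> hold; the latter is needed to exclude a second zero
    eigenvalue.\<close>
  define D0 where "D0 = 1 + C2\<^sup>2"
  \<comment> \<open>\<open>K + 1\<close> collects the two failure probabilities,
    \<open>exp (2 * D0)\<close> trivialises the claim for \<open>d < D0\<close>, and
    \<open>C2\<close> bounds the spectrum, with the positive rest making it strict.\<close>
  define C where "C = K + 1 + exp (2 * D0) + C2"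
  show ?thesis
  proof (intro exI[of _ C] allI impI)
    fix n :: nat and p d :: real
    assume n: "n \<ge> 2" and p: "0 \<le> p" "p \<le> 1" and d: "d = p * (real n - 1)"
    let ?S = "{E. \<forall>U. largest_component {..<n} E U \<longrightarrow> spectral_lambda U (induced_edges E U) < C / sqrt d}"
    let ?e = "exp (- (2 - \<epsilon>) * d)"
    have d0: "d \<ge> 0" using n p d by simp
    have C0: "C \<ge> 0" using K C2 by (simp add: C_def)
    have e: "exp (- 2 * d) \<le> ?e" using d0 assms(2) by (simp add: algebra_simps)
    have "1 - C * real n * ?e \<le> measure_pmf.prob (gnp n p) ?S"
    \<comment> \<open>For bounded \<open>d\<close> the subtracted term \<open>C * n * ?e\<close> is
      already at least \<open>1\<close>.\<close>
    proof (cases "d < D0")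
      case True
      have "1 = exp (2 * D0) * 1 * exp (- 2 * D0)" by (simp add: mult_exp_exp)
      also have "\<dots> \<le> C * real n * ?e"
      proof (intro mult_mono)
        show "exp (2 * D0) \<le> C" using K C2 by (simp add: C_def)
        show "exp (- 2 * D0) \<le> ?e" using True e by (intro order_trans[OF _ e]) simp
      qed (use n C0 in auto)
      finally show ?thesis using measure_nonneg[of "measure_pmf (gnp n p)" ?S] by linarith
    next
      case False
      have d1: "d \<ge> 1" using False by (simp add: D0_def) (smt (verit) zero_le_power2)
      have small: "C2 / sqrt d < 1"
      proof -
        have "C2\<^sup>2 < d" using False by (simp add: D0_def)
        then have "C2 < sqrt d" by (rule real_less_rsqrt)
        then show ?thesis using d1 by simp
      qed
      \<comment> \<open>Rounding \<open>n * p\<close> up gives \<open>k \<ge> d\<close>, so the tail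
        \<open>exp (- 2 * k)\<close> is small enough, and \<open>k \<le> 3 * d\<close> keeps the
        squared norm bound of order \<open>d\<close>.\<close>
      define k where "k = nat \<lceil>real n * p\<rceil>"
      have dn: "d \<le> real n * p" using p by (simp add: d algebra_simps)
      have k: "real n * p \<le> real k" "real k \<le> real n * p + 1" "k > 0"
        using dn d1 by (auto simp: k_def)
      have np: "real n * p \<le> 2 * d"
      proof -
        have "p * real n \<le> p * (2 * (real n - 1))" using n p by (intro mult_left_mono) auto
        then show ?thesis by (simp add: d algebra_simps)
      qed
      have T: "exp 2 * trace_const * real k \<le> c * d"
      proof -
        have "real k \<le> 3 * d" using k np d1 by linarith
        then have "exp 2 * trace_const * real k \<le> exp 2 * trace_const * (3 * d)"
          using trace_const_pos by (intro mult_left_mono) auto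
        then show ?thesis by (simp add: c_def mult_ac)
      qed
      let ?A = "\<lambda>E. \<exists>v. sqn n (matvec n (edge_mat (1 - p) (- p) E) v) > exp 2 * trace_const * real k * sqn n v"
      have "1 - expect (vertex_pairs n) p (\<lambda>E. of_bool (?A E)) - expect (vertex_pairs n) p (\<lambda>E. of_bool (crowded n (\<eta> * d) E))
          \<le> measure_pmf.prob (gnp n p) ?S"
      proof (rule prob_gnp_ge_union_bound[OF p], clarify)
        fix E U assume E: "E \<subseteq> vertex_pairs n" and A: "\<not> ?A E" and B: "\<not> crowded n (\<eta> * d) E"
          and U: "largest_component {..<n} E U"
        have norm: "sqn n (matvec n (edge_mat (1 - p) (- p) E) v) \<le> c * d * sqn n v" for v
          using A mult_right_mono[OF T, of "sqn n v"] by (auto simp: not_less intro: order_trans)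
        have "spectral_lambda U (induced_edges E U) \<le> C2 / sqrt d"
        proof (rule spectral_lambda_le[OF E])
          show "U \<in> components {..<n} E" using U by (simp add: largest_component_def)
          show "\<bar>bilin n (adj E) (\<lambda>i. f i / sqrt (deg n E i)) (\<lambda>i. f i / sqrt (deg n E i))\<bar>
              \<le> C2 / sqrt d * sqn n f" if "(\<Sum>i<n. sqrt (deg n E i) * f i) = 0" for f
            unfolding C2_def
            by (rule laplacian_form_le[OF E n p(1) d d1 p(2) \<eta> B norm c that])
        qed (use small C2 d0 in auto)
        also have "\<dots> < C / sqrt d"
          using d1 K by (intro divide_strict_right_mono) (auto simp: C_def intro: add_nonneg_pos)
        finally show "spectral_lambda U (induced_edges E U) < C / sqrt d" .
      qed
      moreover have "expect (vertex_pairs n) p (\<lambda>E. of_bool (?A E)) \<le> real n * ?e"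
      proof -
        have "expect (vertex_pairs n) p (\<lambda>E. of_bool (?A E)) \<le> real n * exp (- 2 * real k)"
          by (rule centred_matrix_norm_tail[OF p k(3,1)])
        also have "\<dots> \<le> real n * ?e"
          using k(1) dn by (intro mult_left_mono order_trans[OF _ e]) auto
        finally show ?thesis .
      qed
      moreover have "expect (vertex_pairs n) p (\<lambda>E. of_bool (crowded n (\<eta> * d) E)) \<le> K * real n * ?e"
        by (rule crowded[OF n p d])
      moreover have "(K + 1) * (real n * ?e) \<le> C * (real n * ?e)"
        using C2 by (intro mult_right_mono) (auto simp: C_def)
      ultimately show ?thesis by (simp add: algebra_simps)
    qed
    moreover have "0 \<le> C * exp (- (d powr (1/4)) * ln (real n))" using C0 by simp
    ultimately show "measure_pmf.prob (gnp n p) ?S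
        \<ge> 1 - C * real n * ?e - C * exp (- (d powr (1/4)) * ln (real n))" by linarith
  qed
qed

end
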